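(* Let $\mathcal K$ be a representable plumbus with enhanced 2-classifier $u:\Omega_\bullet\to\Omega$, and let $(T,i,m)$ be an opfibrantly cartesian enhanced 2-monad on $\mathcal K$, so that $u$, with its canonical lax $T$-algebra structure, is an enhanced 2-classifier of $\mathrm{LaxAlg}(T)$. Let $b:X\rightsquigarrow B$ be a colax $T$-morphism such that the representable discrete opfibration $\partial_1:b/B\to B$ is a small discrete opfibration in $\mathrm{LaxAlg}(T)$. Then the representable copresheaf $B(b,-):=d(\partial_1):B\rightsquigarrow\Omega$ associated to it is always a lax $T$-morphism, and it is pseudo precisely when $B$ is $T$-cartesian at $b$.
   Context: Enhanced 2-categories. An enhanced 2-category $\mathcal K$ is a 2-category, whose 1-cells are called loose (written $\rightsquigarrow$), with a wide and locally full sub-2-category whose 1-cells are called tight (written $\to$). It is repletely enhanced if $f$ tight and $f\cong g$ imply $g$ tight. An enhanced 2-monad $(T,i,m)$ is a 2-monad with $T$ preserving tight 1-cells and $i,m$ having tight components. A tight terminal object is a terminal object $1$ all of whose maps $X\to 1$ are tight. Algebras. A lax $T$-algebra is $(A,\alpha,\upsilon,\mu)$ with $\alpha:TA\to A$ tight, $\upsilon:\mathrm{id}_A\Rightarrow\alpha i_A$ and $\mu:\alpha\circ T\alpha\Rightarrow\alpha\circ m_A$ such that $(\mu\, i_{TA})(\upsilon\alpha)=\mathrm{id}_\alpha$, $(\mu\, Ti_A)(\alpha\, T\upsilon)=\mathrm{id}_\alpha$, $(\mu\, m_{TA})(\mu\, T^2\alpha)=(\mu\, Tm_A)(\alpha\,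 T\mu)$. A lax $T$-morphism $(f,\bar f):(A,\alpha)\rightsquigarrow(B,\beta)$ is a loose $f$ with $\bar f:\beta\circ Tf\Rightarrow f\circ\alpha$ such that $f\upsilon_A=(\bar f i_A)(\upsilon_B f)$ and $(f\mu_A)(\bar f\,T\alpha)(\beta\,T\bar f)=(\bar f m_A)(\mu_B\,T^2f)$; it is pseudo if $\bar f$ is invertible and strict if $\bar f$ is an identity. A colax $T$-morphism is defined analogously with structure 2-cell $\bar f:f\circ\alpha\Rightarrow\beta\circ Tf$. A $T$-2-morphism $f\Rightarrow f'$ of lax morphisms is a 2-cell $\varphi$ with $(\varphi\alpha)\bar f=\bar f'(\beta\,T\varphi)$. $\mathrm{LaxAlg}(T)$ is the enhanced 2-category of lax $T$-algebras, lax $T$-morphisms as loose 1-cells, pseudo-$T$-morphisms with tight underlying 1-cell as tight 1-cells, and $T$-2-morphisms. Discrete opfibrations and plumbuses. A tight discrete opfibration is a tight $p:E\to B$ such that for all $e:X\rightsquigarrow E$, $b:X\rightsquigarrow B$, $\varphi:pe\Rightarrow b$ there is a unique 2-cell $\lambda$ with domain $e$ and $p\lambda=\varphi$. A left-tight pullback of a tight $f:B\to C$ along a loose $g:A\rightsquigarrow C$ is a (strict 2-categorical) pullback whose projection $p_A$ to $A$ is tight and detects tightness: $h$ is tight whenever $p_Ah$ is. A smallness structure is a class of tight discrete opfibrations, called small, stable under left-tight pullback along arbitrary loose 1-cells, with strictly functorial chosen such pullbacks. A plumbus is a repletely enhanced 2-category with a tight terminal object and a smallness structure. $\mathrm{LaxAlg}(T)$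 is a plumbus whose small discrete opfibrations are the strict $T$-morphisms whose underlying map is small in $\mathcal K$. Representability. An enhanced 2-classifier is a small discrete opfibration $u:\Omega_\bullet\to\Omega$ such that: (1) every small $p:E\to B$ has a chosen pullback square $(d_\bullet p:E\rightsquigarrow\Omega_\bullet,\ dp:B\rightsquigarrow\Omega)$ from $p$ to $u$; (2) for every commuting square $(g,f)$ with loose sides from small $p$ to small $p'$ there is a unique pair of 2-cells $\gamma_\bullet:d_\bullet p\Rightarrow d_\bullet p'\circ g$, $\gamma:dp\Rightarrow dp'\circ f$ with $u\gamma_\bullet=\gamma p$; (3) these are invertible if the square is a pullback; (4) $(d_\bullet u,du)\cong(\mathrm{id},\mathrm{id})$ compatibly with $u$. The map $dp$ is the classifying map of $p$. A plumbus with an enhanced 2-classifier is representable; one always assumes then that $\mathrm{id}_1$ is small. $(T,i,m)$ is opfibrantly cartesian if (A) $Tu$ is a small discrete opfibration, (B) $T$ preserves pullbacks of $u$, (C) $\omega:=d(Tu):T\Omega\to\Omega$ is tight. The canonical lax algebra structures on $\Omega_\bullet,\Omega$ have structure maps $\omega_\bullet:=d_\bullet(Tu)$ and $\omega$, with unitors the unique pair of 2-cells $\mathrm{id}\Rightarrow\omega_\bullet i$, $\mathrm{id}\Rightarrow\omega i$ and multiplicators the unique pair $\omega_\bullet T\omega_\bullet\Rightarrow\omega_\bullet m$, $\omega T\omega\Rightarrow\omega m$ compatible with $u$; then $u$ is strict. Representable opfibrations and cartesianness. For $b:X\rightsquigarrow B$, the representable discrete opfibration at $b$ is the projection $\partial_1:b/B\to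 B$ out of the comma object of $b$ and $\mathrm{id}_B$, with universal 2-cell $\kappa:b\partial_0\Rightarrow\partial_1$. If $(X,\xi)$, $(B,\beta)$ are $T$-algebras and $b$ is colax with $\bar b:b\xi\Rightarrow\beta\,Tb$, the algebra map $\bar b/\beta:T(b/B)\to b/B$ is the one induced by $\xi\,T\partial_0$, $\beta\,T\partial_1$ and the 2-cell $(\beta\,T\kappa)(\bar b\,T\partial_0)$. For a strict $T$-morphism $f:(A,\alpha)\to(B,\beta)$, its $T$-cartesianness defect is the comparison map $\delta_f:TA\to\beta^*A$ into the pullback of $f$ along $\beta$ induced by $Tf$ and $\alpha$; $f$ is $T$-cartesian if $\delta_f$ is a split equivalence, i.e. there are $j$ and an isomorphism $j\delta_f\cong\mathrm{id}$ with $\delta_f j=\mathrm{id}$. $(B,\beta)$ is $T$-cartesian at $b$ if $\partial_1:b/B\to B$ is a $T$-cartesian morphism; this means that $T(b/B)$ is split-equivalent to the pullback of $\partial_1$ along $\beta$ and that the resulting map $\bar b/\beta$ makes $b/B$ a $T$-algebra of the appropriate kind. *)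

theory Defs
  imports Main
begin

section \<open>Enhanced 2-categories\<close>

text \<open>
  Strict 2-categories are presented by a set of objects, a set of (loose) 1-cells, a subset of tight
  1-cells, and a set of 2-cells. All compositions are written in applicative order: \<open>g \<odot> f\<close> is
  \<open>g\<close> after \<open>f\<close>, \<open>\<psi> \<bullet> \<phi>\<close> is the vertical composite \<open>\<phi>\<close> followed by \<open>\<psi>\<close>, and \<open>\<psi> \<star> \<phi>\<close> is
  the horizontal composite. The operations are only meaningful on composable arguments. The tight
  sub-2-category is wide and locally full, so it is determined by its set of 1-cells.
\<close>

record ('o, 'm, 'c) e2cat =
  Obj :: "'o set"
  Loose :: "'m set"
  Tight :: "'m set"
  Cell :: "'c set"
  Dom :: "'m \<Rightarrow> 'o"
  Cod :: "'m \<Rightarrow> 'o"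
  Src :: "'c \<Rightarrow> 'm"
  Tgt :: "'c \<Rightarrow> 'm"
  Id1 :: "'o \<Rightarrow> 'm"
  Cmp :: "'m \<Rightarrow> 'm \<Rightarrow> 'm" (infixr "\<odot>\<index>" 75)
  Id2 :: "'m \<Rightarrow> 'c"
  Vcmp :: "'c \<Rightarrow> 'c \<Rightarrow> 'c" (infixr "\<bullet>\<index>" 65)
  Hcmp :: "'c \<Rightarrow> 'c \<Rightarrow> 'c" (infixr "\<star>\<index>" 70)

abbreviation lwhisker :: "('o, 'm, 'c, 'x) e2cat_scheme \<Rightarrow> 'm \<Rightarrow> 'c \<Rightarrow> 'c" (infixr "\<rhd>\<index>" 72)
  where "f \<rhd>\<^bsub>K\<^esub> \<phi> \<equiv> Id2 K f \<star>\<^bsub>K\<^esub> \<phi>"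

abbreviation rwhisker :: "('o, 'm, 'c, 'x) e2cat_scheme \<Rightarrow> 'c \<Rightarrow> 'm \<Rightarrow> 'c" (infixl "\<lhd>\<index>" 73)
  where "\<phi> \<lhd>\<^bsub>K\<^esub> f \<equiv> \<phi> \<star>\<^bsub>K\<^esub> Id2 K f"

definition hom :: "('o, 'm, 'c, 'x) e2cat_scheme \<Rightarrow> 'o \<Rightarrow> 'o \<Rightarrow> 'm set"
  where "hom K A B = {f \<in> Loose K. Dom K f = A \<and> Cod K f = B}"

definition cells :: "('o, 'm, 'c, 'x) e2cat_scheme \<Rightarrow> 'm \<Rightarrow> 'm \<Rightarrow> 'c set"
  where "cells K f g = {\<phi> \<in> Cell K. Src K \<phi> = f \<and> Tgt K \<phi> = g}"

definition iso2 :: "('o, 'm, 'c, 'x) e2cat_scheme \<Rightarrow> 'c \<Rightarrow> bool"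
  where "iso2 K \<phi> \<longleftrightarrow> \<phi> \<in> Cell K \<and>
    (\<exists>\<psi> \<in> cells K (Tgt K \<phi>) (Src K \<phi>).
       \<psi> \<bullet>\<^bsub>K\<^esub> \<phi> = Id2 K (Src K \<phi>) \<and> \<phi> \<bullet>\<^bsub>K\<^esub> \<psi> = Id2 K (Tgt K \<phi>))"

locale enhanced_2category =
  fixes K :: "('o, 'm, 'c, 'x) e2cat_scheme" (structure)
  assumes Dom_Obj: "f \<in> Loose K \<Longrightarrow> Dom K f \<in> Obj K"
    and Cod_Obj: "f \<in> Loose K \<Longrightarrow> Cod K f \<in> Obj K"
    and Id1_hom: "A \<in> Obj K \<Longrightarrow> Id1 K A \<in> hom K A A"
    and Cmp_hom: "\<lbrakk>g \<in> hom K B C; f \<in> hom K A B\<rbrakk> \<Longrightarrow> g \<odot> f \<in> hom K A C"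
    and Cmp_Id1: "f \<in> hom K A B \<Longrightarrow> f \<odot> Id1 K A = f"
    and Id1_Cmp: "f \<in> hom K A B \<Longrightarrow> Id1 K B \<odot> f = f"
    and Cmp_assoc: "\<lbrakk>h \<in> hom K C D; g \<in> hom K B C; f \<in> hom K A B\<rbrakk>
        \<Longrightarrow> (h \<odot> g) \<odot> f = h \<odot> (g \<odot> f)"
    and Src_Loose: "\<phi> \<in> Cell K \<Longrightarrow> Src K \<phi> \<in> Loose K"
    and Tgt_Loose: "\<phi> \<in> Cell K \<Longrightarrow> Tgt K \<phi> \<in> Loose K"
    and Cell_Dom: "\<phi> \<in> Cell K \<Longrightarrow> Dom K (Tgt K \<phi>) = Dom K (Src K \<phi>)"
    and Cell_Cod: "\<phi> \<in> Cell K \<Longrightarrow> Cod K (Tgt K \<phi>) = Cod K (Src K \<phi>)"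
    and Id2_cells: "f \<in> Loose K \<Longrightarrow> Id2 K f \<in> cells K f f"
    and Vcmp_cells: "\<lbrakk>\<psi> \<in> cells K g h; \<phi> \<in> cells K f g\<rbrakk> \<Longrightarrow> \<psi> \<bullet> \<phi> \<in> cells K f h"
    and Vcmp_Id2: "\<phi> \<in> cells K f g \<Longrightarrow> \<phi> \<bullet> Id2 K f = \<phi>"
    and Id2_Vcmp: "\<phi> \<in> cells K f g \<Longrightarrow> Id2 K g \<bullet> \<phi> = \<phi>"
    and Vcmp_assoc: "\<lbrakk>\<chi> \<in> cells K h k; \<psi> \<in> cells K g h; \<phi> \<in> cells K f g\<rbrakk>
        \<Longrightarrow> (\<chi> \<bullet> \<psi>) \<bullet> \<phi> = \<chi> \<bullet> (\<psi> \<bullet> \<phi>)"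
    and Hcmp_cells: "\<lbrakk>\<psi> \<in> cells K g g'; \<phi> \<in> cells K f f'; Dom K g = Cod K f\<rbrakk>
        \<Longrightarrow> \<psi> \<star> \<phi> \<in> cells K (g \<odot> f) (g' \<odot> f')"
    and Hcmp_Id2: "\<lbrakk>g \<in> Loose K; f \<in> Loose K; Dom K g = Cod K f\<rbrakk>
        \<Longrightarrow> Id2 K g \<star> Id2 K f = Id2 K (g \<odot> f)"
    and Hcmp_Id1: "\<lbrakk>\<phi> \<in> cells K f g; f \<in> hom K A B\<rbrakk> \<Longrightarrow> \<phi> \<star> Id2 K (Id1 K A) = \<phi>"
    and Id1_Hcmp: "\<lbrakk>\<phi> \<in> cells K f g; f \<in> hom K A B\<rbrakk> \<Longrightarrow> Id2 K (Id1 K B) \<star> \<phi> = \<phi>"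
    and Hcmp_assoc: "\<lbrakk>\<chi> \<in> cells K h h'; \<psi> \<in> cells K g g'; \<phi> \<in> cells K f f';
         Dom K h = Cod K g; Dom K g = Cod K f\<rbrakk>
        \<Longrightarrow> (\<chi> \<star> \<psi>) \<star> \<phi> = \<chi> \<star> (\<psi> \<star> \<phi>)"
    and interchange: "\<lbrakk>\<psi>' \<in> cells K g' g''; \<psi> \<in> cells K g g';
         \<phi>' \<in> cells K f' f''; \<phi> \<in> cells K f f'; Dom K g = Cod K f\<rbrakk>
        \<Longrightarrow> (\<psi>' \<bullet> \<psi>) \<star> (\<phi>' \<bullet> \<phi>) = (\<psi>' \<star> \<phi>') \<bullet> (\<psi> \<star> \<phi>)"
    and Tight_Loose: "Tight K \<subseteq> Loose K"
    and Id1_Tight: "A \<in> Obj K \<Longrightarrow> Id1 K A \<in> Tight K"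
    and Cmp_Tight: "\<lbrakk>g \<in> Tight K; f \<in> Tight K; Dom K g = Cod K f\<rbrakk> \<Longrightarrow> g \<odot> f \<in> Tight K"

locale repletely_enhanced_2category = enhanced_2category K
  for K :: "('o, 'm, 'c, 'x) e2cat_scheme" (structure) +
  assumes replete: "\<lbrakk>f \<in> Tight K; \<phi> \<in> cells K f g; iso2 K \<phi>\<rbrakk> \<Longrightarrow> g \<in> Tight K"

context
  fixes K :: "('o, 'm, 'c, 'x) e2cat_scheme" (structure)
begin

definition tight_terminal :: "'o \<Rightarrow> bool"
  where "tight_terminal Z \<longleftrightarrow> Z \<in> Obj K \<and>
    (\<forall>A \<in> Obj K. \<exists>!f. f \<in> hom K A Z) \<and>
    (\<forall>A \<in> Obj K. \<forall>f \<in> hom K A Z. f \<in> Tight K \<and> cells K f f = {Id2 K f})"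

definition tight_discrete_opfibration :: "'m \<Rightarrow> bool"
  where "tight_discrete_opfibration p \<longleftrightarrow> p \<in> Tight K \<and>
    (\<forall>X. \<forall>e \<in> hom K X (Dom K p). \<forall>b \<in> hom K X (Cod K p). \<forall>\<phi> \<in> cells K (p \<odot> e) b.
       \<exists>!\<nu>. \<nu> \<in> Cell K \<and> Src K \<nu> = e \<and> p \<rhd> \<nu> = \<phi>)"

text \<open>
  \<open>pullback f g q p\<close>: the square \<open>f \<odot> q = g \<odot> p\<close> is a strict 2-categorical pullback of
  \<open>f\<close> along \<open>g\<close>; \<open>p\<close> is the projection parallel to \<open>f\<close>, that is, the projection to the domain of \<open>g\<close>.
\<close>

definition pullback :: "'m \<Rightarrow> 'm \<Rightarrow> 'm \<Rightarrow> 'm \<Rightarrow> bool"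
  where "pullback f g q p \<longleftrightarrow>
    f \<in> Loose K \<and> g \<in> Loose K \<and> Cod K f = Cod K g \<and>
    q \<in> hom K (Dom K p) (Dom K f) \<and> p \<in> hom K (Dom K p) (Dom K g) \<and> f \<odot> q = g \<odot> p \<and>
    (\<forall>X. \<forall>x \<in> hom K X (Dom K f). \<forall>y \<in> hom K X (Dom K g). f \<odot> x = g \<odot> y \<longrightarrow>
       (\<exists>!h. h \<in> hom K X (Dom K p) \<and> q \<odot> h = x \<and> p \<odot> h = y)) \<and>
    (\<forall>X. \<forall>h \<in> hom K X (Dom K p). \<forall>h' \<in> hom K X (Dom K p).
       \<forall>\<sigma> \<in> cells K (q \<odot> h) (q \<odot> h'). \<forall>\<tau> \<in> cells K (p \<odot> h) (p \<odot> h').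
       f \<rhd> \<sigma> = g \<rhd> \<tau> \<longrightarrow> (\<exists>!\<theta>. \<theta> \<in> cells K h h' \<and> q \<rhd> \<theta> = \<sigma> \<and> p \<rhd> \<theta> = \<tau>))"

definition left_tight_pullback :: "'m \<Rightarrow> 'm \<Rightarrow> 'm \<Rightarrow> 'm \<Rightarrow> bool"
  where "left_tight_pullback f g q p \<longleftrightarrow> f \<in> Tight K \<and> pullback f g q p \<and> p \<in> Tight K \<and>
    (\<forall>X. \<forall>h \<in> hom K X (Dom K p). p \<odot> h \<in> Tight K \<longrightarrow> h \<in> Tight K)"

definition comma_object :: "'m \<Rightarrow> 'm \<Rightarrow> 'm \<Rightarrow> 'm \<Rightarrow> 'c \<Rightarrow> bool"
  where "comma_object f g p q \<kappa> \<longleftrightarrow>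
    f \<in> Loose K \<and> g \<in> Loose K \<and> Cod K f = Cod K g \<and>
    p \<in> hom K (Dom K p) (Dom K f) \<and> q \<in> hom K (Dom K p) (Dom K g) \<and>
    \<kappa> \<in> cells K (f \<odot> p) (g \<odot> q) \<and>
    (\<forall>X. \<forall>x \<in> hom K X (Dom K f). \<forall>y \<in> hom K X (Dom K g). \<forall>\<sigma> \<in> cells K (f \<odot> x) (g \<odot> y).
       \<exists>!h. h \<in> hom K X (Dom K p) \<and> p \<odot> h = x \<and> q \<odot> h = y \<and> \<kappa> \<lhd> h = \<sigma>) \<and>
    (\<forall>X. \<forall>h \<in> hom K X (Dom K p). \<forall>h' \<in> hom K X (Dom K p).
       \<forall>\<rho> \<in> cells K (p \<odot> h) (p \<odot> h'). \<forall>\<tau> \<in> cells K (q \<odot> h) (q \<odot> h').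
       (\<kappa> \<lhd> h') \<bullet> (f \<rhd> \<rho>) = (g \<rhd> \<tau>) \<bullet> (\<kappa> \<lhd> h) \<longrightarrow>
         (\<exists>!\<theta>. \<theta> \<in> cells K h h' \<and> p \<rhd> \<theta> = \<rho> \<and> q \<rhd> \<theta> = \<tau>))"

definition split_equivalence :: "'m \<Rightarrow> bool"
  where "split_equivalence s \<longleftrightarrow> s \<in> Loose K \<and>
    (\<exists>j \<in> hom K (Cod K s) (Dom K s). s \<odot> j = Id1 K (Cod K s) \<and>
       (\<exists>\<theta> \<in> cells K (j \<odot> s) (Id1 K (Dom K s)). iso2 K \<theta>))"

end

section \<open>Plumbuses and enhanced 2-classifiers\<close>

text \<open>
  For small \<open>p\<close> and loose \<open>g\<close> into the codomain of \<open>p\<close>, the chosen left-tight pullback of \<open>p\<close>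
  along \<open>g\<close> has projections \<open>PbProj p g\<close> to the domain of \<open>g\<close> and \<open>PbTop p g\<close> to the domain of \<open>p\<close>.
\<close>

record ('o, 'm, 'c) plumbus = "('o, 'm, 'c) e2cat" +
  One :: "'o"
  Small :: "'m set"
  PbProj :: "'m \<Rightarrow> 'm \<Rightarrow> 'm"
  PbTop :: "'m \<Rightarrow> 'm \<Rightarrow> 'm"

locale plumbus = repletely_enhanced_2category K
  for K :: "('o, 'm, 'c, 'x) plumbus_scheme" (structure) +
  assumes terminal: "tight_terminal K (One K)"
    and Small_opfib: "p \<in> Small K \<Longrightarrow> tight_discrete_opfibration K p"
    and Small_stable: "\<lbrakk>p \<in> Small K; left_tight_pullback K p g q p'\<rbrakk> \<Longrightarrow> p' \<in> Small K"
    and chosen: "\<lbrakk>p \<in> Small K; g \<in> hom K A (Cod K p)\<rbrakk>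
        \<Longrightarrow> left_tight_pullback K p g (PbTop K p g) (PbProj K p g)"
    and PbProj_Id1: "p \<in> Small K \<Longrightarrow> PbProj K p (Id1 K (Cod K p)) = p"
    and PbTop_Id1: "p \<in> Small K \<Longrightarrow> PbTop K p (Id1 K (Cod K p)) = Id1 K (Dom K p)"
    and PbProj_Cmp: "\<lbrakk>p \<in> Small K; g \<in> hom K A (Cod K p); h \<in> hom K A' A\<rbrakk>
        \<Longrightarrow> PbProj K p (g \<odot> h) = PbProj K (PbProj K p g) h"
    and PbTop_Cmp: "\<lbrakk>p \<in> Small K; g \<in> hom K A (Cod K p); h \<in> hom K A' A\<rbrakk>
        \<Longrightarrow> PbTop K p (g \<odot> h) = PbTop K p g \<odot> PbTop K (PbProj K p g) h"

text \<open>
  \<open>clsf\<close> is \<open>u : \<Omega>\<^sub>\<bullet> \<rightarrow> \<Omega>\<close>; \<open>dtop p\<close> and \<open>dmap p\<close> are \<open>d\<^sub>\<bullet>p\<close> and the classifying map \<open>dp\<close>.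
\<close>

record 'm classifier =
  clsf :: "'m"
  dtop :: "'m \<Rightarrow> 'm"
  dmap :: "'m \<Rightarrow> 'm"

definition classifying_cells ::
  "('o, 'm, 'c, 'x) plumbus_scheme \<Rightarrow> 'm classifier \<Rightarrow> 'm \<Rightarrow> 'm \<Rightarrow> 'm \<Rightarrow> 'm \<Rightarrow> 'c \<times> 'c \<Rightarrow> bool"
  where "classifying_cells K C p p' g f = (\<lambda>(\<gamma>', \<gamma>).
    \<gamma>' \<in> cells K (dtop C p) (dtop C p' \<odot>\<^bsub>K\<^esub> g) \<and> \<gamma> \<in> cells K (dmap C p) (dmap C p' \<odot>\<^bsub>K\<^esub> f) \<and>
    clsf C \<rhd>\<^bsub>K\<^esub> \<gamma>' = \<gamma> \<lhd>\<^bsub>K\<^esub> p)"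

locale enhanced_2classifier = plumbus K
  for K :: "('o, 'm, 'c, 'x) plumbus_scheme" (structure) +
  fixes C :: "'m classifier"
  assumes clsf_Small: "clsf C \<in> Small K"
    and classify: "p \<in> Small K \<Longrightarrow> pullback K (clsf C) (dmap C p) (dtop C p) p"
    and classify_square: "\<lbrakk>p \<in> Small K; p' \<in> Small K;
          g \<in> hom K (Dom K p) (Dom K p'); f \<in> hom K (Cod K p) (Cod K p'); p' \<odot> g = f \<odot> p\<rbrakk>
        \<Longrightarrow> \<exists>!\<gamma>\<gamma>. classifying_cells K C p p' g f \<gamma>\<gamma>"
    and classify_pullback: "\<lbrakk>p \<in> Small K; p' \<in> Small K; pullback K p' f g p;
          classifying_cells K C p p' g f (\<gamma>', \<gamma>)\<rbrakk> \<Longrightarrow> iso2 K \<gamma>' \<and> iso2 K \<gamma>"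
    and classify_clsf: "\<exists>\<phi>' \<in> cells K (dtop C (clsf C)) (Id1 K (Dom K (clsf C))).
          \<exists>\<phi> \<in> cells K (dmap C (clsf C)) (Id1 K (Cod K (clsf C))).
            iso2 K \<phi>' \<and> iso2 K \<phi> \<and> clsf C \<rhd> \<phi>' = \<phi> \<lhd> clsf C"

locale representable_plumbus = enhanced_2classifier K C
  for K :: "('o, 'm, 'c, 'x) plumbus_scheme" (structure) and C :: "'m classifier" +
  assumes Id_One_Small: "Id1 K (One K) \<in> Small K"

section \<open>Enhanced 2-monads and their lax algebras\<close>

record ('o, 'm, 'c) monad_data =
  T0 :: "'o \<Rightarrow> 'o"
  T1 :: "'m \<Rightarrow> 'm"
  T2 :: "'c \<Rightarrow> 'c"
  eta :: "'o \<Rightarrow> 'm"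
  mul :: "'o \<Rightarrow> 'm"

locale enhanced_2monad = enhanced_2category K
  for K :: "('o, 'm, 'c, 'x) e2cat_scheme" (structure) +
  fixes M :: "('o, 'm, 'c) monad_data"
  assumes T0_Obj: "A \<in> Obj K \<Longrightarrow> T0 M A \<in> Obj K"
    and T1_hom: "f \<in> hom K A B \<Longrightarrow> T1 M f \<in> hom K (T0 M A) (T0 M B)"
    and T1_Tight: "f \<in> Tight K \<Longrightarrow> T1 M f \<in> Tight K"
    and T1_Id1: "A \<in> Obj K \<Longrightarrow> T1 M (Id1 K A) = Id1 K (T0 M A)"
    and T1_Cmp: "\<lbrakk>g \<in> hom K B D; f \<in> hom K A B\<rbrakk> \<Longrightarrow> T1 M (g \<odot> f) = T1 M g \<odot> T1 M f"
    and T2_cells: "\<phi> \<in> cells K f g \<Longrightarrow> T2 M \<phi> \<in> cells K (T1 M f) (T1 M g)"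
    and T2_Id2: "f \<in> Loose K \<Longrightarrow> T2 M (Id2 K f) = Id2 K (T1 M f)"
    and T2_Vcmp: "\<lbrakk>\<psi> \<in> cells K g h; \<phi> \<in> cells K f g\<rbrakk> \<Longrightarrow> T2 M (\<psi> \<bullet> \<phi>) = T2 M \<psi> \<bullet> T2 M \<phi>"
    and T2_Hcmp: "\<lbrakk>\<psi> \<in> cells K g g'; \<phi> \<in> cells K f f'; Dom K g = Cod K f\<rbrakk>
        \<Longrightarrow> T2 M (\<psi> \<star> \<phi>) = T2 M \<psi> \<star> T2 M \<phi>"
    and eta_hom: "A \<in> Obj K \<Longrightarrow> eta M A \<in> hom K A (T0 M A)"
    and eta_Tight: "A \<in> Obj K \<Longrightarrow> eta M A \<in> Tight K"
    and eta_natural: "f \<in> hom K A B \<Longrightarrow> eta M B \<odot> f = T1 M f \<odot> eta M A"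
    and eta_natural2: "\<lbrakk>f \<in> hom K A B; \<phi> \<in> cells K f g\<rbrakk> \<Longrightarrow> eta M B \<rhd> \<phi> = T2 M \<phi> \<lhd> eta M A"
    and mul_hom: "A \<in> Obj K \<Longrightarrow> mul M A \<in> hom K (T0 M (T0 M A)) (T0 M A)"
    and mul_Tight: "A \<in> Obj K \<Longrightarrow> mul M A \<in> Tight K"
    and mul_natural: "f \<in> hom K A B \<Longrightarrow> mul M B \<odot> T1 M (T1 M f) = T1 M f \<odot> mul M A"
    and mul_natural2: "\<lbrakk>f \<in> hom K A B; \<phi> \<in> cells K f g\<rbrakk>
        \<Longrightarrow> mul M B \<rhd> T2 M (T2 M \<phi>) = T2 M \<phi> \<lhd> mul M A"
    and mul_eta: "A \<in> Obj K \<Longrightarrow> mul M A \<odot> eta M (T0 M A) = Id1 K (T0 M A)"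
    and mul_T_eta: "A \<in> Obj K \<Longrightarrow> mul M A \<odot> T1 M (eta M A) = Id1 K (T0 M A)"
    and mul_mul: "A \<in> Obj K \<Longrightarrow> mul M A \<odot> mul M (T0 M A) = mul M A \<odot> T1 M (mul M A)"

record ('o, 'm, 'c) lalg =
  carr :: "'o"
  act :: "'m"
  unitor :: "'c"
  multor :: "'c"

record ('o, 'm, 'c) lmor =
  ldom :: "('o, 'm, 'c) lalg"
  lcod :: "('o, 'm, 'c) lalg"
  lmap :: "'m"
  lcell :: "'c"

record ('o, 'm, 'c) lcell2 =
  lsrc :: "('o, 'm, 'c) lmor"
  ltgt :: "('o, 'm, 'c) lmor"
  lund :: "'c"

context
  fixes K :: "('o, 'm, 'c, 'x) e2cat_scheme" (structure)
    and M :: "('o, 'm, 'c) monad_data"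
begin

definition lax_algebra :: "('o, 'm, 'c) lalg \<Rightarrow> bool"
  where "lax_algebra A \<longleftrightarrow>
    (let a = act A; X = carr A; \<upsilon> = unitor A; \<mu> = multor A in
      X \<in> Obj K \<and> a \<in> hom K (T0 M X) X \<and> a \<in> Tight K \<and>
      \<upsilon> \<in> cells K (Id1 K X) (a \<odot> eta M X) \<and>
      \<mu> \<in> cells K (a \<odot> T1 M a) (a \<odot> mul M X) \<and>
      (\<mu> \<lhd> eta M (T0 M X)) \<bullet> (\<upsilon> \<lhd> a) = Id2 K a \<and>
      (\<mu> \<lhd> T1 M (eta M X)) \<bullet> (a \<rhd> T2 M \<upsilon>) = Id2 K a \<and>
      (\<mu> \<lhd> mul M (T0 M X)) \<bullet> (\<mu> \<lhd> T1 M (T1 M a)) =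
        (\<mu> \<lhd> T1 M (mul M X)) \<bullet> (a \<rhd> T2 M \<mu>))"

definition lax_morphism :: "('o, 'm, 'c) lmor \<Rightarrow> bool"
  where "lax_morphism F \<longleftrightarrow>
    (let A = ldom F; B = lcod F; f = lmap F; fb = lcell F; a = act A; b = act B in
      lax_algebra A \<and> lax_algebra B \<and> f \<in> hom K (carr A) (carr B) \<and>
      fb \<in> cells K (b \<odot> T1 M f) (f \<odot> a) \<and>
      f \<rhd> unitor A = (fb \<lhd> eta M (carr A)) \<bullet> (unitor B \<lhd> f) \<and>
      (f \<rhd> multor A) \<bullet> (fb \<lhd> T1 M a) \<bullet> (b \<rhd> T2 M fb) =
        (fb \<lhd> mul M (carr A)) \<bullet> (multor B \<lhd> T1 M (T1 M f)))"

definition colax_morphism :: "('o, 'm, 'c) lmor \<Rightarrow> bool"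
  where "colax_morphism F \<longleftrightarrow>
    (let A = ldom F; B = lcod F; f = lmap F; fb = lcell F; a = act A; b = act B in
      lax_algebra A \<and> lax_algebra B \<and> f \<in> hom K (carr A) (carr B) \<and>
      fb \<in> cells K (f \<odot> a) (b \<odot> T1 M f) \<and>
      (fb \<lhd> eta M (carr A)) \<bullet> (f \<rhd> unitor A) = unitor B \<lhd> f \<and>
      (fb \<lhd> mul M (carr A)) \<bullet> (f \<rhd> multor A) =
        (multor B \<lhd> T1 M (T1 M f)) \<bullet> (b \<rhd> T2 M fb) \<bullet> (fb \<lhd> T1 M a))"

definition pseudo_morphism :: "('o, 'm, 'c) lmor \<Rightarrow> bool"
  where "pseudo_morphism F \<longleftrightarrow> lax_morphism F \<and> iso2 K (lcell F)"

definition strict_morphism :: "('o, 'm, 'c) lmor \<Rightarrow> bool"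
  where "strict_morphism F \<longleftrightarrow> lax_morphism F \<and> lcell F = Id2 K (lmap F \<odot> act (ldom F))"

definition lax_2morphism :: "('o, 'm, 'c) lcell2 \<Rightarrow> bool"
  where "lax_2morphism P \<longleftrightarrow>
    (let F = lsrc P; G = ltgt P; \<phi> = lund P in
      lax_morphism F \<and> lax_morphism G \<and> ldom G = ldom F \<and> lcod G = lcod F \<and>
      \<phi> \<in> cells K (lmap F) (lmap G) \<and>
      (\<phi> \<lhd> act (ldom F)) \<bullet> lcell F = lcell G \<bullet> (act (lcod F) \<rhd> T2 M \<phi>))"

definition lax_Id1 :: "('o, 'm, 'c) lalg \<Rightarrow> ('o, 'm, 'c) lmor"
  where "lax_Id1 A =
    \<lparr>ldom = A, lcod = A, lmap = Id1 K (carr A), lcell = Id2 K (act A)\<rparr>"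

definition lax_Cmp :: "('o, 'm, 'c) lmor \<Rightarrow> ('o, 'm, 'c) lmor \<Rightarrow> ('o, 'm, 'c) lmor"
  where "lax_Cmp G F =
    \<lparr>ldom = ldom F, lcod = lcod G, lmap = lmap G \<odot> lmap F,
     lcell = (lmap G \<rhd> lcell F) \<bullet> (lcell G \<lhd> T1 M (lmap F))\<rparr>"

definition LaxAlg ::
  "(('o, 'm, 'c) lalg, ('o, 'm, 'c) lmor, ('o, 'm, 'c) lcell2) e2cat"
  where "LaxAlg =
    \<lparr>Obj = {A. lax_algebra A},
     Loose = {F. lax_morphism F},
     Tight = {F. pseudo_morphism F \<and> lmap F \<in> Tight K},
     Cell = {P. lax_2morphism P},
     Dom = ldom, Cod = lcod, Src = lsrc, Tgt = ltgt,
     Id1 = lax_Id1, Cmp = lax_Cmp,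
     Id2 = (\<lambda>F. \<lparr>lsrc = F, ltgt = F, lund = Id2 K (lmap F)\<rparr>),
     Vcmp = (\<lambda>Q P. \<lparr>lsrc = lsrc P, ltgt = ltgt Q, lund = lund Q \<bullet> lund P\<rparr>),
     Hcmp = (\<lambda>Q P. \<lparr>lsrc = lax_Cmp (lsrc Q) (lsrc P), ltgt = lax_Cmp (ltgt Q) (ltgt P),
                    lund = lund Q \<star> lund P\<rparr>)\<rparr>"

text \<open>
  The representable opfibration of a colax morphism \<open>(b, bb) : X \<leadsto> B\<close> with respect to a comma
  object \<open>d0, d1, \<kappa>\<close> of \<open>b\<close> and the identity. Since \<open>Id1 \<odot> d1 = d1\<close>, the 2-cell \<open>\<kappa>\<close> has target \<open>d1\<close>.
\<close>

definition comma_act :: "('o, 'm, 'c) lmor \<Rightarrow> 'm \<Rightarrow> 'm \<Rightarrow> 'c \<Rightarrow> 'm"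
  where "comma_act F d0 d1 \<kappa> =
    (THE h. h \<in> hom K (T0 M (Dom K d0)) (Dom K d0) \<and>
       d0 \<odot> h = act (ldom F) \<odot> T1 M d0 \<and>
       d1 \<odot> h = act (lcod F) \<odot> T1 M d1 \<and>
       \<kappa> \<lhd> h = (act (lcod F) \<rhd> T2 M \<kappa>) \<bullet> (lcell F \<lhd> T1 M d0))"

definition comma_algebra ::
  "('o, 'm, 'c) lmor \<Rightarrow> 'm \<Rightarrow> 'm \<Rightarrow> 'c \<Rightarrow> 'c \<Rightarrow> 'c \<Rightarrow> ('o, 'm, 'c) lalg"
  where "comma_algebra F d0 d1 \<kappa> \<upsilon> \<mu> =
    \<lparr>carr = Dom K d0, act = comma_act F d0 d1 \<kappa>, unitor = \<upsilon>, multor = \<mu>\<rparr>"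

definition strict_lmor :: "('o, 'm, 'c) lalg \<Rightarrow> ('o, 'm, 'c) lalg \<Rightarrow> 'm \<Rightarrow> ('o, 'm, 'c) lmor"
  where "strict_lmor A B f = \<lparr>ldom = A, lcod = B, lmap = f, lcell = Id2 K (f \<odot> act A)\<rparr>"

end

section \<open>Small opfibrations and the classifier in lax algebras\<close>

context
  fixes K :: "('o, 'm, 'c, 'x) plumbus_scheme" (structure)
    and M :: "('o, 'm, 'c) monad_data"
begin

definition LaxAlg_Small :: "('o, 'm, 'c) lmor set"
  where "LaxAlg_Small = {F. strict_morphism K M F \<and> lmap F \<in> Small K}"

definition cartesianness_defect :: "('o, 'm, 'c) lmor \<Rightarrow> 'm"
  where "cartesianness_defect F =
    (let f = lmap F; b = act (lcod F) in
      THE h. h \<in> hom K (T0 M (carr (ldom F))) (Dom K (PbProj K f b)) \<and>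
        PbProj K f b \<odot> h = T1 M f \<and> PbTop K f b \<odot> h = act (ldom F))"

text \<open>
  The pullback \<open>\<beta>\<^sup>*A\<close> is the one chosen by the smallness structure, so this is only meaningful
  for strict morphisms whose underlying 1-cell is small.
\<close>

definition T_cartesian :: "('o, 'm, 'c) lmor \<Rightarrow> bool"
  where "T_cartesian F \<longleftrightarrow> strict_morphism K M F \<and> split_equivalence K (cartesianness_defect F)"

definition opfibrantly_cartesian :: "'m classifier \<Rightarrow> bool"
  where "opfibrantly_cartesian C \<longleftrightarrow>
    T1 M (clsf C) \<in> Small K \<and>
    (\<forall>g q p. pullback K (clsf C) g q p \<longrightarrow>
       pullback K (T1 M (clsf C)) (T1 M g) (T1 M q) (T1 M p)) \<and>
    dmap C (T1 M (clsf C)) \<in> Tight K"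

text \<open>
  The structure 2-cells of the canonical lax algebras are the unique pairs compatible with \<open>u\<close>; in
  each pair the first component belongs to \<open>\<Omega>\<^sub>\<bullet>\<close> and the second to \<open>\<Omega>\<close>.
\<close>

definition canonical_unitors :: "'m classifier \<Rightarrow> 'c \<times> 'c"
  where "canonical_unitors C =
    (let u = clsf C; W' = Dom K u; W = Cod K u; w' = dtop C (T1 M u); w = dmap C (T1 M u) in
      THE (\<upsilon>', \<upsilon>). \<upsilon>' \<in> cells K (Id1 K W') (w' \<odot> eta M W') \<and>
        \<upsilon> \<in> cells K (Id1 K W) (w \<odot> eta M W) \<and> u \<rhd> \<upsilon>' = \<upsilon> \<lhd> u)"

definition canonical_multors :: "'m classifier \<Rightarrow> 'c \<times> 'c"
  where "canonical_multors C =
    (let u = clsf C; W' = Dom K u; W = Cod K u; w' = dtop C (T1 M u); w = dmap C (T1 M u) in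
      THE (\<mu>', \<mu>). \<mu>' \<in> cells K (w' \<odot> T1 M w') (w' \<odot> mul M W') \<and>
        \<mu> \<in> cells K (w \<odot> T1 M w) (w \<odot> mul M W) \<and> u \<rhd> \<mu>' = \<mu> \<lhd> T1 M (T1 M u))"

definition Omega_top :: "'m classifier \<Rightarrow> ('o, 'm, 'c) lalg"
  where "Omega_top C =
    \<lparr>carr = Dom K (clsf C), act = dtop C (T1 M (clsf C)),
     unitor = fst (canonical_unitors C), multor = fst (canonical_multors C)\<rparr>"

definition Omega :: "'m classifier \<Rightarrow> ('o, 'm, 'c) lalg"
  where "Omega C =
    \<lparr>carr = Cod K (clsf C), act = dmap C (T1 M (clsf C)),
     unitor = snd (canonical_unitors C), multor = snd (canonical_multors C)\<rparr>"

definition lax_clsf :: "'m classifier \<Rightarrow> ('o, 'm, 'c) lmor"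
  where "lax_clsf C = strict_lmor K (Omega_top C) (Omega C) (clsf C)"

text \<open>
  \<open>(G, H)\<close> is the classifying square, in \<open>LaxAlg\<close>, of the small discrete opfibration \<open>P\<close>: a pullback
  of lax morphisms from \<open>P\<close> to \<open>u\<close> whose underlying 1-cells are the classifying pair of \<open>P\<close> in \<open>K\<close>.
  Thus \<open>H\<close> is \<open>dP\<close> equipped with its lax structure.
\<close>

definition lax_classifying_square ::
  "'m classifier \<Rightarrow> ('o, 'm, 'c) lmor \<Rightarrow> ('o, 'm, 'c) lmor \<Rightarrow> ('o, 'm, 'c) lmor \<Rightarrow> bool"
  where "lax_classifying_square C P G H \<longleftrightarrow>
    pullback (LaxAlg K M) (lax_clsf C) H G P \<and>
    lmap G = dtop C (lmap P) \<and> lmap H = dmap C (lmap P)"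

end

end

theory Submission
  imports Defs
begin

text \<open>
  The statement is an instance of a fact about every strict \<open>T\<close>-morphism \<open>p : (E, \<epsilon>) \<rightarrow> (B, \<beta>)\<close> whose
  underlying 1-cell is small: its classifying map is a lax morphism, and it is pseudo exactly when
  \<open>p\<close> is \<open>T\<close>-cartesian (\<open>classifying_map_pseudo_iff_T_cartesian\<close>). The representable opfibration
  \<open>\<partial>\<^sub>1\<close> is such a morphism.

  Everything rests on one universal property (\<open>pullback_initial_square\<close>): a pullback square from
  \<open>q\<close> to \<open>u\<close> is initial among all commuting squares from \<open>q\<close> to \<open>u\<close>, where a map of squares is a
  2-cell of the arrow 2-category. It is derived from the classifier axioms when \<open>q\<close> is small, and
  carried over to other \<open>q\<close> along an isomorphism with a chosen pullback. Since \<open>T\<close> preserves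
  pullbacks of \<open>u\<close>, pasting \<open>T\<close> of a pullback square into \<open>u\<close> with \<open>(\<omega>\<^sub>\<bullet>, \<omega>)\<close> gives another pullback
  square into \<open>u\<close>; so the sources of all structure 2-cells and of all their composites that matter
  below are initial. This has three consequences.

  \<^item> The canonical unitors and multiplicators exist, and the lax algebra axioms for \<open>\<Omega>\<^sub>\<bullet>\<close> and \<open>\<Omega>\<close> hold
    because both sides of each are maps out of an initial square (\<open>Omega_lax_algebras\<close>).
  \<^item> The square \<open>(d\<^sub>\<bullet>p \<odot> \<epsilon>, dp \<odot> \<beta>)\<close> receives a unique map \<open>(\<gamma>\<^sub>\<bullet>, \<gamma>)\<close> from the initial square
    \<open>(\<omega>\<^sub>\<bullet> \<odot> T d\<^sub>\<bullet>p, \<omega> \<odot> T dp)\<close>. For the same reason as before it satisfies the axioms of lax morphisms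
    (\<open>classifying_lax_morphisms\<close>); its uniqueness is the uniqueness of the classifying square.
  \<^item> The map \<open>\<gamma>\<close> compares an initial square with the pasting of \<open>(\<epsilon>, \<beta>)\<close> and \<open>(d\<^sub>\<bullet>p, dp)\<close>. It is invertible
    exactly when that pasting is itself a pullback, that is, when the comparison of \<open>T E\<close> with the
    pullback of \<open>p\<close> along \<open>\<beta>\<close>, the cartesianness defect, is invertible. As \<open>T p\<close> has unique lifts
    of 2-cells, a split equivalence over it is already invertible
    (\<open>iso2_iff_comparison_split_equivalence\<close>).

  That the resulting square is a pullback of lax algebras (\<open>LaxAlg_pullback\<close>) holds because \<open>p\<close> is a
  discrete opfibration: the structure 2-cell of the induced 1-cell is a lift along \<open>p\<close>, and
  equations between 2-cells with common source can be tested after applying \<open>p\<close>.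
\<close>

section \<open>Whiskering\<close>

context enhanced_2category
begin

lemma hom_Loose: "f \<in> hom K A B \<Longrightarrow> f \<in> Loose K"
  by (simp add: hom_def)

lemma Loose_hom: "f \<in> Loose K \<Longrightarrow> f \<in> hom K (Dom K f) (Cod K f)"
  by (simp add: hom_def)

lemma hom_Obj: "f \<in> hom K A B \<Longrightarrow> A \<in> Obj K" "f \<in> hom K A B \<Longrightarrow> B \<in> Obj K"
  using Dom_Obj Cod_Obj by (auto simp: hom_def)

lemma cells_parallel: "\<lbrakk>\<phi> \<in> cells K f g; f \<in> hom K A B\<rbrakk> \<Longrightarrow> g \<in> hom K A B"
  using Tgt_Loose Cell_Dom Cell_Cod by (auto simp: cells_def hom_def)

lemma Id2_hom_cells: "f \<in> hom K A B \<Longrightarrow> Id2 K f \<in> cells K f f"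
  by (simp add: Id2_cells hom_Loose)

lemma lwhisker_cells:
  "\<lbrakk>f \<in> hom K B D; \<phi> \<in> cells K g h; g \<in> hom K A B\<rbrakk> \<Longrightarrow> f \<rhd> \<phi> \<in> cells K (f \<odot> g) (f \<odot> h)"
  by (rule Hcmp_cells) (auto simp: hom_def Id2_cells)

lemma rwhisker_cells:
  "\<lbrakk>\<phi> \<in> cells K g h; g \<in> hom K B D; f \<in> hom K A B\<rbrakk> \<Longrightarrow> \<phi> \<lhd> f \<in> cells K (g \<odot> f) (h \<odot> f)"
  by (rule Hcmp_cells) (auto simp: hom_def Id2_cells)

lemma lwhisker_Cmp:
  assumes "f \<in> hom K D E" "g \<in> hom K B D" "\<phi> \<in> cells K h k" "h \<in> hom K A B"
  shows "(f \<odot> g) \<rhd> \<phi> = f \<rhd> g \<rhd> \<phi>"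
  using Hcmp_assoc[of "Id2 K f" f f "Id2 K g" g g \<phi> h k] Hcmp_Id2[of f g] assms
  by (auto simp: hom_def Id2_cells)

lemma rwhisker_Cmp:
  assumes "\<phi> \<in> cells K h k" "h \<in> hom K D E" "g \<in> hom K B D" "f \<in> hom K A B"
  shows "\<phi> \<lhd> (g \<odot> f) = \<phi> \<lhd> g \<lhd> f"
  using Hcmp_assoc[of \<phi> h k "Id2 K g" g g "Id2 K f" f f] Hcmp_Id2[of g f] assms
  by (auto simp: hom_def Id2_cells)

lemma whisker_assoc:
  assumes "f \<in> hom K D E" "\<phi> \<in> cells K h k" "h \<in> hom K B D" "g \<in> hom K A B"
  shows "(f \<rhd> \<phi>) \<lhd> g = f \<rhd> \<phi> \<lhd> g"
  using Hcmp_assoc[of "Id2 K f" f f \<phi> h k "Id2 K g" g g] assms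
  by (auto simp: hom_def Id2_cells)

lemma lwhisker_Vcmp:
  assumes "f \<in> hom K B D" "\<psi> \<in> cells K h k" "\<phi> \<in> cells K g h" "g \<in> hom K A B"
  shows "f \<rhd> (\<psi> \<bullet> \<phi>) = (f \<rhd> \<psi>) \<bullet> (f \<rhd> \<phi>)"
  using interchange[of "Id2 K f" f f "Id2 K f" f \<psi> h k \<phi> g] Vcmp_Id2[of "Id2 K f" f f] assms
  by (auto simp: hom_def Id2_cells)

lemma rwhisker_Vcmp:
  assumes "\<psi> \<in> cells K h k" "\<phi> \<in> cells K g h" "g \<in> hom K B D" "f \<in> hom K A B"
  shows "(\<psi> \<bullet> \<phi>) \<lhd> f = (\<psi> \<lhd> f) \<bullet> (\<phi> \<lhd> f)"
  using interchange[of \<psi> h k \<phi> g "Id2 K f" f f "Id2 K f" f] Vcmp_Id2[of "Id2 K f" f f] assms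
  by (auto simp: hom_def Id2_cells)

lemma whisker_Id2:
  assumes "g \<in> hom K B D" "f \<in> hom K A B"
  shows "Id2 K g \<star> Id2 K f = Id2 K (g \<odot> f)"
  using assms by (intro Hcmp_Id2) (auto simp: hom_def)

lemma iso2_cells:
  assumes "\<phi> \<in> cells K f g"
  shows "iso2 K \<phi> \<longleftrightarrow> (\<exists>\<psi> \<in> cells K g f. \<psi> \<bullet> \<phi> = Id2 K f \<and> \<phi> \<bullet> \<psi> = Id2 K g)"
  using assms by (auto simp: iso2_def cells_def)

lemma inverse_unique:
  assumes "\<phi> \<in> cells K f g" "\<psi> \<in> cells K g f" "\<psi>' \<in> cells K g f"
    and "\<phi> \<bullet> \<psi> = Id2 K g" "\<psi>' \<bullet> \<phi> = Id2 K f"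
  shows "\<psi> = \<psi>'"
proof -
  have "\<psi> = (\<psi>' \<bullet> \<phi>) \<bullet> \<psi>" unfolding assms(5) by (rule Id2_Vcmp[symmetric, OF assms(2)])
  also have "\<dots> = \<psi>' \<bullet> \<phi> \<bullet> \<psi>" by (rule Vcmp_assoc[OF assms(3,1,2)])
  also have "\<dots> = \<psi>'" unfolding assms(4) by (rule Vcmp_Id2[OF assms(3)])
  finally show ?thesis .
qed

end

section \<open>The arrow 2-category\<close>

text \<open>
  The objects of the arrow 2-category are the 1-cells of \<open>K\<close>, its 1-cells the commuting squares, and
  its 2-cells the pairs of 2-cells compatible with the vertical sides. It is not built as an
  \<open>e2cat\<close>; the predicates below type its cells, so that an equation between pairs splits into
  equations in \<open>K\<close>. The component between domains, written with a prime, always comes first.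
\<close>

definition square :: "('o, 'm, 'c, 'x) e2cat_scheme \<Rightarrow> 'm \<Rightarrow> 'm \<Rightarrow> 'm \<Rightarrow> 'm \<Rightarrow> bool"
  where "square K q r f' f \<longleftrightarrow> q \<in> Loose K \<and> r \<in> Loose K \<and>
    f' \<in> hom K (Dom K q) (Dom K r) \<and> f \<in> hom K (Cod K q) (Cod K r) \<and>
    r \<odot>\<^bsub>K\<^esub> f' = f \<odot>\<^bsub>K\<^esub> q"

definition square_cell ::
  "('o, 'm, 'c, 'x) e2cat_scheme \<Rightarrow> 'm \<Rightarrow> 'm \<Rightarrow> 'm \<Rightarrow> 'm \<Rightarrow> 'm \<Rightarrow> 'm \<Rightarrow> 'c \<Rightarrow> 'c \<Rightarrow> bool"
  where "square_cell K q r f' f g' g \<gamma>' \<gamma> \<longleftrightarrow> square K q r f' f \<and> square K q r g' g \<and>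
    \<gamma>' \<in> cells K f' g' \<and> \<gamma> \<in> cells K f g \<and> r \<rhd>\<^bsub>K\<^esub> \<gamma>' = \<gamma> \<lhd>\<^bsub>K\<^esub> q"

definition square_iso :: "('o, 'm, 'c, 'x) e2cat_scheme \<Rightarrow> 'm \<Rightarrow> 'm \<Rightarrow> 'm \<Rightarrow> 'm \<Rightarrow> 'm \<Rightarrow> 'm \<Rightarrow> bool"
  where "square_iso K q r f' f g' g \<longleftrightarrow> (\<exists>\<iota>' \<iota> \<kappa>' \<kappa>.
    square_cell K q r f' f g' g \<iota>' \<iota> \<and> square_cell K q r g' g f' f \<kappa>' \<kappa> \<and>
    \<kappa>' \<bullet>\<^bsub>K\<^esub> \<iota>' = Id2 K f' \<and> \<iota>' \<bullet>\<^bsub>K\<^esub> \<kappa>' = Id2 K g' \<and>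
    \<kappa> \<bullet>\<^bsub>K\<^esub> \<iota> = Id2 K f \<and> \<iota> \<bullet>\<^bsub>K\<^esub> \<kappa> = Id2 K g)"

definition initial_square :: "('o, 'm, 'c, 'x) e2cat_scheme \<Rightarrow> 'm \<Rightarrow> 'm \<Rightarrow> 'm \<Rightarrow> 'm \<Rightarrow> bool"
  where "initial_square K q r f' f \<longleftrightarrow> square K q r f' f \<and>
    (\<forall>g' g. square K q r g' g \<longrightarrow>
      (\<exists>!\<gamma>\<gamma>. square_cell K q r f' f g' g (fst \<gamma>\<gamma>) (snd \<gamma>\<gamma>)))"

lemma initial_squareE:
  assumes "initial_square K q r f' f" "square K q r g' g"
  obtains \<gamma>' \<gamma> where "square_cell K q r f' f g' g \<gamma>' \<gamma>"
proof -
  have "\<exists>!\<gamma>\<gamma>. square_cell K q r f' f g' g (fst \<gamma>\<gamma>) (snd \<gamma>\<gamma>)"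
    using assms(1,2) by (simp add: initial_square_def)
  then show thesis using that by blast
qed

lemma initial_square_unique:
  assumes "initial_square K q r f' f"
    and "square_cell K q r f' f g' g \<gamma>' \<gamma>" "square_cell K q r f' f g' g \<delta>' \<delta>"
  shows "\<gamma>' = \<delta>'" "\<gamma> = \<delta>"
proof -
  have "square K q r g' g" using assms(2) by (simp add: square_cell_def)
  then have "\<exists>!\<gamma>\<gamma>. square_cell K q r f' f g' g (fst \<gamma>\<gamma>) (snd \<gamma>\<gamma>)"
    using assms(1) by (simp add: initial_square_def)
  then have "(\<gamma>', \<gamma>) = (\<delta>', \<delta>)" using assms(2,3) by (metis fst_conv snd_conv)
  then show "\<gamma>' = \<delta>'" "\<gamma> = \<delta>" by simp_all
qed

context enhanced_2category
begin

lemma squareD: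
  assumes "square K q r f' f"
  shows "q \<in> hom K (Dom K q) (Cod K q)" "r \<in> hom K (Dom K r) (Cod K r)"
    and "f' \<in> hom K (Dom K q) (Dom K r)" "f \<in> hom K (Cod K q) (Cod K r)"
    and "r \<odot> f' = f \<odot> q"
  using assms by (auto simp: square_def hom_def)

lemma square_Id1: "q \<in> Loose K \<Longrightarrow> square K q q (Id1 K (Dom K q)) (Id1 K (Cod K q))"
  using Cmp_Id1[OF Loose_hom] Id1_Cmp[OF Loose_hom]
  by (simp add: square_def Id1_hom Dom_Obj Cod_Obj)

lemma square_Cmp:
  assumes g: "square K r s g' g" and f: "square K q r f' f"
  shows "square K q s (g' \<odot> f') (g \<odot> f)"
proof -
  note G = squareD[OF g] and F = squareD[OF f]
  have "s \<odot> g' \<odot> f' = (g \<odot> r) \<odot> f'" using Cmp_assoc G F by metis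
  also have "\<dots> = g \<odot> f \<odot> q" using Cmp_assoc G F by metis
  also have "\<dots> = (g \<odot> f) \<odot> q" using Cmp_assoc G F by metis
  finally show ?thesis using f g Cmp_hom by (auto simp: square_def)
qed

lemma square_cellD:
  assumes "square_cell K q r f' f g' g \<gamma>' \<gamma>"
  shows "square K q r f' f" "square K q r g' g" "\<gamma>' \<in> cells K f' g'" "\<gamma> \<in> cells K f g"
    and "r \<rhd> \<gamma>' = \<gamma> \<lhd> q"
  using assms by (auto simp: square_cell_def)

lemma square_cell_Id2:
  assumes "square K q r f' f"
  shows "square_cell K q r f' f f' f (Id2 K f') (Id2 K f)"
  using assms whisker_Id2[OF squareD(2,3)[OF assms]] whisker_Id2[OF squareD(4,1)[OF assms]]
    squareD(5)[OF assms] Id2_hom_cells[OF squareD(3)[OF assms]] Id2_hom_cells[OF squareD(4)[OF assms]]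
  by (simp add: square_cell_def)

lemma square_cell_Vcmp:
  assumes d: "square_cell K q r g' g h' h \<delta>' \<delta>" and c: "square_cell K q r f' f g' g \<gamma>' \<gamma>"
  shows "square_cell K q r f' f h' h (\<delta>' \<bullet> \<gamma>') (\<delta> \<bullet> \<gamma>)"
proof -
  note D = square_cellD[OF d] and G = square_cellD[OF c]
  note F = squareD[OF G(1)]
  show ?thesis
    using D G lwhisker_Vcmp[OF F(2) D(3) G(3) F(3)] rwhisker_Vcmp[OF D(4) G(4) F(4) F(1)]
    by (auto simp: square_cell_def intro: Vcmp_cells)
qed

lemma square_cell_lwhisker:
  assumes g: "square K r s g' g" and c: "square_cell K q r f' f h' h \<gamma>' \<gamma>"
  shows "square_cell K q s (g' \<odot> f') (g \<odot> f) (g' \<odot> h') (g \<odot> h) (g' \<rhd> \<gamma>') (g \<rhd> \<gamma>)"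
proof -
  note C = square_cellD[OF c] and G = squareD[OF g]
  note F = squareD[OF C(1)]
  have "s \<rhd> g' \<rhd> \<gamma>' = (s \<odot> g') \<rhd> \<gamma>'" by (rule lwhisker_Cmp[symmetric, OF G(2,3) C(3) F(3)])
  also have "\<dots> = g \<rhd> r \<rhd> \<gamma>'" unfolding G(5) by (rule lwhisker_Cmp[OF G(4,1) C(3) F(3)])
  also have "\<dots> = (g \<rhd> \<gamma>) \<lhd> q" unfolding C(5) by (rule whisker_assoc[symmetric, OF G(4) C(4) F(4,1)])
  finally show ?thesis
    using square_Cmp[OF g C(1)] square_Cmp[OF g C(2)]
      lwhisker_cells[OF G(3) C(3) F(3)] lwhisker_cells[OF G(4) C(4) F(4)]
    by (simp add: square_cell_def)
qed

lemma square_cell_rwhisker: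
  assumes c: "square_cell K r s f' f h' h \<gamma>' \<gamma>" and g: "square K q r g' g"
  shows "square_cell K q s (f' \<odot> g') (f \<odot> g) (h' \<odot> g') (h \<odot> g) (\<gamma>' \<lhd> g') (\<gamma> \<lhd> g)"
proof -
  note C = square_cellD[OF c] and G = squareD[OF g]
  note F = squareD[OF C(1)]
  have "s \<rhd> \<gamma>' \<lhd> g' = (s \<rhd> \<gamma>') \<lhd> g'" by (rule whisker_assoc[symmetric, OF F(2) C(3) F(3) G(3)])
  also have "\<dots> = \<gamma> \<lhd> (r \<odot> g')" unfolding C(5) by (rule rwhisker_Cmp[symmetric, OF C(4) F(4,1) G(3)])
  also have "\<dots> = \<gamma> \<lhd> g \<lhd> q" unfolding G(5) by (rule rwhisker_Cmp[OF C(4) F(4) G(4,1)])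
  finally show ?thesis
    using square_Cmp[OF C(1) g] square_Cmp[OF C(2) g]
      rwhisker_cells[OF C(3) F(3) G(3)] rwhisker_cells[OF C(4) F(4) G(4)]
    by (simp add: square_cell_def)
qed

text \<open>
  Compatibility with the vertical sides passes to the inverse pair because both whiskerings of the
  inverses are inverse to the same 2-cell.
\<close>

lemma square_isoI:
  assumes c: "square_cell K q r f' f g' g \<gamma>' \<gamma>" and "iso2 K \<gamma>'" "iso2 K \<gamma>"
  shows "square_iso K q r f' f g' g"
proof -
  note C = square_cellD[OF c]
  note F = squareD[OF C(1)] and G = squareD[OF C(2)]
  obtain \<delta>' where d': "\<delta>' \<in> cells K g' f'" "\<delta>' \<bullet> \<gamma>' = Id2 K f'" "\<gamma>' \<bullet> \<delta>' = Id2 K g'"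
    using assms(2) C(3) by (auto simp: iso2_cells)
  obtain \<delta> where d: "\<delta> \<in> cells K g f" "\<delta> \<bullet> \<gamma> = Id2 K f" "\<gamma> \<bullet> \<delta> = Id2 K g"
    using assms(3) C(4) by (auto simp: iso2_cells)
  have "r \<rhd> \<delta>' = \<delta> \<lhd> q"
  proof (rule inverse_unique)
    show "r \<rhd> \<gamma>' \<in> cells K (r \<odot> f') (r \<odot> g')" by (rule lwhisker_cells[OF F(2) C(3) F(3)])
    show "r \<rhd> \<delta>' \<in> cells K (r \<odot> g') (r \<odot> f')" by (rule lwhisker_cells[OF F(2) d'(1) G(3)])
    show "\<delta> \<lhd> q \<in> cells K (r \<odot> g') (r \<odot> f')"
      unfolding F(5) G(5) by (rule rwhisker_cells[OF d(1) G(4,1)])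
    show "(r \<rhd> \<gamma>') \<bullet> (r \<rhd> \<delta>') = Id2 K (r \<odot> g')"
      using lwhisker_Vcmp[OF F(2) C(3) d'(1) G(3)] d'(3) whisker_Id2[OF F(2) G(3)] by simp
    show "(\<delta> \<lhd> q) \<bullet> (r \<rhd> \<gamma>') = Id2 K (r \<odot> f')"
      using rwhisker_Vcmp[OF d(1) C(4) F(4,1)] d(2) whisker_Id2[OF F(4,1)] C(5) F(5) by simp
  qed
  then have "square_cell K q r g' g f' f \<delta>' \<delta>" using C d d' by (simp add: square_cell_def)
  then show ?thesis using c d d' by (auto simp: square_iso_def)
qed

lemma square_iso_rwhisker:
  assumes iso: "square_iso K r s f' f h' h" and g: "square K q r g' g"
  shows "square_iso K q s (f' \<odot> g') (f \<odot> g) (h' \<odot> g') (h \<odot> g)"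
proof -
  obtain \<iota>' \<iota> \<kappa>' \<kappa> where i: "square_cell K r s f' f h' h \<iota>' \<iota>" and k: "square_cell K r s h' h f' f \<kappa>' \<kappa>"
    and eq: "\<kappa>' \<bullet> \<iota>' = Id2 K f'" "\<iota>' \<bullet> \<kappa>' = Id2 K h'" "\<kappa> \<bullet> \<iota> = Id2 K f" "\<iota> \<bullet> \<kappa> = Id2 K h"
    using iso unfolding square_iso_def by auto
  note I = square_cellD[OF i] and L = square_cellD[OF k] and G = squareD[OF g]
  note F = squareD[OF I(1)] and H = squareD[OF I(2)]
  have "(\<kappa>' \<lhd> g') \<bullet> (\<iota>' \<lhd> g') = Id2 K (f' \<odot> g')" "(\<iota>' \<lhd> g') \<bullet> (\<kappa>' \<lhd> g') = Id2 K (h' \<odot> g')"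
    "(\<kappa> \<lhd> g) \<bullet> (\<iota> \<lhd> g) = Id2 K (f \<odot> g)" "(\<iota> \<lhd> g) \<bullet> (\<kappa> \<lhd> g) = Id2 K (h \<odot> g)"
    using rwhisker_Vcmp[OF L(3) I(3) F(3) G(3)] rwhisker_Vcmp[OF I(3) L(3) H(3) G(3)]
      rwhisker_Vcmp[OF L(4) I(4) F(4) G(4)] rwhisker_Vcmp[OF I(4) L(4) H(4) G(4)]
      whisker_Id2[OF F(3) G(3)] whisker_Id2[OF H(3) G(3)] whisker_Id2[OF F(4) G(4)] whisker_Id2[OF H(4) G(4)]
      eq by simp_all
  then show ?thesis
    using square_cell_rwhisker[OF i g] square_cell_rwhisker[OF k g] unfolding square_iso_def by blast
qed

text \<open>
  The two properties of initiality needed to strengthen the classifier axioms: the target of a unique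
  map may be replaced by an isomorphic square, and so may an initial square itself.
\<close>

lemma square_cell_ex1_iso_target:
  assumes ex1: "\<exists>!\<gamma>\<gamma>. square_cell K q r f' f g' g (fst \<gamma>\<gamma>) (snd \<gamma>\<gamma>)"
    and iso: "square_iso K q r g' g h' h"
  shows "\<exists>!\<gamma>\<gamma>. square_cell K q r f' f h' h (fst \<gamma>\<gamma>) (snd \<gamma>\<gamma>)"
proof -
  obtain \<iota>' \<iota> \<kappa>' \<kappa> where i: "square_cell K q r g' g h' h \<iota>' \<iota>"
    and k: "square_cell K q r h' h g' g \<kappa>' \<kappa>"
    and ik: "\<iota>' \<bullet> \<kappa>' = Id2 K h'" "\<iota> \<bullet> \<kappa> = Id2 K h"
    using iso unfolding square_iso_def by auto
  obtain \<gamma>' \<gamma> where g: "square_cell K q r f' f g' g \<gamma>' \<gamma>" using ex1 by auto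
  have factor: "\<delta>' = \<iota>' \<bullet> \<kappa>' \<bullet> \<delta>'" "\<delta> = \<iota> \<bullet> \<kappa> \<bullet> \<delta>" "\<kappa>' \<bullet> \<delta>' = \<gamma>'" "\<kappa> \<bullet> \<delta> = \<gamma>"
    if d: "square_cell K q r f' f h' h \<delta>' \<delta>" for \<delta>' \<delta>
  proof -
    note D = square_cellD[OF d] and I = square_cellD[OF i] and L = square_cellD[OF k]
    show "\<delta>' = \<iota>' \<bullet> \<kappa>' \<bullet> \<delta>'" using Vcmp_assoc[OF I(3) L(3) D(3)] Id2_Vcmp[OF D(3)] ik by simp
    show "\<delta> = \<iota> \<bullet> \<kappa> \<bullet> \<delta>" using Vcmp_assoc[OF I(4) L(4) D(4)] Id2_Vcmp[OF D(4)] ik by simp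
    have "square_cell K q r f' f g' g (\<kappa>' \<bullet> \<delta>') (\<kappa> \<bullet> \<delta>)" by (rule square_cell_Vcmp[OF k d])
    then have "(\<kappa>' \<bullet> \<delta>', \<kappa> \<bullet> \<delta>) = (\<gamma>', \<gamma>)" using ex1 g by (metis fst_conv snd_conv)
    then show "\<kappa>' \<bullet> \<delta>' = \<gamma>'" "\<kappa> \<bullet> \<delta> = \<gamma>" by simp_all
  qed
  show ?thesis
  proof (rule ex1I[of _ "(\<iota>' \<bullet> \<gamma>', \<iota> \<bullet> \<gamma>)"])
    show "square_cell K q r f' f h' h (fst (\<iota>' \<bullet> \<gamma>', \<iota> \<bullet> \<gamma>)) (snd (\<iota>' \<bullet> \<gamma>', \<iota> \<bullet> \<gamma>))"
      using square_cell_Vcmp[OF i g] by simp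
    show "dd = (\<iota>' \<bullet> \<gamma>', \<iota> \<bullet> \<gamma>)" if "square_cell K q r f' f h' h (fst dd) (snd dd)" for dd
      using factor[OF that] by (metis prod.collapse)
  qed
qed

lemma initial_square_iso:
  assumes init: "initial_square K q r f' f" and iso: "square_iso K q r f' f g' g"
  shows "initial_square K q r g' g"
proof -
  obtain \<iota>' \<iota> \<kappa>' \<kappa> where i: "square_cell K q r f' f g' g \<iota>' \<iota>"
    and k: "square_cell K q r g' g f' f \<kappa>' \<kappa>"
    and ik: "\<iota>' \<bullet> \<kappa>' = Id2 K g'" "\<iota> \<bullet> \<kappa> = Id2 K g"
    using iso unfolding square_iso_def by auto
  note I = square_cellD[OF i] and L = square_cellD[OF k]
  have "\<exists>!\<gamma>\<gamma>. square_cell K q r g' g h' h (fst \<gamma>\<gamma>) (snd \<gamma>\<gamma>)" if sq: "square K q r h' h" for h' h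
  proof -
    obtain \<gamma>' \<gamma> where g: "square_cell K q r f' f h' h \<gamma>' \<gamma>" using initial_squareE[OF init sq] .
    have factor: "\<delta>' = \<gamma>' \<bullet> \<kappa>'" "\<delta> = \<gamma> \<bullet> \<kappa>" if d: "square_cell K q r g' g h' h \<delta>' \<delta>" for \<delta>' \<delta>
    proof -
      note D = square_cellD[OF d]
      have "\<delta>' \<bullet> \<iota>' = \<gamma>'" "\<delta> \<bullet> \<iota> = \<gamma>"
        using initial_square_unique[OF init square_cell_Vcmp[OF d i] g] by simp_all
      then show "\<delta>' = \<gamma>' \<bullet> \<kappa>'" "\<delta> = \<gamma> \<bullet> \<kappa>"
        using Vcmp_assoc[OF D(3) I(3) L(3)] Vcmp_Id2[OF D(3)]
          Vcmp_assoc[OF D(4) I(4) L(4)] Vcmp_Id2[OF D(4)] ik by simp_all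
    qed
    show ?thesis
    proof (rule ex1I[of _ "(\<gamma>' \<bullet> \<kappa>', \<gamma> \<bullet> \<kappa>)"])
      show "square_cell K q r g' g h' h (fst (\<gamma>' \<bullet> \<kappa>', \<gamma> \<bullet> \<kappa>)) (snd (\<gamma>' \<bullet> \<kappa>', \<gamma> \<bullet> \<kappa>))"
        using square_cell_Vcmp[OF g k] by simp
      show "dd = (\<gamma>' \<bullet> \<kappa>', \<gamma> \<bullet> \<kappa>)" if "square_cell K q r g' g h' h (fst dd) (snd dd)" for dd
        using factor[OF that] by (metis prod.collapse)
    qed
  qed
  then show ?thesis using I(2) by (simp add: initial_square_def)
qed

section \<open>Pullbacks and discrete opfibrations\<close>

lemma pullback_square: "pullback K f g q p \<Longrightarrow> square K p f q g"
  by (auto simp: pullback_def square_def hom_def)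

lemma pullback_factor:
  assumes "pullback K f g q p" "x \<in> hom K Y (Dom K f)" "y \<in> hom K Y (Dom K g)" "f \<odot> x = g \<odot> y"
  obtains h where "h \<in> hom K Y (Dom K p)" "q \<odot> h = x" "p \<odot> h = y"
proof -
  from assms have "\<exists>!h. h \<in> hom K Y (Dom K p) \<and> q \<odot> h = x \<and> p \<odot> h = y"
    unfolding pullback_def by blast
  then show thesis using that by blast
qed

lemma pullback_monic:
  assumes pb: "pullback K f g q p" and h: "h \<in> hom K Y (Dom K p)" "h' \<in> hom K Y (Dom K p)"
    and eq: "q \<odot> h = q \<odot> h'" "p \<odot> h = p \<odot> h'"
  shows "h = h'"
proof -
  note S = squareD[OF pullback_square[OF pb]]
  have g: "Cod K p = Dom K g" using pb by (simp add: pullback_def hom_def)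
  have qh: "q \<odot> h \<in> hom K Y (Dom K f)" by (rule Cmp_hom[OF S(3) h(1)])
  have ph: "p \<odot> h \<in> hom K Y (Dom K g)" using Cmp_hom[OF S(1) h(1)] g by simp
  have "f \<odot> q \<odot> h = (f \<odot> q) \<odot> h" by (rule Cmp_assoc[symmetric, OF S(2,3) h(1)])
  also have "\<dots> = g \<odot> p \<odot> h" unfolding S(5) by (rule Cmp_assoc[OF S(4,1) h(1)])
  finally have "\<exists>!k. k \<in> hom K Y (Dom K p) \<and> q \<odot> k = q \<odot> h \<and> p \<odot> k = p \<odot> h"
    using pb qh ph unfolding pullback_def by blast
  then show ?thesis using h eq by metis
qed

lemma pullback_factor_cell:
  assumes "pullback K f g q p" "h \<in> hom K Y (Dom K p)" "h' \<in> hom K Y (Dom K p)"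
    and "\<sigma> \<in> cells K (q \<odot> h) (q \<odot> h')" "\<tau> \<in> cells K (p \<odot> h) (p \<odot> h')" "f \<rhd> \<sigma> = g \<rhd> \<tau>"
  shows "\<exists>!\<theta>. \<theta> \<in> cells K h h' \<and> q \<rhd> \<theta> = \<sigma> \<and> p \<rhd> \<theta> = \<tau>"
  using assms unfolding pullback_def by blast

lemma pullback_paste:
  assumes pb: "pullback K f g q p" and pb': "pullback K p g2 q2 p2"
  shows "pullback K f (g \<odot> g2) (q \<odot> q2) p2"
proof -
  note S = squareD[OF pullback_square[OF pb]] and S' = squareD[OF pullback_square[OF pb']]
  have sq: "square K p2 f (q \<odot> q2) (g \<odot> g2)"
    by (rule square_Cmp[OF pullback_square[OF pb] pullback_square[OF pb']])
  note SS = squareD[OF sq]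
  have D: "Dom K g = Cod K p" "Dom K g2 = Cod K p2" "Dom K (g \<odot> g2) = Cod K p2"
    using S S' SS by (simp_all add: hom_def)
  have 1: "\<exists>!h. h \<in> hom K Y (Dom K p2) \<and> (q \<odot> q2) \<odot> h = x \<and> p2 \<odot> h = y"
    if x: "x \<in> hom K Y (Dom K f)" and y: "y \<in> hom K Y (Cod K p2)" and xy: "f \<odot> x = (g \<odot> g2) \<odot> y"
    for Y x y
  proof -
    have "f \<odot> x = g \<odot> g2 \<odot> y" using xy Cmp_assoc[OF S(4) S'(4) y] by simp
    then obtain h1 where h1: "h1 \<in> hom K Y (Dom K p)" "q \<odot> h1 = x" "p \<odot> h1 = g2 \<odot> y"
      using pullback_factor[OF pb x, of "g2 \<odot> y"] Cmp_hom[OF S'(4) y] D by metis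
    then obtain h where h: "h \<in> hom K Y (Dom K p2)" "q2 \<odot> h = h1" "p2 \<odot> h = y"
      using pullback_factor[OF pb' h1(1), of y] y D by metis
    have "(q \<odot> q2) \<odot> h = x" using h h1 Cmp_assoc[OF S(3) S'(3) h(1)] by simp
    moreover have "k = h" if k: "k \<in> hom K Y (Dom K p2)" "(q \<odot> q2) \<odot> k = x" "p2 \<odot> k = y" for k
    proof (rule pullback_monic[OF pb' k(1) h(1)])
      have "q2 \<odot> k = h1"
      proof (rule pullback_monic[OF pb _ h1(1)])
        show "q2 \<odot> k \<in> hom K Y (Dom K p)" by (rule Cmp_hom[OF S'(3) k(1)])
        show "q \<odot> q2 \<odot> k = q \<odot> h1" using k h1 Cmp_assoc[OF S(3) S'(3) k(1)] by simp
        have "p \<odot> q2 \<odot> k = (g2 \<odot> p2) \<odot> k" using Cmp_assoc[OF S'(2,3) k(1)] S'(5) by simp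
        then show "p \<odot> q2 \<odot> k = p \<odot> h1" using k h1 Cmp_assoc[OF S'(4,1) k(1)] by simp
      qed
      then show "q2 \<odot> k = q2 \<odot> h" using h by simp
    qed (use k h in simp)
    ultimately show ?thesis using h by metis
  qed
  have 2: "\<exists>!\<theta>. \<theta> \<in> cells K h h' \<and> (q \<odot> q2) \<rhd> \<theta> = \<sigma> \<and> p2 \<rhd> \<theta> = \<tau>"
    if h: "h \<in> hom K Y (Dom K p2)" and h': "h' \<in> hom K Y (Dom K p2)"
      and s: "\<sigma> \<in> cells K ((q \<odot> q2) \<odot> h) ((q \<odot> q2) \<odot> h')"
      and t: "\<tau> \<in> cells K (p2 \<odot> h) (p2 \<odot> h')"
      and st: "f \<rhd> \<sigma> = (g \<odot> g2) \<rhd> \<tau>" for Y h h' \<sigma> \<tau>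
  proof -
    have p2h: "p2 \<odot> h \<in> hom K Y (Cod K p2)" by (rule Cmp_hom[OF S'(1) h])
    have pq: "p \<odot> q2 \<odot> k = g2 \<odot> p2 \<odot> k" if "k \<in> hom K Y (Dom K p2)" for k
      using Cmp_assoc[OF S'(2,3) that] Cmp_assoc[OF S'(4,1) that] S'(5) by simp
    have s1: "\<sigma> \<in> cells K (q \<odot> q2 \<odot> h) (q \<odot> q2 \<odot> h')"
      using s Cmp_assoc[OF S(3) S'(3)] h h' by simp
    have t1: "g2 \<rhd> \<tau> \<in> cells K (p \<odot> q2 \<odot> h) (p \<odot> q2 \<odot> h')"
      using lwhisker_cells[OF S'(4) t p2h] pq h h' by simp
    have st1: "f \<rhd> \<sigma> = g \<rhd> g2 \<rhd> \<tau>" using st lwhisker_Cmp[OF S(4) S'(4) t p2h] by simp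
    note ex = pullback_factor_cell[OF pb Cmp_hom[OF S'(3) h] Cmp_hom[OF S'(3) h'] s1 t1 st1]
    then obtain \<theta>1 where th1: "\<theta>1 \<in> cells K (q2 \<odot> h) (q2 \<odot> h')"
        "q \<rhd> \<theta>1 = \<sigma>" "p \<rhd> \<theta>1 = g2 \<rhd> \<tau>" by blast
    note ex' = pullback_factor_cell[OF pb' h h' th1(1) t th1(3)]
    have "\<theta> \<in> cells K h h' \<and> (q \<odot> q2) \<rhd> \<theta> = \<sigma> \<and> p2 \<rhd> \<theta> = \<tau> \<longleftrightarrow>
        \<theta> \<in> cells K h h' \<and> q2 \<rhd> \<theta> = \<theta>1 \<and> p2 \<rhd> \<theta> = \<tau>" for \<theta>
    proof (cases "\<theta> \<in> cells K h h' \<and> p2 \<rhd> \<theta> = \<tau>")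
      case True
      then have th: "\<theta> \<in> cells K h h'" "p2 \<rhd> \<theta> = \<tau>" by simp_all
      have c: "q2 \<rhd> \<theta> \<in> cells K (q2 \<odot> h) (q2 \<odot> h')" by (rule lwhisker_cells[OF S'(3) th(1) h])
      have "p \<rhd> q2 \<rhd> \<theta> = g2 \<rhd> \<tau>"
        using lwhisker_Cmp[OF S'(2,3) th(1) h] lwhisker_Cmp[OF S'(4,1) th(1) h] S'(5) th(2) by simp
      then have "q \<rhd> q2 \<rhd> \<theta> = \<sigma> \<longleftrightarrow> q2 \<rhd> \<theta> = \<theta>1" using ex th1 c by blast
      then show ?thesis using th lwhisker_Cmp[OF S(3) S'(3) th(1) h] by simp
    qed auto
    then show ?thesis using ex' by simp
  qed
  show ?thesis
    unfolding pullback_def using SS D 1 2 by (auto simp: hom_def)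
qed

lemma pullback_Id1:
  assumes "f \<in> Loose K"
  shows "pullback K f (Id1 K (Cod K f)) (Id1 K (Dom K f)) f"
proof -
  note f = Loose_hom[OF assms]
  have I: "Id1 K (Cod K f) \<in> hom K (Cod K f) (Cod K f)" "Id1 K (Dom K f) \<in> hom K (Dom K f) (Dom K f)"
    using hom_Obj[OF f] Id1_hom by auto
  have 1: "\<exists>!h. h \<in> hom K Y (Dom K f) \<and> Id1 K (Dom K f) \<odot> h = x \<and> f \<odot> h = y"
    if "x \<in> hom K Y (Dom K f)" "y \<in> hom K Y (Cod K f)" "f \<odot> x = Id1 K (Cod K f) \<odot> y" for Y x y
    using that Id1_Cmp by metis
  have 2: "\<exists>!\<theta>. \<theta> \<in> cells K h h' \<and> Id1 K (Dom K f) \<rhd> \<theta> = \<sigma> \<and> f \<rhd> \<theta> = \<tau>"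
    if h: "h \<in> hom K Y (Dom K f)" "h' \<in> hom K Y (Dom K f)"
      and s: "\<sigma> \<in> cells K (Id1 K (Dom K f) \<odot> h) (Id1 K (Dom K f) \<odot> h')"
      and t: "\<tau> \<in> cells K (f \<odot> h) (f \<odot> h')"
      and eq: "f \<rhd> \<sigma> = Id1 K (Cod K f) \<rhd> \<tau>" for Y h h' \<sigma> \<tau>
  proof -
    have s: "\<sigma> \<in> cells K h h'" using s h Id1_Cmp by simp
    have "f \<rhd> \<sigma> = \<tau>" using eq Id1_Hcmp[OF t Cmp_hom[OF f h(1)]] by simp
    then show ?thesis using s Id1_Hcmp[OF _ h(1)] by metis
  qed
  show ?thesis
    unfolding pullback_def using I f 1 2 Cmp_Id1[OF f] Id1_Cmp[OF f] assms by (auto simp: hom_def)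
qed

lemma opfib_hom: "tight_discrete_opfibration K p \<Longrightarrow> p \<in> hom K (Dom K p) (Cod K p)"
  using Tight_Loose by (auto simp: tight_discrete_opfibration_def hom_def)

text \<open>
  Lifts along a discrete opfibration are determined by their source. Hence equality of the targets of
  two 2-cells is a conclusion of \<open>opfib_faithful\<close>, which is how 1-cells are identified later.
\<close>

lemma opfib_lift:
  assumes p: "tight_discrete_opfibration K p" and e: "e \<in> hom K Y (Dom K p)"
    and \<phi>: "\<phi> \<in> cells K (p \<odot> e) b"
  obtains e' \<nu> where "e' \<in> hom K Y (Dom K p)" "\<nu> \<in> cells K e e'" "p \<odot> e' = b" "p \<rhd> \<nu> = \<phi>"
proof -
  have b: "b \<in> hom K Y (Cod K p)" by (rule cells_parallel[OF \<phi> Cmp_hom[OF opfib_hom[OF p] e]])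
  obtain \<nu> where n: "\<nu> \<in> Cell K" "Src K \<nu> = e" "p \<rhd> \<nu> = \<phi>"
    using p e b \<phi> unfolding tight_discrete_opfibration_def by blast
  have nc: "\<nu> \<in> cells K e (Tgt K \<nu>)" using n by (simp add: cells_def)
  have "p \<rhd> \<nu> \<in> cells K (p \<odot> e) (p \<odot> Tgt K \<nu>)" by (rule lwhisker_cells[OF opfib_hom[OF p] nc e])
  then have "p \<odot> Tgt K \<nu> = b" using n \<phi> by (simp add: cells_def)
  then show thesis using that nc cells_parallel[OF nc e] n by blast
qed

lemma opfib_faithful:
  assumes p: "tight_discrete_opfibration K p" and e: "e \<in> hom K Y (Dom K p)"
    and n: "\<nu> \<in> cells K e e1" "\<nu>' \<in> cells K e e2" and eq: "p \<rhd> \<nu> = p \<rhd> \<nu>'"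
  shows "\<nu> = \<nu>'" "e1 = e2"
proof -
  have c: "p \<rhd> \<nu> \<in> cells K (p \<odot> e) (p \<odot> e1)" by (rule lwhisker_cells[OF opfib_hom[OF p] n(1) e])
  have b: "p \<odot> e1 \<in> hom K Y (Cod K p)"
    by (rule cells_parallel[OF c Cmp_hom[OF opfib_hom[OF p] e]])
  have "\<exists>!\<xi>. \<xi> \<in> Cell K \<and> Src K \<xi> = e \<and> p \<rhd> \<xi> = p \<rhd> \<nu>"
    using p e b c unfolding tight_discrete_opfibration_def by blast
  then show "\<nu> = \<nu>'" using n eq by (auto simp: cells_def)
  then show "e1 = e2" using n by (auto simp: cells_def)
qed

end

section \<open>Algebras and morphisms in the arrow 2-category\<close>

text \<open>
  A strict morphism \<open>q\<close> of lax algebras is a lax algebra in the arrow 2-category on the object \<open>q\<close>.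
  This predicate types its structure cells there and omits the axioms, which are equations between
  composites of these cells.
\<close>

definition algebra_cells ::
  "('o, 'm, 'c, 'x) e2cat_scheme \<Rightarrow> ('o, 'm, 'c) monad_data \<Rightarrow>
    'm \<Rightarrow> 'm \<Rightarrow> 'm \<Rightarrow> 'c \<Rightarrow> 'c \<Rightarrow> 'c \<Rightarrow> 'c \<Rightarrow> bool"
  where "algebra_cells K M q a' a \<upsilon>' \<upsilon> \<mu>' \<mu> \<longleftrightarrow> square K (T1 M q) q a' a \<and>
    square_cell K q q (Id1 K (Dom K q)) (Id1 K (Cod K q))
      (a' \<odot>\<^bsub>K\<^esub> eta M (Dom K q)) (a \<odot>\<^bsub>K\<^esub> eta M (Cod K q)) \<upsilon>' \<upsilon> \<and>
    square_cell K (T1 M (T1 M q)) q (a' \<odot>\<^bsub>K\<^esub> T1 M a') (a \<odot>\<^bsub>K\<^esub> T1 M a)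
      (a' \<odot>\<^bsub>K\<^esub> mul M (Dom K q)) (a \<odot>\<^bsub>K\<^esub> mul M (Cod K q)) \<mu>' \<mu>"

context enhanced_2monad
begin

lemma T1_Loose: "f \<in> Loose K \<Longrightarrow> T1 M f \<in> Loose K"
  and Dom_T1: "f \<in> Loose K \<Longrightarrow> Dom K (T1 M f) = T0 M (Dom K f)"
  and Cod_T1: "f \<in> Loose K \<Longrightarrow> Cod K (T1 M f) = T0 M (Cod K f)"
  using T1_hom[OF Loose_hom[of f]] by (simp_all add: hom_def)

lemma T2_lwhisker:
  assumes "f \<in> hom K B D" "\<phi> \<in> cells K g h" "g \<in> hom K A B"
  shows "T2 M (f \<rhd> \<phi>) = T1 M f \<rhd> T2 M \<phi>"
  using T2_Hcmp[OF Id2_hom_cells[OF assms(1)] assms(2)] T2_Id2[of f] assms by (simp add: hom_def)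

lemma T2_rwhisker:
  assumes "\<phi> \<in> cells K g h" "g \<in> hom K B D" "f \<in> hom K A B"
  shows "T2 M (\<phi> \<lhd> f) = T2 M \<phi> \<lhd> T1 M f"
  using T2_Hcmp[OF assms(1) Id2_hom_cells[OF assms(3)]] T2_Id2[of f] assms by (simp add: hom_def)

lemma square_T1:
  assumes f: "square K q r f' f"
  shows "square K (T1 M q) (T1 M r) (T1 M f') (T1 M f)"
proof -
  note F = squareD[OF f]
  have "T1 M r \<odot> T1 M f' = T1 M f \<odot> T1 M q" using T1_Cmp[OF F(2,3)] T1_Cmp[OF F(4,1)] F(5) by simp
  then show ?thesis using T1_hom[OF F(1)] T1_hom[OF F(2)] T1_hom[OF F(3)] T1_hom[OF F(4)]
    by (simp add: square_def hom_def)
qed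

lemma square_eta: "q \<in> Loose K \<Longrightarrow> square K q (T1 M q) (eta M (Dom K q)) (eta M (Cod K q))"
  using eta_natural[OF Loose_hom] eta_hom Dom_Obj Cod_Obj T1_Loose Dom_T1 Cod_T1
  by (simp add: square_def)

lemma square_mul: "q \<in> Loose K \<Longrightarrow> square K (T1 M (T1 M q)) (T1 M q) (mul M (Dom K q)) (mul M (Cod K q))"
  using mul_natural[OF Loose_hom] mul_hom Dom_Obj Cod_Obj T1_Loose Dom_T1 Cod_T1
  by (simp add: square_def)

lemma square_cell_T2:
  assumes c: "square_cell K q r f' f g' g \<gamma>' \<gamma>"
  shows "square_cell K (T1 M q) (T1 M r) (T1 M f') (T1 M f) (T1 M g') (T1 M g) (T2 M \<gamma>') (T2 M \<gamma>)"
proof -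
  note C = square_cellD[OF c]
  note F = squareD[OF C(1)]
  show ?thesis
    using square_T1[OF C(1)] square_T1[OF C(2)] T2_cells[OF C(3)] T2_cells[OF C(4)]
      T2_lwhisker[OF F(2) C(3) F(3)] T2_rwhisker[OF C(4) F(4,1)] C(5)
    by (simp add: square_cell_def)
qed

text \<open>
  The normal forms of the 1-cells that bound the two sides of the lax algebra axioms, and likewise
  of the axioms for lax morphisms in \<open>map_composites\<close>. They make the whiskered structure cells
  composable on the nose.
\<close>

lemma act_composites:
  assumes a: "a \<in> hom K (T0 M X) X"
  shows "(a \<odot> T1 M a) \<odot> eta M (T0 M X) = a \<odot> eta M X \<odot> a"
    and "(a \<odot> eta M X) \<odot> a = a \<odot> eta M X \<odot> a"
    and "(a \<odot> mul M X) \<odot> eta M (T0 M X) = a"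
    and "Id1 K X \<odot> a = a"
    and "a \<odot> T1 M (Id1 K X) = a"
    and "a \<odot> T1 M (a \<odot> eta M X) = (a \<odot> T1 M a) \<odot> T1 M (eta M X)"
    and "(a \<odot> mul M X) \<odot> T1 M (eta M X) = a"
    and "(a \<odot> T1 M a) \<odot> T1 M (T1 M a) = a \<odot> T1 M (a \<odot> T1 M a)"
    and "(a \<odot> mul M X) \<odot> T1 M (T1 M a) = (a \<odot> T1 M a) \<odot> mul M (T0 M X)"
    and "a \<odot> T1 M (a \<odot> mul M X) = (a \<odot> T1 M a) \<odot> T1 M (mul M X)"
    and "(a \<odot> mul M X) \<odot> T1 M (mul M X) = (a \<odot> mul M X) \<odot> mul M (T0 M X)"
proof -
  have X: "X \<in> Obj K" "T0 M X \<in> Obj K" using hom_Obj[OF a] by simp_all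
  note Ta = T1_hom[OF a] and e = eta_hom[OF X(1)] and eT = eta_hom[OF X(2)]
  note m = mul_hom[OF X(1)] and mT = mul_hom[OF X(2)]
  show "(a \<odot> T1 M a) \<odot> eta M (T0 M X) = a \<odot> eta M X \<odot> a"
    using Cmp_assoc[OF a Ta eT] eta_natural[OF a] by simp
  show "(a \<odot> eta M X) \<odot> a = a \<odot> eta M X \<odot> a" by (rule Cmp_assoc[OF a e a])
  show "(a \<odot> mul M X) \<odot> eta M (T0 M X) = a"
    using Cmp_assoc[OF a m eT] mul_eta[OF X(1)] Cmp_Id1[OF a] by simp
  show "Id1 K X \<odot> a = a" by (rule Id1_Cmp[OF a])
  show "a \<odot> T1 M (Id1 K X) = a" using T1_Id1[OF X(1)] Cmp_Id1[OF a] by simp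
  show "a \<odot> T1 M (a \<odot> eta M X) = (a \<odot> T1 M a) \<odot> T1 M (eta M X)"
    using T1_Cmp[OF a e] Cmp_assoc[OF a Ta T1_hom[OF e]] by simp
  show "(a \<odot> mul M X) \<odot> T1 M (eta M X) = a"
    using Cmp_assoc[OF a m T1_hom[OF e]] mul_T_eta[OF X(1)] Cmp_Id1[OF a] by simp
  show "(a \<odot> T1 M a) \<odot> T1 M (T1 M a) = a \<odot> T1 M (a \<odot> T1 M a)"
    using T1_Cmp[OF a Ta] Cmp_assoc[OF a Ta T1_hom[OF Ta]] by simp
  show "(a \<odot> mul M X) \<odot> T1 M (T1 M a) = (a \<odot> T1 M a) \<odot> mul M (T0 M X)"
    using Cmp_assoc[OF a m T1_hom[OF Ta]] Cmp_assoc[OF a Ta mT] mul_natural[OF a] by simp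
  show "a \<odot> T1 M (a \<odot> mul M X) = (a \<odot> T1 M a) \<odot> T1 M (mul M X)"
    using T1_Cmp[OF a m] Cmp_assoc[OF a Ta T1_hom[OF m]] by simp
  show "(a \<odot> mul M X) \<odot> T1 M (mul M X) = (a \<odot> mul M X) \<odot> mul M (T0 M X)"
    using Cmp_assoc[OF a m T1_hom[OF m]] Cmp_assoc[OF a m mT] mul_mul[OF X(1)] by simp
qed

lemma map_composites:
  assumes a: "a \<in> hom K (T0 M X) X" and b: "b \<in> hom K (T0 M Y) Y" and f: "f \<in> hom K X Y"
  shows "f \<odot> Id1 K X = f"
    and "Id1 K Y \<odot> f = f"
    and "(b \<odot> eta M Y) \<odot> f = (b \<odot> T1 M f) \<odot> eta M X"
    and "(f \<odot> a) \<odot> eta M X = f \<odot> a \<odot> eta M X"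
    and "b \<odot> T1 M (f \<odot> a) = (b \<odot> T1 M f) \<odot> T1 M a"
    and "(f \<odot> a) \<odot> T1 M a = f \<odot> a \<odot> T1 M a"
    and "(b \<odot> T1 M b) \<odot> T1 M (T1 M f) = b \<odot> T1 M (b \<odot> T1 M f)"
    and "(b \<odot> mul M Y) \<odot> T1 M (T1 M f) = (b \<odot> T1 M f) \<odot> mul M X"
    and "(f \<odot> a) \<odot> mul M X = f \<odot> a \<odot> mul M X"
proof -
  have O: "X \<in> Obj K" "Y \<in> Obj K" using hom_Obj[OF f] by simp_all
  note Ta = T1_hom[OF a] and Tb = T1_hom[OF b] and Tf = T1_hom[OF f]
  note e = eta_hom[OF O(1)] and m = mul_hom[OF O(1)]
  show "f \<odot> Id1 K X = f" by (rule Cmp_Id1[OF f])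
  show "Id1 K Y \<odot> f = f" by (rule Id1_Cmp[OF f])
  show "(b \<odot> eta M Y) \<odot> f = (b \<odot> T1 M f) \<odot> eta M X"
    using Cmp_assoc[OF b eta_hom[OF O(2)] f] Cmp_assoc[OF b Tf e] eta_natural[OF f] by simp
  show "(f \<odot> a) \<odot> eta M X = f \<odot> a \<odot> eta M X" by (rule Cmp_assoc[OF f a e])
  show "b \<odot> T1 M (f \<odot> a) = (b \<odot> T1 M f) \<odot> T1 M a"
    using T1_Cmp[OF f a] Cmp_assoc[OF b Tf Ta] by simp
  show "(f \<odot> a) \<odot> T1 M a = f \<odot> a \<odot> T1 M a" by (rule Cmp_assoc[OF f a Ta])
  show "(b \<odot> T1 M b) \<odot> T1 M (T1 M f) = b \<odot> T1 M (b \<odot> T1 M f)"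
    using T1_Cmp[OF b Tf] Cmp_assoc[OF b Tb T1_hom[OF Tf]] by simp
  show "(b \<odot> mul M Y) \<odot> T1 M (T1 M f) = (b \<odot> T1 M f) \<odot> mul M X"
    using Cmp_assoc[OF b mul_hom[OF O(2)] T1_hom[OF Tf]] Cmp_assoc[OF b Tf m] mul_natural[OF f] by simp
  show "(f \<odot> a) \<odot> mul M X = f \<odot> a \<odot> mul M X" by (rule Cmp_assoc[OF f a m])
qed

lemma algebra_cellsD:
  assumes "algebra_cells K M q a' a \<upsilon>' \<upsilon> \<mu>' \<mu>"
  shows "q \<in> Loose K"
    and "square K (T1 M q) q a' a"
    and "square_cell K q q (Id1 K (Dom K q)) (Id1 K (Cod K q))
      (a' \<odot> eta M (Dom K q)) (a \<odot> eta M (Cod K q)) \<upsilon>' \<upsilon>"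
    and "square_cell K (T1 M (T1 M q)) q (a' \<odot> T1 M a') (a \<odot> T1 M a)
      (a' \<odot> mul M (Dom K q)) (a \<odot> mul M (Cod K q)) \<mu>' \<mu>"
    and "a' \<in> hom K (T0 M (Dom K q)) (Dom K q)"
    and "a \<in> hom K (T0 M (Cod K q)) (Cod K q)"
  using assms Dom_T1[of q] Cod_T1[of q]
  by (auto simp: algebra_cells_def square_def square_cell_def)

text \<open>
  Both sides of every axiom are typed as parallel 2-cells of the arrow 2-category. An axiom then
  follows in two situations: if the source square is initial, or if the vertical target is a discrete
  opfibration and the axiom is known for the second components.
\<close>

lemma algebra_unit_cells:
  assumes "algebra_cells K M q a' a \<upsilon>' \<upsilon> \<mu>' \<mu>"
  shows "square_cell K (T1 M q) q a' a a' a
      ((\<mu>' \<lhd> eta M (T0 M (Dom K q))) \<bullet> (\<upsilon>' \<lhd> a')) ((\<mu> \<lhd> eta M (T0 M (Cod K q))) \<bullet> (\<upsilon> \<lhd> a))"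
    and "square_cell K (T1 M q) q a' a a' a
      ((\<mu>' \<lhd> T1 M (eta M (Dom K q))) \<bullet> (a' \<rhd> T2 M \<upsilon>')) ((\<mu> \<lhd> T1 M (eta M (Cod K q))) \<bullet> (a \<rhd> T2 M \<upsilon>))"
proof -
  note A = algebra_cellsD[OF assms]
  note c' = act_composites[OF A(5)] and c = act_composites[OF A(6)]
  note eT = square_eta[OF T1_Loose[OF A(1)], unfolded Dom_T1[OF A(1)] Cod_T1[OF A(1)]]
  show "square_cell K (T1 M q) q a' a a' a
      ((\<mu>' \<lhd> eta M (T0 M (Dom K q))) \<bullet> (\<upsilon>' \<lhd> a')) ((\<mu> \<lhd> eta M (T0 M (Cod K q))) \<bullet> (\<upsilon> \<lhd> a))"
    by (rule square_cell_Vcmp[OF square_cell_rwhisker[OF A(4) eT, unfolded c'(1,3) c(1,3)]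
          square_cell_rwhisker[OF A(3,2), unfolded c'(2,4) c(2,4)]])
  show "square_cell K (T1 M q) q a' a a' a
      ((\<mu>' \<lhd> T1 M (eta M (Dom K q))) \<bullet> (a' \<rhd> T2 M \<upsilon>')) ((\<mu> \<lhd> T1 M (eta M (Cod K q))) \<bullet> (a \<rhd> T2 M \<upsilon>))"
    by (rule square_cell_Vcmp[OF
          square_cell_rwhisker[OF A(4) square_T1[OF square_eta[OF A(1)]], unfolded c'(7) c(7)]
          square_cell_lwhisker[OF A(2) square_cell_T2[OF A(3)], unfolded c'(5,6) c(5,6)]])
qed

lemma algebra_assoc_cells:
  assumes "algebra_cells K M q a' a \<upsilon>' \<upsilon> \<mu>' \<mu>"
  defines "\<And>x X. assoc_source x X \<equiv> x \<odot> T1 M (x \<odot> T1 M x)"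
    and "\<And>x X. assoc_target x X \<equiv> (x \<odot> mul M X) \<odot> mul M (T0 M X)"
  shows "square_cell K (T1 M (T1 M (T1 M q))) q (assoc_source a' (Dom K q)) (assoc_source a (Cod K q))
      (assoc_target a' (Dom K q)) (assoc_target a (Cod K q))
      ((\<mu>' \<lhd> mul M (T0 M (Dom K q))) \<bullet> (\<mu>' \<lhd> T1 M (T1 M a')))
      ((\<mu> \<lhd> mul M (T0 M (Cod K q))) \<bullet> (\<mu> \<lhd> T1 M (T1 M a)))"
    and "square_cell K (T1 M (T1 M (T1 M q))) q (assoc_source a' (Dom K q)) (assoc_source a (Cod K q))
      (assoc_target a' (Dom K q)) (assoc_target a (Cod K q))
      ((\<mu>' \<lhd> T1 M (mul M (Dom K q))) \<bullet> (a' \<rhd> T2 M \<mu>'))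
      ((\<mu> \<lhd> T1 M (mul M (Cod K q))) \<bullet> (a \<rhd> T2 M \<mu>))"
proof -
  note A = algebra_cellsD[OF assms(1)]
  note c' = act_composites[OF A(5)] and c = act_composites[OF A(6)]
  note mT = square_mul[OF T1_Loose[OF A(1)], unfolded Dom_T1[OF A(1)] Cod_T1[OF A(1)]]
  show "square_cell K (T1 M (T1 M (T1 M q))) q (assoc_source a' (Dom K q)) (assoc_source a (Cod K q))
      (assoc_target a' (Dom K q)) (assoc_target a (Cod K q))
      ((\<mu>' \<lhd> mul M (T0 M (Dom K q))) \<bullet> (\<mu>' \<lhd> T1 M (T1 M a')))
      ((\<mu> \<lhd> mul M (T0 M (Cod K q))) \<bullet> (\<mu> \<lhd> T1 M (T1 M a)))"
    unfolding assms(2,3)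
    by (rule square_cell_Vcmp[OF square_cell_rwhisker[OF A(4) mT]
          square_cell_rwhisker[OF A(4) square_T1[OF square_T1[OF A(2)]], unfolded c'(8,9) c(8,9)]])
  show "square_cell K (T1 M (T1 M (T1 M q))) q (assoc_source a' (Dom K q)) (assoc_source a (Cod K q))
      (assoc_target a' (Dom K q)) (assoc_target a (Cod K q))
      ((\<mu>' \<lhd> T1 M (mul M (Dom K q))) \<bullet> (a' \<rhd> T2 M \<mu>'))
      ((\<mu> \<lhd> T1 M (mul M (Cod K q))) \<bullet> (a \<rhd> T2 M \<mu>))"
    unfolding assms(2,3)
    by (rule square_cell_Vcmp[OF
          square_cell_rwhisker[OF A(4) square_T1[OF square_mul[OF A(1)]], unfolded c'(11) c(11)]
          square_cell_lwhisker[OF A(2) square_cell_T2[OF A(4)], unfolded c'(10) c(10)]])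
qed

lemma morphism_unit_cells:
  assumes alg: "algebra_cells K M q a' a \<upsilon>' \<upsilon> \<mu>' \<mu>" "algebra_cells K M r b' b \<nu>' \<nu> \<pi>' \<pi>"
    and f: "square K q r f' f"
    and \<phi>: "square_cell K (T1 M q) r (b' \<odot> T1 M f') (b \<odot> T1 M f) (f' \<odot> a') (f \<odot> a) \<phi>' \<phi>"
  shows "square_cell K q r f' f (f' \<odot> a' \<odot> eta M (Dom K q)) (f \<odot> a \<odot> eta M (Cod K q))
      (f' \<rhd> \<upsilon>') (f \<rhd> \<upsilon>)"
    and "square_cell K q r f' f (f' \<odot> a' \<odot> eta M (Dom K q)) (f \<odot> a \<odot> eta M (Cod K q))
      ((\<phi>' \<lhd> eta M (Dom K q)) \<bullet> (\<nu>' \<lhd> f')) ((\<phi> \<lhd> eta M (Cod K q)) \<bullet> (\<nu> \<lhd> f))"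
proof -
  note A = algebra_cellsD[OF alg(1)] and B = algebra_cellsD[OF alg(2)]
  note c' = map_composites[OF A(5) B(5) squareD(3)[OF f]]
    and c = map_composites[OF A(6) B(6) squareD(4)[OF f]]
  show "square_cell K q r f' f (f' \<odot> a' \<odot> eta M (Dom K q)) (f \<odot> a \<odot> eta M (Cod K q))
      (f' \<rhd> \<upsilon>') (f \<rhd> \<upsilon>)"
    using square_cell_lwhisker[OF f A(3)] unfolding c'(1) c(1) .
  show "square_cell K q r f' f (f' \<odot> a' \<odot> eta M (Dom K q)) (f \<odot> a \<odot> eta M (Cod K q))
      ((\<phi>' \<lhd> eta M (Dom K q)) \<bullet> (\<nu>' \<lhd> f')) ((\<phi> \<lhd> eta M (Cod K q)) \<bullet> (\<nu> \<lhd> f))"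
    by (rule square_cell_Vcmp[OF
          square_cell_rwhisker[OF \<phi> square_eta[OF A(1)], unfolded c'(4) c(4)]
          square_cell_rwhisker[OF B(3) f, unfolded c'(2,3) c(2,3)]])
qed

lemma morphism_mult_cells:
  assumes alg: "algebra_cells K M q a' a \<upsilon>' \<upsilon> \<mu>' \<mu>" "algebra_cells K M r b' b \<nu>' \<nu> \<pi>' \<pi>"
    and f: "square K q r f' f"
    and \<phi>: "square_cell K (T1 M q) r (b' \<odot> T1 M f') (b \<odot> T1 M f) (f' \<odot> a') (f \<odot> a) \<phi>' \<phi>"
  shows "square_cell K (T1 M (T1 M q)) r
      (b' \<odot> T1 M (b' \<odot> T1 M f')) (b \<odot> T1 M (b \<odot> T1 M f))
      (f' \<odot> a' \<odot> mul M (Dom K q)) (f \<odot> a \<odot> mul M (Cod K q))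
      ((f' \<rhd> \<mu>') \<bullet> (\<phi>' \<lhd> T1 M a') \<bullet> (b' \<rhd> T2 M \<phi>')) ((f \<rhd> \<mu>) \<bullet> (\<phi> \<lhd> T1 M a) \<bullet> (b \<rhd> T2 M \<phi>))"
    and "square_cell K (T1 M (T1 M q)) r
      (b' \<odot> T1 M (b' \<odot> T1 M f')) (b \<odot> T1 M (b \<odot> T1 M f))
      (f' \<odot> a' \<odot> mul M (Dom K q)) (f \<odot> a \<odot> mul M (Cod K q))
      ((\<phi>' \<lhd> mul M (Dom K q)) \<bullet> (\<pi>' \<lhd> T1 M (T1 M f'))) ((\<phi> \<lhd> mul M (Cod K q)) \<bullet> (\<pi> \<lhd> T1 M (T1 M f)))"
proof -
  note A = algebra_cellsD[OF alg(1)] and B = algebra_cellsD[OF alg(2)]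
  note c' = map_composites[OF A(5) B(5) squareD(3)[OF f]]
    and c = map_composites[OF A(6) B(6) squareD(4)[OF f]]
  show "square_cell K (T1 M (T1 M q)) r
      (b' \<odot> T1 M (b' \<odot> T1 M f')) (b \<odot> T1 M (b \<odot> T1 M f))
      (f' \<odot> a' \<odot> mul M (Dom K q)) (f \<odot> a \<odot> mul M (Cod K q))
      ((f' \<rhd> \<mu>') \<bullet> (\<phi>' \<lhd> T1 M a') \<bullet> (b' \<rhd> T2 M \<phi>')) ((f \<rhd> \<mu>) \<bullet> (\<phi> \<lhd> T1 M a) \<bullet> (b \<rhd> T2 M \<phi>))"
    by (rule square_cell_Vcmp[OF square_cell_lwhisker[OF f A(4)] square_cell_Vcmp[OF
          square_cell_rwhisker[OF \<phi> square_T1[OF A(2)], unfolded c'(6) c(6)]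
          square_cell_lwhisker[OF B(2) square_cell_T2[OF \<phi>], unfolded c'(5) c(5)]]])
  show "square_cell K (T1 M (T1 M q)) r
      (b' \<odot> T1 M (b' \<odot> T1 M f')) (b \<odot> T1 M (b \<odot> T1 M f))
      (f' \<odot> a' \<odot> mul M (Dom K q)) (f \<odot> a \<odot> mul M (Cod K q))
      ((\<phi>' \<lhd> mul M (Dom K q)) \<bullet> (\<pi>' \<lhd> T1 M (T1 M f'))) ((\<phi> \<lhd> mul M (Cod K q)) \<bullet> (\<pi> \<lhd> T1 M (T1 M f)))"
    by (rule square_cell_Vcmp[OF
          square_cell_rwhisker[OF \<phi> square_mul[OF A(1)], unfolded c'(9) c(9)]
          square_cell_rwhisker[OF B(4) square_T1[OF square_T1[OF f]], unfolded c'(7,8) c(7,8)]])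
qed

lemma transformation_cells:
  assumes alg: "algebra_cells K M q a' a \<upsilon>' \<upsilon> \<mu>' \<mu>" "algebra_cells K M r b' b \<nu>' \<nu> \<pi>' \<pi>"
    and \<phi>: "square_cell K (T1 M q) r (b' \<odot> T1 M f') (b \<odot> T1 M f) (f' \<odot> a') (f \<odot> a) \<phi>' \<phi>"
    and \<psi>: "square_cell K (T1 M q) r (b' \<odot> T1 M g') (b \<odot> T1 M g) (g' \<odot> a') (g \<odot> a) \<psi>' \<psi>"
    and \<theta>: "square_cell K q r f' f g' g \<theta>' \<theta>"
  shows "square_cell K (T1 M q) r (b' \<odot> T1 M f') (b \<odot> T1 M f) (g' \<odot> a') (g \<odot> a)
      ((\<theta>' \<lhd> a') \<bullet> \<phi>') ((\<theta> \<lhd> a) \<bullet> \<phi>)"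
    and "square_cell K (T1 M q) r (b' \<odot> T1 M f') (b \<odot> T1 M f) (g' \<odot> a') (g \<odot> a)
      (\<psi>' \<bullet> (b' \<rhd> T2 M \<theta>')) (\<psi> \<bullet> (b \<rhd> T2 M \<theta>))"
  by (rule square_cell_Vcmp[OF square_cell_rwhisker[OF \<theta> algebra_cellsD(2)[OF alg(1)]] \<phi>]
      square_cell_Vcmp[OF \<psi> square_cell_lwhisker[OF algebra_cellsD(2)[OF alg(2)] square_cell_T2[OF \<theta>]]])+

section \<open>Strict morphisms as algebras in the arrow 2-category\<close>

lemma lax_algebraD:
  assumes "lax_algebra K M A"
  shows "carr A \<in> Obj K" "act A \<in> hom K (T0 M (carr A)) (carr A)" "act A \<in> Tight K"
    and "unitor A \<in> cells K (Id1 K (carr A)) (act A \<odot> eta M (carr A))"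
    and "multor A \<in> cells K (act A \<odot> T1 M (act A)) (act A \<odot> mul M (carr A))"
  using assms by (simp_all add: lax_algebra_def Let_def)

text \<open>
  With identity structure cell, the axioms of a lax morphism reduce to the compatibility of \<open>f\<close> with
  the unitors and the multiplicators.
\<close>

lemma strict_lmor_algebra_cells:
  assumes A: "lax_algebra K M A" and B: "lax_algebra K M B" and f: "f \<in> hom K (carr A) (carr B)"
  shows "strict_morphism K M (strict_lmor K A B f) \<longleftrightarrow>
    algebra_cells K M f (act A) (act B) (unitor A) (unitor B) (multor A) (multor B)"
proof (cases "act B \<odot> T1 M f = f \<odot> act A")
  case True
  note LA = lax_algebraD[OF A] and LB = lax_algebraD[OF B]
  note c = map_composites[OF LA(2) LB(2) f]
  have D: "Dom K f = carr A" "Cod K f = carr B" "f \<in> Loose K" using f by (simp_all add: hom_def)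
  have fa: "f \<odot> act A \<in> hom K (T0 M (carr A)) (carr B)" by (rule Cmp_hom[OF f LA(2)])
  note e = eta_hom[OF LA(1)] and m = mul_hom[OF LA(1)]
  have bf: "act B \<odot> T1 M f \<in> hom K (T0 M (carr A)) (carr B)" using fa True by simp
  have aTa: "act A \<odot> T1 M (act A) \<in> hom K (T0 M (T0 M (carr A))) (carr A)"
    by (rule Cmp_hom[OF LA(2) T1_hom[OF LA(2)]])
  have fm: "f \<rhd> multor A \<in> cells K (f \<odot> act A \<odot> T1 M (act A)) (f \<odot> act A \<odot> mul M (carr A))"
    by (rule lwhisker_cells[OF f LA(5) aTa])
  have "Id2 K (f \<odot> act A) \<lhd> eta M (carr A) = Id2 K ((act B \<odot> eta M (carr B)) \<odot> f)"
    using whisker_Id2[OF fa e] c(3) True by simp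
  then have unit: "(Id2 K (f \<odot> act A) \<lhd> eta M (carr A)) \<bullet> (unitor B \<lhd> f) = unitor B \<lhd> f"
    using Id2_Vcmp[OF rwhisker_cells[OF LB(4) Id1_hom[OF LB(1)] f]] by simp
  have "Id2 K (f \<odot> act A) \<lhd> mul M (carr A) = Id2 K ((act B \<odot> mul M (carr B)) \<odot> T1 M (T1 M f))"
    using whisker_Id2[OF fa m] c(8) True by simp
  then have mult: "(Id2 K (f \<odot> act A) \<lhd> mul M (carr A)) \<bullet> (multor B \<lhd> T1 M (T1 M f))
      = multor B \<lhd> T1 M (T1 M f)"
    using Id2_Vcmp[OF rwhisker_cells[OF LB(5) Cmp_hom[OF LB(2) T1_hom[OF LB(2)]] T1_hom[OF T1_hom[OF f]]]]
    by simp
  have i1: "Id2 K (f \<odot> act A) \<lhd> T1 M (act A) = Id2 K (f \<odot> act A \<odot> T1 M (act A))"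
    using whisker_Id2[OF fa T1_hom[OF LA(2)]] c(6) by simp
  have "act B \<rhd> T2 M (Id2 K (f \<odot> act A)) = Id2 K (act B \<odot> T1 M (f \<odot> act A))"
    using T2_Id2[OF hom_Loose[OF fa]] whisker_Id2[OF LB(2) T1_hom[OF fa]] by simp
  then have i2: "act B \<rhd> T2 M (Id2 K (f \<odot> act A)) = Id2 K (f \<odot> act A \<odot> T1 M (act A))"
    using c(5,6) True by simp
  have "f \<odot> act A \<odot> T1 M (act A) \<in> hom K (T0 M (T0 M (carr A))) (carr B)" by (rule Cmp_hom[OF f aTa])
  then have mult': "(f \<rhd> multor A) \<bullet> (Id2 K (f \<odot> act A) \<lhd> T1 M (act A))
      \<bullet> (act B \<rhd> T2 M (Id2 K (f \<odot> act A))) = f \<rhd> multor A"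
    unfolding i1 i2 using Vcmp_Id2[OF fm] Vcmp_Id2[OF Id2_hom_cells] by simp
  have sq: "square K (T1 M f) f (act A) (act B)"
    using True D LA LB T1_hom[OF f] by (simp add: square_def hom_def)
  have "square K f f (Id1 K (carr A)) (Id1 K (carr B))" using square_Id1[OF D(3)] D by simp
  moreover have "square K f f (act A \<odot> eta M (carr A)) (act B \<odot> eta M (carr B))"
    using square_Cmp[OF sq square_eta[OF D(3)]] D by simp
  moreover have "square K (T1 M (T1 M f)) f (act A \<odot> T1 M (act A)) (act B \<odot> T1 M (act B))"
    by (rule square_Cmp[OF sq square_T1[OF sq]])
  moreover have "square K (T1 M (T1 M f)) f (act A \<odot> mul M (carr A)) (act B \<odot> mul M (carr B))"
    using square_Cmp[OF sq square_mul[OF D(3)]] D by simp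
  ultimately have "algebra_cells K M f (act A) (act B) (unitor A) (unitor B) (multor A) (multor B)
      \<longleftrightarrow> f \<rhd> unitor A = unitor B \<lhd> f \<and> f \<rhd> multor A = multor B \<lhd> T1 M (T1 M f)"
    using sq D LA LB by (simp add: algebra_cells_def square_cell_def)
  moreover have "Id2 K (f \<odot> act A) \<in> cells K (act B \<odot> T1 M f) (f \<odot> act A)"
    using Id2_hom_cells[OF fa] True by simp
  ultimately show ?thesis
    using A B f unit mult mult'
    by (simp add: strict_morphism_def lax_morphism_def strict_lmor_def Let_def)
next
  case False
  have "f \<odot> act A \<in> hom K (T0 M (carr A)) (carr B)" by (rule Cmp_hom[OF f lax_algebraD(2)[OF A]])
  then have "Id2 K (f \<odot> act A) \<in> cells K (f \<odot> act A) (f \<odot> act A)" by (rule Id2_hom_cells)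
  then have "Id2 K (f \<odot> act A) \<notin> cells K (act B \<odot> T1 M f) (f \<odot> act A)"
    using False by (simp add: cells_def)
  then show ?thesis using False
    by (simp add: strict_morphism_def lax_morphism_def strict_lmor_def Let_def algebra_cells_def square_def)
qed

text \<open>
  Any lax algebra is an algebra in the arrow 2-category on an identity. Through it the axioms of a
  single lax morphism into \<open>E\<close>, and not only those of a pair, become equations of 2-cells of the
  arrow 2-category with vertical target \<open>p : E \<rightarrow> B\<close>.
\<close>

lemma algebra_cells_Id1:
  assumes A: "lax_algebra K M A"
  shows "algebra_cells K M (Id1 K (carr A)) (act A) (act A) (unitor A) (unitor A) (multor A) (multor A)"
proof -
  note L = lax_algebraD[OF A]
  note I = Id1_hom[OF L(1)]
  have D: "Dom K (Id1 K (carr A)) = carr A" "Cod K (Id1 K (carr A)) = carr A" "Id1 K (carr A) \<in> Loose K"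
    using I by (simp_all add: hom_def)
  have TI: "T1 M (Id1 K (carr A)) = Id1 K (T0 M (carr A))"
    "T1 M (Id1 K (T0 M (carr A))) = Id1 K (T0 M (T0 M (carr A)))"
    using T1_Id1 T0_Obj L(1) by simp_all
  have aTa: "act A \<odot> T1 M (act A) \<in> hom K (T0 M (T0 M (carr A))) (carr A)"
    by (rule Cmp_hom[OF L(2) T1_hom[OF L(2)]])
  have sq: "square K (T1 M (Id1 K (carr A))) (Id1 K (carr A)) (act A) (act A)"
    using L(1,2) D T1_hom[OF I] Cmp_Id1[OF L(2)] Id1_Cmp[OF L(2)] TI by (simp add: square_def hom_def)
  show ?thesis
    unfolding algebra_cells_def D square_cell_def
    using sq L square_Id1[OF D(3)] square_Cmp[OF sq square_eta[OF D(3)]]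
      square_Cmp[OF sq square_mul[OF D(3)]] square_Cmp[OF sq square_T1[OF sq]] D TI
      Id1_Hcmp[OF L(4) I] Hcmp_Id1[OF L(4) I] Id1_Hcmp[OF L(5) aTa] Hcmp_Id1[OF L(5) aTa]
    by simp
qed

end

context enhanced_2category
begin

lemma square_Id1_iff:
  "\<lbrakk>X \<in> Obj K; r \<in> Loose K; x' \<in> hom K X (Dom K r); x \<in> hom K X (Cod K r)\<rbrakk>
    \<Longrightarrow> square K (Id1 K X) r x' x \<longleftrightarrow> r \<odot> x' = x"
  using Id1_hom[of X] Cmp_Id1[of x X] by (auto simp: square_def hom_def)

lemma square_cell_Id1_iff:
  assumes "square K (Id1 K X) r x' x" "square K (Id1 K X) r y' y" "X \<in> Obj K"
    and "\<gamma>' \<in> cells K x' y'" "\<gamma> \<in> cells K x y"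
  shows "square_cell K (Id1 K X) r x' x y' y \<gamma>' \<gamma> \<longleftrightarrow> r \<rhd> \<gamma>' = \<gamma>"
proof -
  have "x \<in> hom K X (Cod K r)" using squareD(4)[OF assms(1)] Id1_hom[OF assms(3)] by (simp add: hom_def)
  then show ?thesis using Hcmp_Id1[OF assms(5)] assms by (simp add: square_cell_def)
qed

text \<open>
  Into a discrete opfibration, a 2-cell of the arrow 2-category is determined by its ends and its
  second component.
\<close>

lemma opfib_square_cell_unique:
  assumes r: "tight_discrete_opfibration K r"
    and "square_cell K q r f' f g' g \<gamma>' \<gamma>" "square_cell K q r f' f g' g \<delta>' \<gamma>"
  shows "\<gamma>' = \<delta>'"
proof -
  note C = square_cellD[OF assms(2)] and D = square_cellD[OF assms(3)]
  show ?thesis using opfib_faithful(1)[OF r squareD(3)[OF C(1)] C(3) D(3)] C(5) D(5) by simp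
qed

lemma opfib_square_cell_Id2:
  assumes r: "tight_discrete_opfibration K r" and c: "square_cell K q r f' f g' f \<gamma>' (Id2 K f)"
  shows "g' = f'"
proof -
  note C = square_cellD[OF c]
  note F = squareD[OF C(1)]
  have "r \<rhd> \<gamma>' = r \<rhd> Id2 K f'" using C(5) F(5) whisker_Id2[OF F(4,1)] whisker_Id2[OF F(2,3)] by simp
  then show ?thesis using opfib_faithful(2)[OF r F(3) C(3) Id2_hom_cells[OF F(3)]] by simp
qed

text \<open>
  Unique lifting is inherited by the pullback \<open>q\<close> of a discrete opfibration. This applies to \<open>T p\<close>,
  which is a pullback of \<open>u\<close>.
\<close>

lemma pullback_opfib_faithful:
  assumes u: "tight_discrete_opfibration K u" and pb: "pullback K u a a' q"
    and e: "e \<in> hom K Y (Dom K q)"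
    and n: "\<nu> \<in> cells K e e1" "\<nu>' \<in> cells K e e2" and eq: "q \<rhd> \<nu> = q \<rhd> \<nu>'"
  shows "e1 = e2"
proof -
  note S = squareD[OF pullback_square[OF pb]]
  have "u \<rhd> a' \<rhd> \<xi> = a \<rhd> q \<rhd> \<xi>" if "\<xi> \<in> cells K e e'" for \<xi> e'
    using lwhisker_Cmp[OF S(2,3) that e] lwhisker_Cmp[OF S(4,1) that e] S(5) by simp
  then have "u \<rhd> a' \<rhd> \<nu> = u \<rhd> a' \<rhd> \<nu>'" using n eq by simp
  then have a: "a' \<odot> e1 = a' \<odot> e2"
    by (rule opfib_faithful(2)[OF u Cmp_hom[OF S(3) e] lwhisker_cells[OF S(3) n(1) e]
          lwhisker_cells[OF S(3) n(2) e]])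
  have "q \<odot> e1 = q \<odot> e2"
    using lwhisker_cells[OF S(1) n(1) e] lwhisker_cells[OF S(1) n(2) e] eq by (simp add: cells_def)
  then show ?thesis by (rule pullback_monic[OF pb cells_parallel[OF n(1) e] cells_parallel[OF n(2) e] a])
qed

end

section \<open>Pullbacks of lax algebras\<close>

context enhanced_2monad
begin

lemma hom_LaxAlg: "F \<in> hom (LaxAlg K M) A B \<longleftrightarrow> lax_morphism K M F \<and> ldom F = A \<and> lcod F = B"
  by (simp add: hom_def LaxAlg_def)

lemma cells_LaxAlg:
  "P \<in> cells (LaxAlg K M) F G \<longleftrightarrow> lax_2morphism K M P \<and> lsrc P = F \<and> ltgt P = G"
  by (simp add: cells_def LaxAlg_def)

lemma lwhisker_LaxAlg: "F \<rhd>\<^bsub>LaxAlg K M\<^esub> P =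
  \<lparr>lsrc = lax_Cmp K M F (lsrc P), ltgt = lax_Cmp K M F (ltgt P), lund = lmap F \<rhd> lund P\<rparr>"
  by (simp add: LaxAlg_def)

lemma LaxAlg_simps:
  "Loose (LaxAlg K M) = {F. lax_morphism K M F}" "Dom (LaxAlg K M) = ldom"
  "Cod (LaxAlg K M) = lcod" "F \<odot>\<^bsub>LaxAlg K M\<^esub> G = lax_Cmp K M F G"
  by (simp_all add: LaxAlg_def)

lemma lax_morphismD:
  assumes "lax_morphism K M F"
  shows "lax_algebra K M (ldom F)" "lax_algebra K M (lcod F)"
    and "lmap F \<in> hom K (carr (ldom F)) (carr (lcod F))"
    and "lcell F \<in> cells K (act (lcod F) \<odot> T1 M (lmap F)) (lmap F \<odot> act (ldom F))"
    and "lmap F \<rhd> unitor (ldom F) =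
      (lcell F \<lhd> eta M (carr (ldom F))) \<bullet> (unitor (lcod F) \<lhd> lmap F)"
    and "(lmap F \<rhd> multor (ldom F)) \<bullet> (lcell F \<lhd> T1 M (act (ldom F))) \<bullet>
        (act (lcod F) \<rhd> T2 M (lcell F)) =
      (lcell F \<lhd> mul M (carr (ldom F))) \<bullet> (multor (lcod F) \<lhd> T1 M (T1 M (lmap F)))"
  using assms by (simp_all add: lax_morphism_def Let_def)

lemma strict_lmorD:
  assumes "strict_morphism K M (strict_lmor K A B f)"
  shows "lax_algebra K M A" "lax_algebra K M B" "f \<in> hom K (carr A) (carr B)"
    and "lax_morphism K M (strict_lmor K A B f)"
    and "algebra_cells K M f (act A) (act B) (unitor A) (unitor B) (multor A) (multor B)"
    and "square K (T1 M f) f (act A) (act B)"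
proof -
  show L: "lax_morphism K M (strict_lmor K A B f)" using assms by (simp add: strict_morphism_def)
  show D: "lax_algebra K M A" "lax_algebra K M B" "f \<in> hom K (carr A) (carr B)"
    using lax_morphismD[OF L] by (simp_all add: strict_lmor_def)
  show A: "algebra_cells K M f (act A) (act B) (unitor A) (unitor B) (multor A) (multor B)"
    using assms strict_lmor_algebra_cells[OF D] by simp
  show "square K (T1 M f) f (act A) (act B)" by (rule algebra_cellsD(2)[OF A])
qed

lemma lax_Cmp_strict_left:
  assumes F: "lax_morphism K M F" "lcod F = A" and A: "lax_algebra K M A"
    and f: "f \<in> hom K (carr A) (carr B)"
  shows "lax_Cmp K M (strict_lmor K A B f) F =
    \<lparr>ldom = ldom F, lcod = B, lmap = f \<odot> lmap F, lcell = f \<rhd> lcell F\<rparr>"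
proof -
  note L = lax_morphismD[OF F(1), unfolded F(2)]
  note a = lax_algebraD(2)[OF A] and Tx = T1_hom[OF L(3)]
  have "Id2 K (f \<odot> act A) \<lhd> T1 M (lmap F) = Id2 K (f \<odot> act A \<odot> T1 M (lmap F))"
    using whisker_Id2[OF Cmp_hom[OF f a] Tx] Cmp_assoc[OF f a Tx] by simp
  then show ?thesis
    using Vcmp_Id2[OF lwhisker_cells[OF f L(4) Cmp_hom[OF a Tx]]]
    by (simp add: lax_Cmp_def strict_lmor_def)
qed

lemma lax_Cmp_strict_right:
  assumes F: "lax_morphism K M F" "ldom F = B" and f: "strict_morphism K M (strict_lmor K A B f)"
  shows "lax_Cmp K M F (strict_lmor K A B f) =
    \<lparr>ldom = A, lcod = lcod F, lmap = lmap F \<odot> f, lcell = lcell F \<lhd> T1 M f\<rparr>"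
proof -
  note L = lax_morphismD[OF F(1), unfolded F(2)] and S = strict_lmorD[OF f]
  note a = lax_algebraD(2)[OF S(1)] and b = lax_algebraD(2)[OF S(2)] and Tf = T1_hom[OF S(3)]
  have src: "act (lcod F) \<odot> T1 M (lmap F) \<in> hom K (T0 M (carr B)) (carr (lcod F))"
    by (rule Cmp_hom[OF lax_algebraD(2)[OF L(2)] T1_hom[OF L(3)]])
  have "lmap F \<rhd> Id2 K (f \<odot> act A) = Id2 K ((lmap F \<odot> act B) \<odot> T1 M f)"
    using whisker_Id2[OF L(3) Cmp_hom[OF S(3) a]] Cmp_assoc[OF L(3) b Tf] squareD(5)[OF S(6)] by simp
  then show ?thesis
    using Id2_Vcmp[OF rwhisker_cells[OF L(4) src Tf]]
    by (simp add: lax_Cmp_def strict_lmor_def)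
qed

lemma lax_morphism_square_cell:
  assumes F: "lax_morphism K M F" "ldom F = A" "lcod F = E" and p: "strict_morphism K M (strict_lmor K E B p)"
  shows "square K (Id1 K (carr A)) p (lmap F) (p \<odot> lmap F)"
    and "square_cell K (T1 M (Id1 K (carr A))) p (act E \<odot> T1 M (lmap F)) (act B \<odot> T1 M (p \<odot> lmap F))
      (lmap F \<odot> act A) ((p \<odot> lmap F) \<odot> act A) (lcell F) (p \<rhd> lcell F)"
proof -
  note L = lax_morphismD[OF F(1), unfolded F(2,3)] and S = strict_lmorD[OF p]
  note X = lax_algebraD[OF L(1)] and e = lax_algebraD[OF L(2)]
  have D: "Dom K p = carr E" "Cod K p = carr B" "p \<in> Loose K" using S(3) by (simp_all add: hom_def)
  have py: "p \<odot> lmap F \<in> hom K (carr A) (carr B)" by (rule Cmp_hom[OF S(3) L(3)])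
  show sq: "square K (Id1 K (carr A)) p (lmap F) (p \<odot> lmap F)"
    using square_Id1_iff[OF X(1) D(3)] D L(3) py by simp
  have src: "square K (T1 M (Id1 K (carr A))) p (act E \<odot> T1 M (lmap F)) (act B \<odot> T1 M (p \<odot> lmap F))"
    by (rule square_Cmp[OF S(6) square_T1[OF sq]])
  have tgt: "square K (T1 M (Id1 K (carr A))) p (lmap F \<odot> act A) ((p \<odot> lmap F) \<odot> act A)"
    by (rule square_Cmp[OF sq algebra_cellsD(2)[OF algebra_cells_Id1[OF L(1)]]])
  have c: "p \<rhd> lcell F \<in> cells K (act B \<odot> T1 M (p \<odot> lmap F)) ((p \<odot> lmap F) \<odot> act A)"
  proof -
    have "p \<odot> act E \<odot> T1 M (lmap F) = act B \<odot> T1 M (p \<odot> lmap F)"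
      using squareD(5)[OF src] T1_Id1[OF X(1)]
        Cmp_Id1[OF Cmp_hom[OF lax_algebraD(2)[OF S(2)] T1_hom[OF py]]] by simp
    moreover have "p \<odot> lmap F \<odot> act A = (p \<odot> lmap F) \<odot> act A"
      by (rule Cmp_assoc[symmetric, OF S(3) L(3) X(2)])
    ultimately show ?thesis
      using lwhisker_cells[OF S(3) L(4) Cmp_hom[OF e(2) T1_hom[OF L(3)]]] by simp
  qed
  show "square_cell K (T1 M (Id1 K (carr A))) p (act E \<odot> T1 M (lmap F)) (act B \<odot> T1 M (p \<odot> lmap F))
      (lmap F \<odot> act A) ((p \<odot> lmap F) \<odot> act A) (lcell F) (p \<rhd> lcell F)"
    using square_cell_Id1_iff[OF _ _ T0_Obj[OF X(1)] L(4) c] src tgt T1_Id1[OF X(1)] by simp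
qed

text \<open>
  A lift along \<open>p\<close> of the structure cell of a lax morphism satisfies the axioms, because they hold
  after applying \<open>p\<close> and both sides have the same source. The same argument reflects 2-morphisms
  in \<open>lax_2morphism_reflect\<close>.
\<close>

lemma lax_morphism_reflect:
  assumes A: "lax_algebra K M A" and p: "strict_morphism K M (strict_lmor K E B p)"
    and fib: "tight_discrete_opfibration K p"
    and F: "lax_morphism K M F" "ldom F = A" "lcod F = B"
    and h: "h \<in> hom K (carr A) (carr E)" "p \<odot> h = lmap F"
    and c: "\<chi> \<in> cells K (act E \<odot> T1 M h) (h \<odot> act A)" "p \<rhd> \<chi> = lcell F"
  shows "lax_morphism K M \<lparr>ldom = A, lcod = E, lmap = h, lcell = \<chi>\<rparr>"
proof -
  note L = lax_morphismD[OF F(1), unfolded F(2,3)] and S = strict_lmorD[OF p]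
  note X = lax_algebraD[OF A]
  have D: "Dom K p = carr E" "Cod K p = carr B" "p \<in> Loose K" using S(3) by (simp_all add: hom_def)
  have I: "Dom K (Id1 K (carr A)) = carr A" "Cod K (Id1 K (carr A)) = carr A"
    using Id1_hom[OF X(1)] by (simp_all add: hom_def)
  note AI = algebra_cells_Id1[OF A]
  have sq: "square K (Id1 K (carr A)) p h (lmap F)"
    using square_Id1_iff[OF X(1) D(3)] D h L(3) by simp
  have "square_cell K (T1 M (Id1 K (carr A))) p (act E \<odot> T1 M h) (act B \<odot> T1 M (lmap F))
      (h \<odot> act A) (lmap F \<odot> act A) \<chi> (lcell F)"
    using square_cell_Id1_iff[OF _ _ T0_Obj[OF X(1)] c(1) L(4)] c(2) T1_Id1[OF X(1)]
      square_Cmp[OF S(6) square_T1[OF sq]] square_Cmp[OF sq algebra_cellsD(2)[OF AI]] by simp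
  note U = morphism_unit_cells[OF AI S(5) sq this, unfolded I]
    and V = morphism_mult_cells[OF AI S(5) sq this, unfolded I]
  have "h \<rhd> unitor A = (\<chi> \<lhd> eta M (carr A)) \<bullet> (unitor E \<lhd> h)"
    by (rule opfib_square_cell_unique[OF fib U(1)]) (use U(2) L(5) in simp)
  moreover have "(h \<rhd> multor A) \<bullet> (\<chi> \<lhd> T1 M (act A)) \<bullet> (act E \<rhd> T2 M \<chi>) =
      (\<chi> \<lhd> mul M (carr A)) \<bullet> (multor E \<lhd> T1 M (T1 M h))"
    by (rule opfib_square_cell_unique[OF fib V(1)]) (use V(2) L(6) in simp)
  ultimately show ?thesis using A S(1) h c by (simp add: lax_morphism_def Let_def)
qed

lemma lax_2morphism_reflect:
  assumes p: "strict_morphism K M (strict_lmor K E B p)" and fib: "tight_discrete_opfibration K p"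
    and F: "lax_morphism K M F" "ldom F = A" "lcod F = E"
    and G: "lax_morphism K M G" "ldom G = A" "lcod G = E"
    and \<theta>: "\<theta> \<in> cells K (lmap F) (lmap G)"
    and \<tau>: "lax_2morphism K M \<lparr>lsrc = lax_Cmp K M (strict_lmor K E B p) F,
      ltgt = lax_Cmp K M (strict_lmor K E B p) G, lund = p \<rhd> \<theta>\<rparr>"
  shows "lax_2morphism K M \<lparr>lsrc = F, ltgt = G, lund = \<theta>\<rparr>"
proof -
  note S = strict_lmorD[OF p]
  note LF = lax_morphismD[OF F(1), unfolded F(2,3)]
  have pF: "lax_Cmp K M (strict_lmor K E B p) F =
      \<lparr>ldom = A, lcod = B, lmap = p \<odot> lmap F, lcell = p \<rhd> lcell F\<rparr>"
    using lax_Cmp_strict_left[OF F(1,3) S(1,3)] F(2) by simp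
  have pG: "lax_Cmp K M (strict_lmor K E B p) G =
      \<lparr>ldom = A, lcod = B, lmap = p \<odot> lmap G, lcell = p \<rhd> lcell G\<rparr>"
    using lax_Cmp_strict_left[OF G(1,3) S(1,3)] G(2) by simp
  have \<tau>': "p \<rhd> \<theta> \<in> cells K (p \<odot> lmap F) (p \<odot> lmap G)"
    "((p \<rhd> \<theta>) \<lhd> act A) \<bullet> (p \<rhd> lcell F) = (p \<rhd> lcell G) \<bullet> (act B \<rhd> T2 M (p \<rhd> \<theta>))"
    using \<tau> unfolding pF pG by (simp_all add: lax_2morphism_def Let_def)
  note SF = lax_morphism_square_cell[OF F p] and SG = lax_morphism_square_cell[OF G p]
  have "square_cell K (Id1 K (carr A)) p (lmap F) (p \<odot> lmap F) (lmap G) (p \<odot> lmap G) \<theta> (p \<rhd> \<theta>)"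
    using square_cell_Id1_iff[OF SF(1) SG(1) lax_algebraD(1)[OF LF(1)] \<theta> \<tau>'(1)] by simp
  note W = transformation_cells[OF algebra_cells_Id1[OF LF(1)] S(5) SF(2) SG(2) this]
  have "(\<theta> \<lhd> act A) \<bullet> lcell F = lcell G \<bullet> (act E \<rhd> T2 M \<theta>)"
    by (rule opfib_square_cell_unique[OF fib W(1)]) (use W(2) \<tau>'(2) in simp)
  then show ?thesis using F G \<theta> by (simp add: lax_2morphism_def Let_def)
qed

text \<open>
  A 1-cell into the pullback is found in \<open>K\<close>. Its structure cell has to lie over that of \<open>y\<close>, so it
  is the lift \<open>\<chi>\<close> of \<open>lcell y\<close> along \<open>p\<close>; unique lifting along \<open>u\<close> shows that \<open>g\<close> maps it to the
  structure cell of \<open>x\<close>, and thereby that its target is the required one.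
\<close>

theorem LaxAlg_pullback:
  assumes p: "strict_morphism K M (strict_lmor K E B p)" "tight_discrete_opfibration K p"
    and u: "strict_morphism K M (strict_lmor K D Z u)" "tight_discrete_opfibration K u"
    and pb: "pullback K u h g p"
    and G: "lax_morphism K M G" "ldom G = E" "lcod G = D" "lmap G = g"
    and H: "lax_morphism K M H" "ldom H = B" "lcod H = Z" "lmap H = h"
    and GH: "square_cell K (T1 M p) u (act D \<odot> T1 M g) (act Z \<odot> T1 M h)
      (g \<odot> act E) (h \<odot> act B) (lcell G) (lcell H)"
  shows "pullback (LaxAlg K M) (strict_lmor K D Z u) H G (strict_lmor K E B p)"
proof -
  let ?P = "strict_lmor K E B p" and ?U = "strict_lmor K D Z u"
  note P = strict_lmorD[OF p(1)] and U = strict_lmorD[OF u(1)]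
  note LG = lax_morphismD[OF G(1), unfolded G(2-4)] and LH = lax_morphismD[OF H(1), unfolded H(2-4)]
  note S = squareD[OF pullback_square[OF pb]]
  have Dp: "Dom K p = carr E" "Cod K p = carr B" and Du: "Dom K u = carr D" "Cod K u = carr Z"
    and Dh: "Dom K h = carr B"
    using P(3) U(3) LH(3) by (simp_all add: hom_def)
  note e = lax_algebraD(2)[OF P(1)] and b = lax_algebraD(2)[OF P(2)] and d = lax_algebraD(2)[OF U(1)]
  have Cmp_P: "lax_Cmp K M ?P F = \<lparr>ldom = ldom F, lcod = B, lmap = p \<odot> lmap F, lcell = p \<rhd> lcell F\<rparr>"
    if "lax_morphism K M F" "lcod F = E" for F by (rule lax_Cmp_strict_left[OF that P(1,3)])
  have Cmp_U: "lax_Cmp K M ?U F = \<lparr>ldom = ldom F, lcod = Z, lmap = u \<odot> lmap F, lcell = u \<rhd> lcell F\<rparr>"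
    if "lax_morphism K M F" "lcod F = D" for F by (rule lax_Cmp_strict_left[OF that U(1,3)])
  have sel: "ldom ?P = E" "lcod ?P = B" "lmap ?P = p" "ldom ?U = D" "lcod ?U = Z" "lmap ?U = u"
    by (simp_all add: strict_lmor_def)
  have comm: "lax_Cmp K M ?U G = lax_Cmp K M H ?P"
    using Cmp_U[OF G(1,3)] lax_Cmp_strict_right[OF H(1,2) p(1)] G H S(5) square_cellD(5)[OF GH] by simp
  have one: "\<exists>!k. (lax_morphism K M k \<and> ldom k = A \<and> lcod k = E) \<and>
      lax_Cmp K M G k = x \<and> lax_Cmp K M ?P k = y"
    if x: "lax_morphism K M x" "ldom x = A" "lcod x = D" and y: "lax_morphism K M y" "ldom y = A" "lcod y = B"
      and xy: "lax_Cmp K M ?U x = lax_Cmp K M H y" for A x y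
  proof -
    note X = lax_morphismD[OF x(1), unfolded x(2,3)] and Y = lax_morphismD[OF y(1), unfolded y(2,3)]
    note O = lax_algebraD(1)[OF X(1)] and a = lax_algebraD(2)[OF X(1)]
    have xy0: "u \<odot> lmap x = h \<odot> lmap y"
      and xyc: "u \<rhd> lcell x = (h \<rhd> lcell y) \<bullet> (lcell H \<lhd> T1 M (lmap y))"
      using xy H Cmp_U[OF x(1,3)] by (simp_all add: lax_Cmp_def)
    obtain k where k: "k \<in> hom K (carr A) (carr E)" "g \<odot> k = lmap x" "p \<odot> k = lmap y"
      using pullback_factor[OF pb _ _ xy0, of "carr A"] X(3) Y(3) Dp Du Dh by metis
    have "p \<odot> act E \<odot> T1 M k = act B \<odot> T1 M (lmap y)"
      using Cmp_assoc[OF P(3) e T1_hom[OF k(1)]] Cmp_assoc[OF b T1_hom[OF P(3)] T1_hom[OF k(1)]]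
        squareD(5)[OF P(6)] T1_Cmp[OF P(3) k(1)] k(3) by simp
    then have "lcell y \<in> cells K (p \<odot> act E \<odot> T1 M k) (lmap y \<odot> act A)" using Y(4) by simp
    then obtain l \<chi> where l: "l \<in> hom K (T0 M (carr A)) (carr E)" "p \<odot> l = lmap y \<odot> act A"
      and \<chi>: "\<chi> \<in> cells K (act E \<odot> T1 M k) l" "p \<rhd> \<chi> = lcell y"
      using opfib_lift[OF p(2), of "act E \<odot> T1 M k" "T0 M (carr A)"] Cmp_hom[OF e T1_hom[OF k(1)]] Dp
      by metis
    note TO = T0_Obj[OF O]
    have sqk: "square K (Id1 K (carr A)) p k (lmap y)"
      using square_Id1_iff[OF O hom_Loose[OF P(3)]] Dp k Y(3) by simp
    have sql: "square K (Id1 K (T0 M (carr A))) p l (lmap y \<odot> act A)"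
      using square_Id1_iff[OF TO hom_Loose[OF P(3)]] Dp l Cmp_hom[OF Y(3) a] by simp
    note sqTk = square_T1[OF sqk, unfolded T1_Id1[OF O]]
    have c1: "square_cell K (Id1 K (T0 M (carr A))) p (act E \<odot> T1 M k) (act B \<odot> T1 M (lmap y))
        l (lmap y \<odot> act A) \<chi> (lcell y)"
      using square_cell_Id1_iff[OF square_Cmp[OF P(6) sqTk] sql TO \<chi>(1) Y(4)] \<chi>(2) by simp
    \<comment> \<open>The structure cell of the composite of \<open>G\<close> with the lift lies over that of \<open>H\<close> with \<open>y\<close>,
      as does the structure cell of \<open>x\<close>; so the two agree, targets included.\<close>
    have src: "(act D \<odot> T1 M g) \<odot> T1 M k = act D \<odot> T1 M (lmap x)"
      using Cmp_assoc[OF d T1_hom[OF LG(3)] T1_hom[OF k(1)]] T1_Cmp[OF LG(3) k(1)] k(2) by simp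
    have mid: "(g \<odot> act E) \<odot> T1 M k = g \<odot> act E \<odot> T1 M k"
      "(h \<odot> act B) \<odot> T1 M (lmap y) = h \<odot> act B \<odot> T1 M (lmap y)"
      by (rule Cmp_assoc[OF LG(3) e T1_hom[OF k(1)]] Cmp_assoc[OF LH(3) b T1_hom[OF Y(3)]])+
    note c2 = square_cell_Vcmp[OF square_cell_lwhisker[OF pullback_square[OF pb] c1]
        square_cell_rwhisker[OF GH sqTk, unfolded src mid]]
    have cell: "(g \<rhd> \<chi>) \<bullet> (lcell G \<lhd> T1 M k) \<in> cells K (act D \<odot> T1 M (lmap x)) (g \<odot> l)"
      by (rule square_cellD(3)[OF c2])
    have "u \<rhd> ((g \<rhd> \<chi>) \<bullet> (lcell G \<lhd> T1 M k)) = u \<rhd> lcell x"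
      using square_cell_Id1_iff[OF square_cellD(1,2)[OF c2] TO square_cellD(3,4)[OF c2]] c2 xyc by simp
    note eqs = opfib_faithful[OF u(2) _ cell X(4) this, of "T0 M (carr A)"]
    have src_hom: "act D \<odot> T1 M (lmap x) \<in> hom K (T0 M (carr A)) (Dom K u)"
      using Cmp_hom[OF d T1_hom[OF X(3)]] Du by simp
    have Gk: "(g \<rhd> \<chi>) \<bullet> (lcell G \<lhd> T1 M k) = lcell x" by (rule eqs(1)[OF src_hom])
    have gl: "g \<odot> l = lmap x \<odot> act A" by (rule eqs(2)[OF src_hom])
    have l_eq: "l = k \<odot> act A"
    proof (rule pullback_monic[OF pb])
      show "l \<in> hom K (T0 M (carr A)) (Dom K p)" "k \<odot> act A \<in> hom K (T0 M (carr A)) (Dom K p)"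
        using l Cmp_hom[OF k(1) a] Dp by simp_all
      show "g \<odot> l = g \<odot> k \<odot> act A" using gl Cmp_assoc[OF LG(3) k(1) a] k(2) by simp
      show "p \<odot> l = p \<odot> k \<odot> act A" using l Cmp_assoc[OF P(3) k(1) a] k(3) by simp
    qed
    let ?k = "\<lparr>ldom = A, lcod = E, lmap = k, lcell = \<chi>\<rparr>"
    have lax: "lax_morphism K M ?k"
      by (rule lax_morphism_reflect[OF X(1) p y k(1,3) _ \<chi>(2)]) (use \<chi>(1) l_eq in simp)
    have Gk_x: "lax_Cmp K M G ?k = x" using Gk k(2) x(2,3) G(3,4) by (intro lmor.equality) (simp_all add: lax_Cmp_def)
    have Pk_y: "lax_Cmp K M ?P ?k = y" using Cmp_P[OF lax] k(3) \<chi>(2) y(2,3) by (intro lmor.equality) simp_all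
    have unique: "k' = ?k" if k': "lax_morphism K M k'" "ldom k' = A" "lcod k' = E"
      "lax_Cmp K M G k' = x" "lax_Cmp K M ?P k' = y" for k'
    proof -
      note L = lax_morphismD[OF k'(1), unfolded k'(2,3)]
      have "g \<odot> lmap k' = lmap x" using k'(4) G(4) by (auto simp: lax_Cmp_def)
      moreover have pk: "p \<odot> lmap k' = lmap y" "p \<rhd> lcell k' = lcell y"
        using k'(5) Cmp_P[OF k'(1,3)] by auto
      ultimately have eq: "lmap k' = k"
        using pullback_monic[OF pb, of "lmap k'" "carr A" k] L(3) k Dp by simp
      have "lcell k' = \<chi>"
        using opfib_faithful(1)[OF p(2) _ L(4), of "T0 M (carr A)" \<chi> l] \<chi> pk eq
          Cmp_hom[OF e T1_hom[OF k(1)]] Dp by simp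
      then show ?thesis using eq k'(2,3) by (intro lmor.equality) simp_all
    qed
    show ?thesis
    proof (rule ex1I[of _ ?k])
      show "(lax_morphism K M ?k \<and> ldom ?k = A \<and> lcod ?k = E) \<and>
          lax_Cmp K M G ?k = x \<and> lax_Cmp K M ?P ?k = y"
        using lax Gk_x Pk_y by simp
    qed (elim conjE, rule unique)
  qed
  have two: "\<exists>!\<Theta>. (lax_2morphism K M \<Theta> \<and> lsrc \<Theta> = k \<and> ltgt \<Theta> = k') \<and>
      G \<rhd>\<^bsub>LaxAlg K M\<^esub> \<Theta> = \<sigma> \<and> ?P \<rhd>\<^bsub>LaxAlg K M\<^esub> \<Theta> = \<tau>"
    if k: "lax_morphism K M k" "ldom k = A" "lcod k = E" and k': "lax_morphism K M k'" "ldom k' = A" "lcod k' = E"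
      and s: "lax_2morphism K M \<sigma>" "lsrc \<sigma> = lax_Cmp K M G k" "ltgt \<sigma> = lax_Cmp K M G k'"
      and t: "lax_2morphism K M \<tau>" "lsrc \<tau> = lax_Cmp K M ?P k" "ltgt \<tau> = lax_Cmp K M ?P k'"
      and st: "?U \<rhd>\<^bsub>LaxAlg K M\<^esub> \<sigma> = H \<rhd>\<^bsub>LaxAlg K M\<^esub> \<tau>" for A k k' \<sigma> \<tau>
  proof -
    note L = lax_morphismD[OF k(1), unfolded k(2,3)] and L' = lax_morphismD[OF k'(1), unfolded k'(2,3)]
    have "lund \<sigma> \<in> cells K (g \<odot> lmap k) (g \<odot> lmap k')"
      using s G(4) by (simp add: lax_2morphism_def Let_def lax_Cmp_def)
    moreover have "lund \<tau> \<in> cells K (p \<odot> lmap k) (p \<odot> lmap k')"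
      using t sel by (simp add: lax_2morphism_def Let_def lax_Cmp_def)
    moreover have "u \<rhd> lund \<sigma> = h \<rhd> lund \<tau>" using st sel H(4) by (simp add: lwhisker_LaxAlg)
    ultimately have ex: "\<exists>!\<theta>. \<theta> \<in> cells K (lmap k) (lmap k') \<and> g \<rhd> \<theta> = lund \<sigma> \<and> p \<rhd> \<theta> = lund \<tau>"
      using pullback_factor_cell[OF pb] L(3) L'(3) Dp by simp
    then obtain \<theta> where th: "\<theta> \<in> cells K (lmap k) (lmap k')" "g \<rhd> \<theta> = lund \<sigma>" "p \<rhd> \<theta> = lund \<tau>"
      by blast
    have "\<tau> = \<lparr>lsrc = lax_Cmp K M ?P k, ltgt = lax_Cmp K M ?P k', lund = p \<rhd> \<theta>\<rparr>"
      using t(2,3) th(3) by (intro lcell2.equality) simp_all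
    then have lax: "lax_2morphism K M \<lparr>lsrc = k, ltgt = k', lund = \<theta>\<rparr>"
      using lax_2morphism_reflect[OF p k k' th(1)] t(1) by simp
    have unique: "\<Theta> = \<lparr>lsrc = k, ltgt = k', lund = \<theta>\<rparr>"
      if "lax_2morphism K M \<Theta>" "lsrc \<Theta> = k" "ltgt \<Theta> = k'"
        "G \<rhd>\<^bsub>LaxAlg K M\<^esub> \<Theta> = \<sigma>" "?P \<rhd>\<^bsub>LaxAlg K M\<^esub> \<Theta> = \<tau>" for \<Theta>
    proof -
      have "lund \<Theta> \<in> cells K (lmap k) (lmap k')" "g \<rhd> lund \<Theta> = lund \<sigma>" "p \<rhd> lund \<Theta> = lund \<tau>"
        using that sel G(4) by (auto simp: lax_2morphism_def Let_def lwhisker_LaxAlg)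
      then have "lund \<Theta> = \<theta>" using ex th by blast
      then show ?thesis using that(2,3) by (intro lcell2.equality) simp_all
    qed
    have whisker: "G \<rhd>\<^bsub>LaxAlg K M\<^esub> \<lparr>lsrc = k, ltgt = k', lund = \<theta>\<rparr> = \<sigma>"
      "?P \<rhd>\<^bsub>LaxAlg K M\<^esub> \<lparr>lsrc = k, ltgt = k', lund = \<theta>\<rparr> = \<tau>"
      unfolding lwhisker_LaxAlg
      using s(2,3) t(2,3) th(2,3) sel G(4) by (intro lcell2.equality; simp)+
    show ?thesis
    proof (rule ex1I[of _ "\<lparr>lsrc = k, ltgt = k', lund = \<theta>\<rparr>"])
      show "(lax_2morphism K M \<lparr>lsrc = k, ltgt = k', lund = \<theta>\<rparr> \<and>
          lsrc \<lparr>lsrc = k, ltgt = k', lund = \<theta>\<rparr> = k \<and> ltgt \<lparr>lsrc = k, ltgt = k', lund = \<theta>\<rparr> = k') \<and>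
          G \<rhd>\<^bsub>LaxAlg K M\<^esub> \<lparr>lsrc = k, ltgt = k', lund = \<theta>\<rparr> = \<sigma> \<and>
          ?P \<rhd>\<^bsub>LaxAlg K M\<^esub> \<lparr>lsrc = k, ltgt = k', lund = \<theta>\<rparr> = \<tau>"
        using lax whisker by simp
    qed (elim conjE, rule unique)
  qed
  have one': "\<exists>!k. k \<in> hom (LaxAlg K M) A E \<and> lax_Cmp K M G k = x \<and> lax_Cmp K M ?P k = y"
    if "x \<in> hom (LaxAlg K M) A D" "y \<in> hom (LaxAlg K M) A B" "lax_Cmp K M ?U x = lax_Cmp K M H y" for A x y
    using that unfolding hom_LaxAlg by (elim conjE) (rule one)
  have two': "\<exists>!\<Theta>. \<Theta> \<in> cells (LaxAlg K M) k k' \<and>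
      G \<rhd>\<^bsub>LaxAlg K M\<^esub> \<Theta> = \<sigma> \<and> ?P \<rhd>\<^bsub>LaxAlg K M\<^esub> \<Theta> = \<tau>"
    if "k \<in> hom (LaxAlg K M) A E" "k' \<in> hom (LaxAlg K M) A E"
      "\<sigma> \<in> cells (LaxAlg K M) (lax_Cmp K M G k) (lax_Cmp K M G k')"
      "\<tau> \<in> cells (LaxAlg K M) (lax_Cmp K M ?P k) (lax_Cmp K M ?P k')"
      "?U \<rhd>\<^bsub>LaxAlg K M\<^esub> \<sigma> = H \<rhd>\<^bsub>LaxAlg K M\<^esub> \<tau>" for A k k' \<sigma> \<tau>
    using that unfolding hom_LaxAlg cells_LaxAlg by (elim conjE) (rule two)
  have "?U \<in> Loose (LaxAlg K M)" "H \<in> Loose (LaxAlg K M)"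
    "G \<in> hom (LaxAlg K M) E D" "?P \<in> hom (LaxAlg K M) E B"
    using P(4) U(4) G H sel by (simp_all add: hom_LaxAlg LaxAlg_simps)
  then show ?thesis
    unfolding pullback_def LaxAlg_simps sel H(2,3) using comm one' two' by blast
qed

end

section \<open>Pullback squares into the classifier are initial\<close>

context enhanced_2classifier
begin

lemma clsf_opfib: "tight_discrete_opfibration K (clsf C)"
  by (rule Small_opfib[OF clsf_Small])

lemma Small_Loose: "p \<in> Small K \<Longrightarrow> p \<in> Loose K"
  using hom_Loose[OF opfib_hom[OF Small_opfib]] .

text \<open>
  A small map is its own chosen pullback along the identity, and projections of left-tight pullbacks
  detect tightness.
\<close>

lemma Small_detects_Tight:
  assumes p: "p \<in> Small K" and h: "h \<in> hom K Y (Dom K p)" "p \<odot> h \<in> Tight K"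
  shows "h \<in> Tight K"
proof -
  note ph = opfib_hom[OF Small_opfib[OF p]]
  have "left_tight_pullback K p (Id1 K (Cod K p)) (Id1 K (Dom K p)) p"
    using chosen[OF p Id1_hom[OF hom_Obj(2)[OF ph]]] PbProj_Id1[OF p] PbTop_Id1[OF p] by simp
  then show ?thesis using h unfolding left_tight_pullback_def by blast
qed

lemma dmap_square: "p \<in> Small K \<Longrightarrow> square K p (clsf C) (dtop C p) (dmap C p)"
  by (rule pullback_square[OF classify])

lemma dmap_clsf_iso:
  "square_iso K (clsf C) (clsf C) (dtop C (clsf C)) (dmap C (clsf C))
    (Id1 K (Dom K (clsf C))) (Id1 K (Cod K (clsf C)))"
proof -
  let ?u = "clsf C"
  obtain \<phi>' \<phi> where \<phi>: "\<phi>' \<in> cells K (dtop C ?u) (Id1 K (Dom K ?u))"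
    "\<phi> \<in> cells K (dmap C ?u) (Id1 K (Cod K ?u))"
    "iso2 K \<phi>'" "iso2 K \<phi>" "?u \<rhd> \<phi>' = \<phi> \<lhd> ?u" using classify_clsf by blast
  then have "square_cell K ?u ?u (dtop C ?u) (dmap C ?u)
      (Id1 K (Dom K ?u)) (Id1 K (Cod K ?u)) \<phi>' \<phi>"
    by (simp add: square_cell_def dmap_square clsf_Small square_Id1 Small_Loose)
  then show ?thesis using \<phi>(3,4) by (rule square_isoI)
qed

text \<open>
  Classification of squares from \<open>q\<close> to \<open>u\<close> gives unique maps into \<open>(d\<^sub>\<bullet>u \<odot> x', du \<odot> x)\<close>, a square
  isomorphic to \<open>(x', x)\<close> since \<open>u\<close> classifies itself by an identity up to isomorphism.
\<close>

lemma dmap_initial_square: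
  assumes q: "q \<in> Small K"
  shows "initial_square K q (clsf C) (dtop C q) (dmap C q)"
proof -
  let ?u = "clsf C"
  have "\<exists>!\<gamma>\<gamma>. square_cell K q ?u (dtop C q) (dmap C q) x' x (fst \<gamma>\<gamma>) (snd \<gamma>\<gamma>)"
    if sq: "square K q ?u x' x" for x' x
  proof (rule square_cell_ex1_iso_target)
    note X = squareD[OF sq]
    have sq1: "square K q ?u (dtop C ?u \<odot> x') (dmap C ?u \<odot> x)"
      by (rule square_Cmp[OF dmap_square[OF clsf_Small] sq])
    have "square_cell K q ?u (dtop C q) (dmap C q) (dtop C ?u \<odot> x') (dmap C ?u \<odot> x) (fst \<gamma>\<gamma>) (snd \<gamma>\<gamma>)
        \<longleftrightarrow> classifying_cells K C q ?u x' x \<gamma>\<gamma>" for \<gamma>\<gamma>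
      using sq1 dmap_square[OF q] by (simp add: square_cell_def classifying_cells_def split_beta)
    then show "\<exists>!\<gamma>\<gamma>. square_cell K q ?u (dtop C q) (dmap C q)
        (dtop C ?u \<odot> x') (dmap C ?u \<odot> x) (fst \<gamma>\<gamma>) (snd \<gamma>\<gamma>)"
      using classify_square[OF q clsf_Small X(3-5)] by simp
    from square_iso_rwhisker[OF dmap_clsf_iso sq]
    show "square_iso K q ?u (dtop C ?u \<odot> x') (dmap C ?u \<odot> x) x' x"
      using Id1_Cmp[OF X(3)] Id1_Cmp[OF X(4)] by simp
  qed
  then show ?thesis using dmap_square[OF q] by (simp add: initial_square_def)
qed

lemma Small_pullback_initial_square:
  assumes q: "q \<in> Small K" and pb: "pullback K (clsf C) a a' q"
  shows "initial_square K q (clsf C) a' a"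
proof -
  let ?u = "clsf C"
  note sq = pullback_square[OF pb]
  note X = squareD[OF sq]
  obtain \<gamma>' \<gamma> where g: "classifying_cells K C q ?u a' a (\<gamma>', \<gamma>)"
    using classify_square[OF q clsf_Small X(3-5)] by auto
  have "square_cell K q ?u (dtop C q) (dmap C q) (dtop C ?u \<odot> a') (dmap C ?u \<odot> a) \<gamma>' \<gamma>"
    using g dmap_square[OF q] square_Cmp[OF dmap_square[OF clsf_Small] sq]
    by (simp add: square_cell_def classifying_cells_def)
  then have "square_iso K q ?u (dtop C q) (dmap C q) (dtop C ?u \<odot> a') (dmap C ?u \<odot> a)"
    using classify_pullback[OF q clsf_Small pb g] by (intro square_isoI) auto
  note init = initial_square_iso[OF dmap_initial_square[OF q] this]
  from square_iso_rwhisker[OF dmap_clsf_iso sq]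
  have "square_iso K q ?u (dtop C ?u \<odot> a') (dmap C ?u \<odot> a) a' a"
    using Id1_Cmp[OF X(3)] Id1_Cmp[OF X(4)] by simp
  then show ?thesis by (rule initial_square_iso[OF init])
qed

text \<open>
  The opfibration \<open>q\<close> is isomorphic over its codomain to the chosen pullback of \<open>u\<close> along \<open>a\<close>, which
  is small. The isomorphism \<open>k\<close> may fail to be tight, so smallness does not pass to \<open>q\<close>; the universal
  property is transported instead along \<open>k\<close> and its inverse \<open>l\<close>. This generality is used for
  \<open>q = T p\<close> and its iterates.
\<close>

theorem pullback_initial_square:
  assumes pb: "pullback K (clsf C) a a' q"
  shows "initial_square K q (clsf C) a' a"
proof -
  let ?u = "clsf C" and ?q = "PbProj K (clsf C) a" and ?a' = "PbTop K (clsf C) a"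
  note sq = pullback_square[OF pb]
  note S = squareD[OF sq]
  have ltp: "left_tight_pullback K ?u a ?a' ?q" by (rule chosen[OF clsf_Small S(4)])
  have small: "?q \<in> Small K" by (rule Small_stable[OF clsf_Small ltp])
  have pb0: "pullback K ?u a ?a' ?q" using ltp by (simp add: left_tight_pullback_def)
  note S0 = squareD[OF pullback_square[OF pb0]]
  have C: "Cod K ?q = Cod K q" "Dom K a = Cod K q" using S S0 by (simp_all add: hom_def)
  note q0 = S0(1)[unfolded C(1)]
  have q0a: "?q \<in> hom K (Dom K ?q) (Dom K a)" and qa: "q \<in> hom K (Dom K q) (Dom K a)"
    using q0 S(1) C(2) by simp_all
  obtain k where k: "k \<in> hom K (Dom K ?q) (Dom K q)" "a' \<odot> k = ?a'" "q \<odot> k = ?q"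
    using pullback_factor[OF pb S0(3) q0a S0(5)] .
  obtain l where l: "l \<in> hom K (Dom K q) (Dom K ?q)" "?a' \<odot> l = a'" "?q \<odot> l = q"
    using pullback_factor[OF pb0 S(3) qa S(5)] .
  have kl: "k \<odot> l = Id1 K (Dom K q)"
  proof (rule pullback_monic[OF pb])
    show "k \<odot> l \<in> hom K (Dom K q) (Dom K q)" by (rule Cmp_hom[OF k(1) l(1)])
    show "Id1 K (Dom K q) \<in> hom K (Dom K q) (Dom K q)" by (rule Id1_hom[OF hom_Obj(1)[OF S(1)]])
    show "a' \<odot> k \<odot> l = a' \<odot> Id1 K (Dom K q)"
      by (simp only: Cmp_assoc[symmetric, OF S(3) k(1) l(1)] Cmp_Id1[OF S(3)] k l)
    show "q \<odot> k \<odot> l = q \<odot> Id1 K (Dom K q)"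
      by (simp only: Cmp_assoc[symmetric, OF S(1) k(1) l(1)] Cmp_Id1[OF S(1)] k l)
  qed
  have sqk: "square K ?q q k (Id1 K (Cod K q))"
    using k S(1) q0 Id1_Cmp[OF q0] Id1_hom[OF hom_Obj(2)[OF S(1)]] by (simp add: square_def hom_def)
  have sql: "square K q ?q l (Id1 K (Cod K q))"
    using l S(1) q0 Id1_Cmp[OF S(1)] Id1_hom[OF hom_Obj(2)[OF S(1)]] by (simp add: square_def hom_def)
  note init = Small_pullback_initial_square[OF small pb0]
  have "\<exists>!\<gamma>\<gamma>. square_cell K q ?u a' a x' x (fst \<gamma>\<gamma>) (snd \<gamma>\<gamma>)" if x: "square K q ?u x' x" for x' x
  proof -
    note X = squareD[OF x]
    have x0: "square K ?q ?u (x' \<odot> k) x" using square_Cmp[OF x sqk] Cmp_Id1[OF X(4)] by simp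
    obtain \<gamma>' \<gamma> where g: "square_cell K ?q ?u ?a' a (x' \<odot> k) x \<gamma>' \<gamma>"
      using initial_squareE[OF init x0] .
    have xkl: "(x' \<odot> k) \<odot> l = x'" by (simp only: Cmp_assoc[OF X(3) k(1) l(1)] kl Cmp_Id1[OF X(3)])
    have g': "square_cell K q ?u a' a x' x (\<gamma>' \<lhd> l) \<gamma>"
      using square_cell_rwhisker[OF g sql] xkl l Cmp_Id1[OF S(4)] Cmp_Id1[OF X(4)]
        Hcmp_Id1[OF square_cellD(4)[OF g] S(4)] by simp
    have unique: "(\<delta>', \<delta>) = (\<gamma>' \<lhd> l, \<gamma>)" if d: "square_cell K q ?u a' a x' x \<delta>' \<delta>" for \<delta>' \<delta>
    proof -
      note D = square_cellD[OF d]
      have "square_cell K ?q ?u ?a' a (x' \<odot> k) x (\<delta>' \<lhd> k) \<delta>"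
        using square_cell_rwhisker[OF d sqk] k Cmp_Id1[OF S(4)] Cmp_Id1[OF X(4)] Hcmp_Id1[OF D(4) S(4)]
        by simp
      then have "\<delta>' \<lhd> k = \<gamma>'" "\<delta> = \<gamma>" using initial_square_unique[OF init _ g] by simp_all
      then show ?thesis using rwhisker_Cmp[OF D(3) S(3) k(1) l(1)] kl Hcmp_Id1[OF D(3) S(3)] by simp
    qed
    show ?thesis
    proof (rule ex1I[of _ "(\<gamma>' \<lhd> l, \<gamma>)"])
      show "square_cell K q ?u a' a x' x (fst (\<gamma>' \<lhd> l, \<gamma>)) (snd (\<gamma>' \<lhd> l, \<gamma>))" using g' by simp
      show "dd = (\<gamma>' \<lhd> l, \<gamma>)" if "square_cell K q ?u a' a x' x (fst dd) (snd dd)" for dd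
        using unique[OF that] by simp
    qed
  qed
  then show ?thesis using sq by (simp add: initial_square_def)
qed

text \<open>
  The 2-cell \<open>\<gamma>\<close> is the comparison from the pullback square \<open>(a', a)\<close> to an arbitrary square \<open>(x', x)\<close>
  out of \<open>q\<close>, and \<open>\<delta>\<close> is the comparison from \<open>q\<close> to the pullback \<open>q1\<close> of \<open>u\<close> along \<open>x\<close>. In both
  directions \<open>\<delta>\<close> turns out to have a strict two-sided inverse \<open>j\<close>.
\<close>

theorem iso2_iff_comparison_split_equivalence:
  assumes pb: "pullback K (clsf C) a a' q"
    and g: "square_cell K q (clsf C) a' a x' x \<gamma>' \<gamma>"
    and pb1: "pullback K (clsf C) x t q1"
    and \<delta>: "\<delta> \<in> hom K (Dom K q) (Dom K q1)" "t \<odot> \<delta> = x'" "q1 \<odot> \<delta> = q"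
  shows "iso2 K \<gamma> \<longleftrightarrow> split_equivalence K \<delta>"
proof -
  let ?u = "clsf C"
  note u = clsf_opfib
  note G = square_cellD[OF g]
  note S = squareD[OF G(1)] and X = squareD[OF G(2)] and S1 = squareD[OF pullback_square[OF pb1]]
  have Cq: "Cod K q1 = Cod K q" using X(4) S1(4) by (simp add: hom_def)
  note q1 = S1(1)[unfolded Cq]
  have O: "Dom K q \<in> Obj K" "Cod K q \<in> Obj K" "Dom K q1 \<in> Obj K"
    using hom_Obj[OF S(1)] hom_Obj[OF q1] by simp_all
  have D\<delta>: "Dom K \<delta> = Dom K q" "Cod K \<delta> = Dom K q1" "\<delta> \<in> Loose K" using \<delta>(1) by (simp_all add: hom_def)
  have sq\<delta>: "square K q q1 \<delta> (Id1 K (Cod K q))"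
    using \<delta> S(1) q1 Id1_Cmp[OF S(1)] Id1_hom[OF O(2)] by (simp add: square_def hom_def)
  have sqj: "square K q1 q j (Id1 K (Cod K q))" if "j \<in> hom K (Dom K q1) (Dom K q)" "q \<odot> j = q1" for j
    using that S(1) q1 Id1_Cmp[OF q1] Id1_hom[OF O(2)] by (simp add: square_def hom_def)
  show ?thesis
  proof
    assume "iso2 K \<gamma>"
    then obtain \<psi> where psi: "\<psi> \<in> cells K x a" "\<psi> \<bullet> \<gamma> = Id2 K a" "\<gamma> \<bullet> \<psi> = Id2 K x"
      using iso2_cells[OF G(4)] by auto
    \<comment> \<open>Transporting \<open>t\<close> along the inverse of \<open>\<gamma>\<close> gives a cone over \<open>u\<close> and \<open>a\<close>, hence the inverse \<open>j\<close>.\<close>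
    have \<psi>q1: "\<psi> \<lhd> q1 \<in> cells K (?u \<odot> t) (a \<odot> q1)" using rwhisker_cells[OF psi(1) X(4) q1] S1(5) by simp
    obtain t' \<nu> where t': "t' \<in> hom K (Dom K q1) (Dom K ?u)" and \<nu>: "\<nu> \<in> cells K t t'"
      and t'_eq: "?u \<odot> t' = a \<odot> q1" and \<nu>_eq: "?u \<rhd> \<nu> = \<psi> \<lhd> q1" using opfib_lift[OF u S1(3) \<psi>q1] .
    have Da: "Dom K a = Cod K q" using S(4) by (simp add: hom_def)
    obtain j where j: "j \<in> hom K (Dom K q1) (Dom K q)" "a' \<odot> j = t'" "q \<odot> j = q1"
      using pullback_factor[OF pb t' q1[folded Da] t'_eq] .
    have n: "square_cell K q1 ?u t x t' a \<nu> \<psi>"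
      using \<nu> \<nu>_eq psi(1) pullback_square[OF pb1] square_Cmp[OF G(1) sqj[OF j(1,3)]] j(2) Cmp_Id1[OF S(4)]
      by (simp add: square_cell_def)
    have "square_cell K q1 ?u t' a (x' \<odot> j) x (\<gamma>' \<lhd> j) \<gamma>"
      using square_cell_rwhisker[OF g sqj[OF j(1,3)]] j(2) Cmp_Id1[OF S(4)] Cmp_Id1[OF X(4)]
        Hcmp_Id1[OF G(4) S(4)] by simp
    from square_cell_Vcmp[OF this n, unfolded psi(3)]
    have xj: "x' \<odot> j = t" by (rule opfib_square_cell_Id2[OF u])
    have "square_cell K q ?u x' x (t' \<odot> \<delta>) a (\<nu> \<lhd> \<delta>) \<psi>"
      using square_cell_rwhisker[OF n sq\<delta>] \<delta>(2) Cmp_Id1[OF S(4)] Cmp_Id1[OF X(4)]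
        Hcmp_Id1[OF psi(1) X(4)] by simp
    from square_cell_Vcmp[OF this g, unfolded psi(2)]
    have td: "t' \<odot> \<delta> = a'" by (rule opfib_square_cell_Id2[OF u])
    have "\<delta> \<odot> j = Id1 K (Dom K q1)"
    proof (rule pullback_monic[OF pb1 Cmp_hom[OF \<delta>(1) j(1)] Id1_hom[OF O(3)]])
      show "t \<odot> \<delta> \<odot> j = t \<odot> Id1 K (Dom K q1)"
        by (simp only: Cmp_assoc[symmetric, OF S1(3) \<delta>(1) j(1)] \<delta>(2) xj Cmp_Id1[OF S1(3)])
      show "q1 \<odot> \<delta> \<odot> j = q1 \<odot> Id1 K (Dom K q1)"
        by (simp only: Cmp_assoc[symmetric, OF q1 \<delta>(1) j(1)] \<delta>(3) j(3) Cmp_Id1[OF q1])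
    qed
    moreover have "j \<odot> \<delta> = Id1 K (Dom K q)"
    proof (rule pullback_monic[OF pb Cmp_hom[OF j(1) \<delta>(1)] Id1_hom[OF O(1)]])
      show "a' \<odot> j \<odot> \<delta> = a' \<odot> Id1 K (Dom K q)"
        by (simp only: Cmp_assoc[symmetric, OF S(3) j(1) \<delta>(1)] j(2) td Cmp_Id1[OF S(3)])
      show "q \<odot> j \<odot> \<delta> = q \<odot> Id1 K (Dom K q)"
        by (simp only: Cmp_assoc[symmetric, OF S(1) j(1) \<delta>(1)] j(3) \<delta>(3) Cmp_Id1[OF S(1)])
    qed
    moreover have "iso2 K (Id2 K (Id1 K (Dom K q)))"
      using Id2_hom_cells[OF Id1_hom[OF O(1)]] iso2_cells Id2_Vcmp by blast
    ultimately show "split_equivalence K \<delta>"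
      using j(1) D\<delta> Id2_hom_cells[OF Id1_hom[OF O(1)]] unfolding split_equivalence_def
      by (auto intro!: bexI[of _ j] bexI[of _ "Id2 K (Id1 K (Dom K q))"])
  next
    assume "split_equivalence K \<delta>"
    then obtain j \<theta> where j: "j \<in> hom K (Dom K q1) (Dom K q)" "\<delta> \<odot> j = Id1 K (Dom K q1)"
      and \<theta>: "\<theta> \<in> cells K (j \<odot> \<delta>) (Id1 K (Dom K q))"
      using D\<delta> unfolding split_equivalence_def by auto
    let ?s = "j \<odot> \<delta>"
    have s: "?s \<in> hom K (Dom K q) (Dom K q)" by (rule Cmp_hom[OF j(1) \<delta>(1)])
    have qj: "q \<odot> j = q1" using Cmp_assoc[OF q1 \<delta>(1) j(1)] unfolding \<delta>(3) j(2) Cmp_Id1[OF q1] .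
    have qs: "q \<odot> ?s = q" by (simp only: Cmp_assoc[symmetric, OF S(1) j(1) \<delta>(1)] qj \<delta>(3))
    have "?s \<odot> ?s = j \<odot> (\<delta> \<odot> j) \<odot> \<delta>" by (simp only: Cmp_assoc[OF j(1) \<delta>(1) s] Cmp_assoc[OF \<delta>(1) j(1) \<delta>(1)])
    then have ss: "?s \<odot> ?s = ?s" using j(2) Id1_Cmp[OF \<delta>(1)] by simp
    \<comment> \<open>Both \<open>\<theta>\<close> and its whiskering with the idempotent \<open>s\<close> start at \<open>s\<close> and lie over the same 2-cell,
      so their targets, the identity and \<open>s\<close>, agree.\<close>
    have "?s \<rhd> \<theta> \<in> cells K ?s ?s" using lwhisker_cells[OF s \<theta> s] ss Cmp_Id1[OF s] by simp
    moreover have "q \<rhd> ?s \<rhd> \<theta> = q \<rhd> \<theta>" using lwhisker_Cmp[OF S(1) s \<theta> s] qs by simp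
    ultimately have s1: "?s = Id1 K (Dom K q)" using pullback_opfib_faithful[OF u pb s _ \<theta>] by simp
    \<comment> \<open>The inverse of \<open>\<gamma>\<close> comes from initiality of the pullback square out of \<open>q1\<close>.\<close>
    have aj: "square K q1 ?u (a' \<odot> j) a" using square_Cmp[OF G(1) sqj[OF j(1) qj]] Cmp_Id1[OF S(4)] by simp
    obtain \<psi>' \<psi> where p: "square_cell K q1 ?u t x (a' \<odot> j) a \<psi>' \<psi>"
      using initial_squareE[OF pullback_initial_square[OF pb1] aj] .
    note P = square_cellD[OF p]
    have xj: "x' \<odot> j = t" using Cmp_assoc[OF S1(3) \<delta>(1) j(1)] unfolding \<delta>(2) j(2) Cmp_Id1[OF S1(3)] .
    have "square_cell K q1 ?u (a' \<odot> j) a t x (\<gamma>' \<lhd> j) \<gamma>"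
      using square_cell_rwhisker[OF g sqj[OF j(1) qj]] xj Cmp_Id1[OF S(4)] Cmp_Id1[OF X(4)]
        Hcmp_Id1[OF G(4) S(4)] by simp
    from initial_square_unique(2)[OF pullback_initial_square[OF pb1] square_cell_Vcmp[OF this p]
        square_cell_Id2[OF pullback_square[OF pb1]]]
    have 1: "\<gamma> \<bullet> \<psi> = Id2 K x" .
    have ajd: "(a' \<odot> j) \<odot> \<delta> = a'" by (simp only: Cmp_assoc[OF S(3) j(1) \<delta>(1)] s1 Cmp_Id1[OF S(3)])
    have "square_cell K q ?u x' x a' a (\<psi>' \<lhd> \<delta>) \<psi>"
      using square_cell_rwhisker[OF p sq\<delta>] \<delta>(2) ajd Cmp_Id1[OF S(4)] Cmp_Id1[OF X(4)]
        Hcmp_Id1[OF P(4) X(4)] by simp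
    from initial_square_unique(2)[OF pullback_initial_square[OF pb] square_cell_Vcmp[OF this g]
        square_cell_Id2[OF G(1)]]
    have 2: "\<psi> \<bullet> \<gamma> = Id2 K a" .
    show "iso2 K \<gamma>" using iso2_cells[OF G(4)] P(4) 1 2 by blast
  qed
qed

end

section \<open>The lax algebra structure of the classifier\<close>

locale opfibrantly_cartesian_2monad = enhanced_2classifier K C + enhanced_2monad K M
  for K :: "('o, 'm, 'c, 'x) plumbus_scheme" (structure) and C :: "'m classifier"
    and M :: "('o, 'm, 'c) monad_data" +
  assumes opfibrantly_cartesian: "opfibrantly_cartesian K M C"
begin

lemma T1_clsf_Small: "T1 M (clsf C) \<in> Small K"
  using opfibrantly_cartesian by (simp add: opfibrantly_cartesian_def)

text \<open>
  Applied repeatedly, this makes the sources of all 2-cells in the axioms for \<open>\<Omega>\<close> and for classifying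
  maps initial.
\<close>

lemma pullback_T1:
  assumes "pullback K (clsf C) a a' q"
  shows "pullback K (clsf C) (dmap C (T1 M (clsf C)) \<odot> T1 M a) (dtop C (T1 M (clsf C)) \<odot> T1 M a') (T1 M q)"
  using assms opfibrantly_cartesian
  by (intro pullback_paste[OF classify[OF T1_clsf_Small]]) (simp add: opfibrantly_cartesian_def)

lemma act_square: "square K (T1 M (clsf C)) (clsf C) (dtop C (T1 M (clsf C))) (dmap C (T1 M (clsf C)))"
  by (rule dmap_square[OF T1_clsf_Small])

lemma canonical_cells:
  "algebra_cells K M (clsf C) (act (Omega_top K M C)) (act (Omega K M C))
    (unitor (Omega_top K M C)) (unitor (Omega K M C)) (multor (Omega_top K M C)) (multor (Omega K M C))"
proof -
  let ?u = "clsf C" and ?w' = "dtop C (T1 M (clsf C))" and ?w = "dmap C (T1 M (clsf C))"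
  note u = Small_Loose[OF clsf_Small]
  have sq: "square K ?u ?u (?w' \<odot> eta M (Dom K ?u)) (?w \<odot> eta M (Cod K ?u))"
    by (rule square_Cmp[OF act_square square_eta[OF u]])
  note I = square_Id1[OF u]
  have "\<exists>!\<upsilon>\<upsilon>. square_cell K ?u ?u (Id1 K (Dom K ?u)) (Id1 K (Cod K ?u))
      (?w' \<odot> eta M (Dom K ?u)) (?w \<odot> eta M (Cod K ?u)) (fst \<upsilon>\<upsilon>) (snd \<upsilon>\<upsilon>)"
    using pullback_initial_square[OF pullback_Id1[OF u]] sq by (simp add: initial_square_def)
  from theI'[OF this] have unit: "square_cell K ?u ?u (Id1 K (Dom K ?u)) (Id1 K (Cod K ?u))
      (?w' \<odot> eta M (Dom K ?u)) (?w \<odot> eta M (Cod K ?u))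
      (fst (canonical_unitors K M C)) (snd (canonical_unitors K M C))"
    using I sq by (simp add: canonical_unitors_def Let_def square_cell_def case_prod_unfold)
  have sqT: "square K (T1 M (T1 M ?u)) ?u (?w' \<odot> T1 M ?w') (?w \<odot> T1 M ?w)"
    by (rule square_Cmp[OF act_square square_T1[OF act_square]])
  have sqm: "square K (T1 M (T1 M ?u)) ?u (?w' \<odot> mul M (Dom K ?u)) (?w \<odot> mul M (Cod K ?u))"
    by (rule square_Cmp[OF act_square square_mul[OF u]])
  have "\<exists>!\<mu>\<mu>. square_cell K (T1 M (T1 M ?u)) ?u (?w' \<odot> T1 M ?w') (?w \<odot> T1 M ?w)
      (?w' \<odot> mul M (Dom K ?u)) (?w \<odot> mul M (Cod K ?u)) (fst \<mu>\<mu>) (snd \<mu>\<mu>)"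
    using pullback_initial_square[OF pullback_T1[OF classify[OF T1_clsf_Small]]] sqm
    by (simp add: initial_square_def)
  from theI'[OF this] have "square_cell K (T1 M (T1 M ?u)) ?u (?w' \<odot> T1 M ?w') (?w \<odot> T1 M ?w)
      (?w' \<odot> mul M (Dom K ?u)) (?w \<odot> mul M (Cod K ?u))
      (fst (canonical_multors K M C)) (snd (canonical_multors K M C))"
    using sqT sqm by (simp add: canonical_multors_def Let_def square_cell_def case_prod_unfold)
  then show ?thesis using unit act_square
    by (simp add: algebra_cells_def Omega_def Omega_top_def)
qed

text \<open>
  Tightness of \<open>\<omega>\<^sub>\<bullet>\<close> follows from that of \<open>\<omega>\<close>, as \<open>u \<odot> \<omega>\<^sub>\<bullet> = \<omega> \<odot> T u\<close> and \<open>u\<close> detects tightness.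
\<close>

lemma Omega_lax_algebras: "lax_algebra K M (Omega_top K M C)" "lax_algebra K M (Omega K M C)"
proof -
  let ?u = "clsf C" and ?A' = "Omega_top K M C" and ?A = "Omega K M C"
  note u = Small_Loose[OF clsf_Small]
  have carr: "carr ?A' = Dom K ?u" "carr ?A = Cod K ?u" by (simp_all add: Omega_def Omega_top_def)
  have act: "act ?A' = dtop C (T1 M ?u)" "act ?A = dmap C (T1 M ?u)"
    by (simp_all add: Omega_def Omega_top_def)
  note A = algebra_cellsD[OF canonical_cells]
  have tight: "act ?A \<in> Tight K" using opfibrantly_cartesian act by (simp add: opfibrantly_cartesian_def)
  have "T1 M ?u \<in> Tight K"
    using Small_opfib[OF T1_clsf_Small] by (simp add: tight_discrete_opfibration_def)
  then have "?u \<odot> act ?A' \<in> Tight K"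
    using Cmp_Tight[OF tight] A(6) Cod_T1[OF u] squareD(5)[OF A(2)] by (simp add: hom_def)
  then have tight': "act ?A' \<in> Tight K" by (rule Small_detects_Tight[OF clsf_Small A(5)])
  note pb = classify[OF T1_clsf_Small, folded act]
  note init1 = pullback_initial_square[OF pb]
  note init3 = pullback_initial_square[OF pullback_T1[OF pullback_T1[OF pb]], folded act]
  note U = algebra_unit_cells[OF canonical_cells] and V = algebra_assoc_cells[OF canonical_cells]
  note id = square_cell_Id2[OF A(2)]
  note e1 = initial_square_unique[OF init1 U(1) id] and e2 = initial_square_unique[OF init1 U(2) id]
    and e3 = initial_square_unique[OF init3 V]
  note O = hom_Obj[OF Loose_hom[OF u]]
  show "lax_algebra K M ?A'" unfolding lax_algebra_def Let_def carr
    using O A(5) tight' square_cellD(3)[OF A(3)] square_cellD(3)[OF A(4)] e1(1) e2(1) e3(1) by simp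
  show "lax_algebra K M ?A" unfolding lax_algebra_def Let_def carr
    using O A(6) tight square_cellD(4)[OF A(3)] square_cellD(4)[OF A(4)] e1(2) e2(2) e3(2) by simp
qed

lemma lax_clsf_strict: "strict_morphism K M (lax_clsf K M C)"
proof -
  have "clsf C \<in> hom K (carr (Omega_top K M C)) (carr (Omega K M C))"
    using opfib_hom[OF clsf_opfib] by (simp add: Omega_def Omega_top_def)
  then show ?thesis
    unfolding lax_clsf_def using strict_lmor_algebra_cells[OF Omega_lax_algebras] canonical_cells by simp
qed

section \<open>Classifying maps of strict discrete opfibrations\<close>

text \<open>
  The source and the target of the structure cells of the classifying pair of \<open>p\<close>; the first is
  initial, so these cells exist uniquely.
\<close>

lemma classifying_cell_source_target:
  assumes P: "strict_morphism K M (strict_lmor K E B p)" and p: "p \<in> Small K"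
  shows "initial_square K (T1 M p) (clsf C) (act (Omega_top K M C) \<odot> T1 M (dtop C p))
      (act (Omega K M C) \<odot> T1 M (dmap C p))"
    and "square K (T1 M p) (clsf C) (dtop C p \<odot> act E) (dmap C p \<odot> act B)"
  using pullback_initial_square[OF pullback_T1[OF classify[OF p]]]
    square_Cmp[OF dmap_square[OF p] strict_lmorD(6)[OF P]]
  by (simp_all add: Omega_def Omega_top_def)

lemma classifying_lax_morphisms:
  assumes P: "strict_morphism K M (strict_lmor K E B p)" and p: "p \<in> Small K"
    and c: "square_cell K (T1 M p) (clsf C) (act (Omega_top K M C) \<odot> T1 M (dtop C p))
      (act (Omega K M C) \<odot> T1 M (dmap C p)) (dtop C p \<odot> act E) (dmap C p \<odot> act B) \<gamma>' \<gamma>"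
  shows "lax_morphism K M \<lparr>ldom = E, lcod = Omega_top K M C, lmap = dtop C p, lcell = \<gamma>'\<rparr>"
    and "lax_morphism K M \<lparr>ldom = B, lcod = Omega K M C, lmap = dmap C p, lcell = \<gamma>\<rparr>"
proof -
  note S = strict_lmorD[OF P]
  have D: "Dom K p = carr E" "Cod K p = carr B" using S(3) by (simp_all add: hom_def)
  have act: "act (Omega_top K M C) = dtop C (T1 M (clsf C))" "act (Omega K M C) = dmap C (T1 M (clsf C))"
    and carr: "carr (Omega_top K M C) = Dom K (clsf C)" "carr (Omega K M C) = Cod K (clsf C)"
    by (simp_all add: Omega_def Omega_top_def)
  note sq = dmap_square[OF p]
  note U = morphism_unit_cells[OF S(5) canonical_cells sq c]
    and V = morphism_mult_cells[OF S(5) canonical_cells sq c]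
  note e1 = initial_square_unique[OF pullback_initial_square[OF classify[OF p]] U, unfolded D]
    and e2 = initial_square_unique[OF
      pullback_initial_square[OF pullback_T1[OF pullback_T1[OF classify[OF p]]], folded act] V, unfolded D]
  show "lax_morphism K M \<lparr>ldom = E, lcod = Omega_top K M C, lmap = dtop C p, lcell = \<gamma>'\<rparr>"
    "lax_morphism K M \<lparr>ldom = B, lcod = Omega K M C, lmap = dmap C p, lcell = \<gamma>\<rparr>"
    using S(1,2) Omega_lax_algebras squareD(3,4)[OF sq] D carr square_cellD(3,4)[OF c] e1 e2
    by (simp_all add: lax_morphism_def Let_def)
qed

text \<open>
  Commutativity of the square in \<open>LaxAlg\<close> says on structure cells exactly that they form a 2-cell of
  the arrow 2-category, and a commuting square of this form is automatically a pullback.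
\<close>

lemma lax_classifying_square_iff:
  assumes P: "strict_morphism K M (strict_lmor K E B p)" and p: "p \<in> Small K"
  shows "lax_classifying_square K M C (strict_lmor K E B p) G H \<longleftrightarrow> (\<exists>\<gamma>' \<gamma>.
    G = \<lparr>ldom = E, lcod = Omega_top K M C, lmap = dtop C p, lcell = \<gamma>'\<rparr> \<and>
    H = \<lparr>ldom = B, lcod = Omega K M C, lmap = dmap C p, lcell = \<gamma>\<rparr> \<and>
    square_cell K (T1 M p) (clsf C) (act (Omega_top K M C) \<odot> T1 M (dtop C p))
      (act (Omega K M C) \<odot> T1 M (dmap C p)) (dtop C p \<odot> act E) (dmap C p \<odot> act B) \<gamma>' \<gamma>)"
    (is "?L \<longleftrightarrow> (\<exists>\<gamma>' \<gamma>. ?R \<gamma>' \<gamma>)")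
proof
  note S = strict_lmorD[OF P] and W = strict_lmorD[OF lax_clsf_strict[unfolded lax_clsf_def]]
  note I = classifying_cell_source_target[OF P p]
  assume ?L
  then have pb: "pullback (LaxAlg K M) (lax_clsf K M C) H G (strict_lmor K E B p)"
    and maps: "lmap G = dtop C p" "lmap H = dmap C p"
    by (simp_all add: lax_classifying_square_def strict_lmor_def)
  have sel: "ldom (strict_lmor K A A' f) = A" "lcod (strict_lmor K A A' f) = A'" for A A' f
    by (simp_all add: strict_lmor_def)
  have "H \<in> Loose (LaxAlg K M) \<and> Cod (LaxAlg K M) (lax_clsf K M C) = Cod (LaxAlg K M) H \<and>
      G \<in> hom (LaxAlg K M) (Dom (LaxAlg K M) (strict_lmor K E B p)) (Dom (LaxAlg K M) (lax_clsf K M C)) \<and>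
      strict_lmor K E B p \<in> hom (LaxAlg K M) (Dom (LaxAlg K M) (strict_lmor K E B p)) (Dom (LaxAlg K M) H) \<and>
      lax_clsf K M C \<odot>\<^bsub>LaxAlg K M\<^esub> G = H \<odot>\<^bsub>LaxAlg K M\<^esub> strict_lmor K E B p"
    using pb unfolding pullback_def by blast
  then have G: "lax_morphism K M G" "ldom G = E" "lcod G = Omega_top K M C"
    and H: "lax_morphism K M H" "B = ldom H" "Omega K M C = lcod H"
    and eq: "lax_Cmp K M (strict_lmor K (Omega_top K M C) (Omega K M C) (clsf C)) G =
      lax_Cmp K M H (strict_lmor K E B p)"
    unfolding hom_LaxAlg LaxAlg_simps lax_clsf_def sel mem_Collect_eq by iprover+
  note H = H(1) H(2,3)[symmetric]
  have "clsf C \<rhd> lcell G = lcell H \<lhd> T1 M p"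
    using eq lax_Cmp_strict_left[OF G(1,3) W(1,3)] lax_Cmp_strict_right[OF H(1,2) P]
    unfolding lax_clsf_def by simp
  then have "?R (lcell G) (lcell H)"
    using G H maps I lax_morphismD(4)[OF G(1)] lax_morphismD(4)[OF H(1)]
    by (simp add: square_cell_def initial_square_def)
  then show "\<exists>\<gamma>' \<gamma>. ?R \<gamma>' \<gamma>" by blast
next
  assume "\<exists>\<gamma>' \<gamma>. ?R \<gamma>' \<gamma>"
  then obtain \<gamma>' \<gamma> where R: "?R \<gamma>' \<gamma>" by blast
  then have c: "square_cell K (T1 M p) (clsf C) (act (Omega_top K M C) \<odot> T1 M (dtop C p))
      (act (Omega K M C) \<odot> T1 M (dmap C p)) (dtop C p \<odot> act E) (dmap C p \<odot> act B) \<gamma>' \<gamma>" by blast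
  have "pullback (LaxAlg K M) (lax_clsf K M C) H G (strict_lmor K E B p)"
    unfolding lax_clsf_def
    by (rule LaxAlg_pullback[OF P Small_opfib[OF p] lax_clsf_strict[unfolded lax_clsf_def] clsf_opfib
          classify[OF p]])
      (use R classifying_lax_morphisms[OF P p c] in auto)
  then show ?L using R by (simp add: lax_classifying_square_def strict_lmor_def)
qed

text \<open>
  Pasting the pullback of \<open>p\<close> along \<open>\<beta>\<close> with the classifying square of \<open>p\<close> gives the pullback of \<open>u\<close>
  along \<open>dp \<odot> \<beta>\<close>, so the cartesianness defect is the comparison map associated with \<open>\<gamma>\<close>.
\<close>

lemma T_cartesian_iff_iso2:
  assumes P: "strict_morphism K M (strict_lmor K E B p)" and p: "p \<in> Small K"
    and c: "square_cell K (T1 M p) (clsf C) (act (Omega_top K M C) \<odot> T1 M (dtop C p))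
      (act (Omega K M C) \<odot> T1 M (dmap C p)) (dtop C p \<odot> act E) (dmap C p \<odot> act B) \<gamma>' \<gamma>"
  shows "T_cartesian K M (strict_lmor K E B p) \<longleftrightarrow> iso2 K \<gamma>"
proof -
  note S = strict_lmorD[OF P]
  note b = lax_algebraD(2)[OF S(2)] and e = lax_algebraD(2)[OF S(1)]
  have D: "Dom K p = carr E" "Cod K p = carr B" using S(3) by (simp_all add: hom_def)
  let ?q = "PbProj K p (act B)" and ?t = "PbTop K p (act B)"
  have pb: "pullback K p (act B) ?t ?q"
    using chosen[OF p, of "act B"] b D by (simp add: left_tight_pullback_def)
  have Db: "Dom K (act B) = T0 M (carr B)" using b by (simp add: hom_def)
  have ex: "\<exists>!h. h \<in> hom K (T0 M (carr E)) (Dom K ?q) \<and> ?q \<odot> h = T1 M p \<and> ?t \<odot> h = act E"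
  proof -
    obtain h where h: "h \<in> hom K (T0 M (carr E)) (Dom K ?q)" "?t \<odot> h = act E" "?q \<odot> h = T1 M p"
      using pullback_factor[OF pb, of "act E" "T0 M (carr E)" "T1 M p"] e T1_hom[OF S(3)] D Db
        squareD(5)[OF S(6)] by metis
    moreover have "k = h" if "k \<in> hom K (T0 M (carr E)) (Dom K ?q)" "?t \<odot> k = act E" "?q \<odot> k = T1 M p" for k
      using pullback_monic[OF pb that(1) h(1)] that h by simp
    ultimately show ?thesis by blast
  qed
  let ?\<delta> = "cartesianness_defect K M (strict_lmor K E B p)"
  have \<delta>: "?\<delta> \<in> hom K (T0 M (carr E)) (Dom K ?q)" "?q \<odot> ?\<delta> = T1 M p" "?t \<odot> ?\<delta> = act E"
    using theI'[OF ex] by (simp_all add: cartesianness_defect_def Let_def strict_lmor_def)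
  have DT: "Dom K (T1 M p) = T0 M (carr E)" using Dom_T1[OF hom_Loose[OF S(3)]] D by simp
  note pbu = classify[OF p]
  have "(dtop C p \<odot> ?t) \<odot> ?\<delta> = dtop C p \<odot> act E"
    using Cmp_assoc[OF squareD(3)[OF pullback_square[OF pbu]] squareD(3)[OF pullback_square[OF pb]] \<delta>(1)] \<delta>(3)
    by simp
  moreover have "pullback K (clsf C) (act (Omega K M C) \<odot> T1 M (dmap C p))
      (act (Omega_top K M C) \<odot> T1 M (dtop C p)) (T1 M p)"
    using pullback_T1[OF pbu] by (simp add: Omega_def Omega_top_def)
  ultimately have "iso2 K \<gamma> \<longleftrightarrow> split_equivalence K ?\<delta>"
    using iso2_iff_comparison_split_equivalence[OF _ c pullback_paste[OF pbu pb]] \<delta> DT by simp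
  then show ?thesis using P by (simp add: T_cartesian_def)
qed

theorem classifying_map_pseudo_iff_T_cartesian:
  assumes P: "strict_morphism K M (strict_lmor K E B p)" and p: "p \<in> Small K"
  shows "\<exists>G H. lax_classifying_square K M C (strict_lmor K E B p) G H \<and>
    (\<forall>G' H'. lax_classifying_square K M C (strict_lmor K E B p) G' H' \<longrightarrow> G' = G \<and> H' = H) \<and>
    H \<in> hom (LaxAlg K M) B (Omega K M C) \<and> lax_morphism K M H \<and>
    (pseudo_morphism K M H \<longleftrightarrow> T_cartesian K M (strict_lmor K E B p))"
proof -
  note I = classifying_cell_source_target[OF P p]
  obtain \<gamma>' \<gamma> where c: "square_cell K (T1 M p) (clsf C) (act (Omega_top K M C) \<odot> T1 M (dtop C p))
      (act (Omega K M C) \<odot> T1 M (dmap C p)) (dtop C p \<odot> act E) (dmap C p \<odot> act B) \<gamma>' \<gamma>"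
    using initial_squareE[OF I] .
  let ?G = "\<lparr>ldom = E, lcod = Omega_top K M C, lmap = dtop C p, lcell = \<gamma>'\<rparr>"
    and ?H = "\<lparr>ldom = B, lcod = Omega K M C, lmap = dmap C p, lcell = \<gamma>\<rparr>"
  note lax = classifying_lax_morphisms[OF P p c]
  have "lax_classifying_square K M C (strict_lmor K E B p) ?G ?H"
    using lax_classifying_square_iff[OF P p] c by blast
  moreover have "G' = ?G \<and> H' = ?H" if "lax_classifying_square K M C (strict_lmor K E B p) G' H'" for G' H'
    using that initial_square_unique[OF I(1) _ c] unfolding lax_classifying_square_iff[OF P p] by auto
  moreover have "?H \<in> hom (LaxAlg K M) B (Omega K M C)" using lax by (simp add: hom_LaxAlg)
  moreover have "pseudo_morphism K M ?H \<longleftrightarrow> T_cartesian K M (strict_lmor K E B p)"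
    using lax T_cartesian_iff_iso2[OF P p c] by (simp add: pseudo_morphism_def)
  ultimately show ?thesis using lax by blast
qed

end

theorem corollary6p25:
  fixes K :: "('o, 'm, 'c) plumbus"
    and C :: "'m classifier"
    and M :: "('o, 'm, 'c) monad_data"
    and X B :: "('o, 'm, 'c) lalg"
    and F P :: "('o, 'm, 'c) lmor"
    and b d0 d1 :: 'm
    and bb \<kappa> \<upsilon> \<mu> :: 'c
  assumes "representable_plumbus K C"
    and "enhanced_2monad K M"
    and "opfibrantly_cartesian K M C"
    and "F = \<lparr>ldom = X, lcod = B, lmap = b, lcell = bb\<rparr>"
    and "colax_morphism K M F"
    and "comma_object K b (Id1 K (carr B)) d0 d1 \<kappa>"
    and "P = strict_lmor K (comma_algebra K M F d0 d1 \<kappa> \<upsilon> \<mu>) B d1"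
    and "P \<in> LaxAlg_Small K M"
  shows "\<exists>G H. lax_classifying_square K M C P G H \<and>
    (\<forall>G' H'. lax_classifying_square K M C P G' H' \<longrightarrow> G' = G \<and> H' = H) \<and>
    H \<in> hom (LaxAlg K M) B (Omega K M C) \<and> lax_morphism K M H \<and>
    (pseudo_morphism K M H \<longleftrightarrow> T_cartesian K M P)"
proof -
  interpret representable_plumbus K C by fact
  interpret enhanced_2monad K M by fact
  interpret opfibrantly_cartesian_2monad K C M by unfold_locales fact
  have "strict_morphism K M P" "d1 \<in> Small K"
    using assms(7,8) by (simp_all add: LaxAlg_Small_def strict_lmor_def)
  then show ?thesis unfolding assms(7) by (rule classifying_map_pseudo_iff_T_cartesian)
qed

end
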